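(* Let $f\colon\mathbb{N}\to [0,1]$, and suppose $\mathbf{N} = (N_s)_{s \in \mathbb{N}}$, $\mathbf{K}^+=(K^+_s)_{s\in\mathbb{N}}$, and $\mathbf{K}^-=(K^-_s)_{s\in\mathbb{N}}$ are sequences in $\mathbb{N}$ satisfying $1\prec \mathbf{K}^-\prec \mathbf{K}^+\preceq \mathbf{N}$. After replacing $(\mathbf{N},\mathbf{K}^+,\mathbf{K}^-)$ by a subsequence if necessary, there exist sequences $\mathbf{H}^+ = (H_s^+)_{s \in \mathbb{N}}$ and $\mathbf{H}^- = (H_s^-)_{s \in \mathbb{N}}$ with $\mathbf{K}^-\preceq \mathbf{H}^-\prec \mathbf{H}^+\preceq \mathbf{K}^+$ such that for any $\mathbf{H}=(H_s)_{s\in\mathbb{N}}$ with $\mathbf{H}^-\prec \mathbf{H}\prec \mathbf{H}^+$ the pair $(\mathbf{N},\mathbf{H})$ is a $U^2$ good scale for $f$.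
   Context: Sequence order: $1\prec\mathbf{H}$ means $H_s\to\infty$; $\mathbf{H}\preceq\mathbf{N}$ means $H_s\le N_s$ for large $s$; $\mathbf{H}\prec\mathbf{N}$ means $H_s/N_s\to0$; subsequence of a tuple = common reindexing along a strictly increasing map. $[M]=\{1,\dots,M\}$, $e(x)=e^{2\pi ix}$, $\|x\|_{\mathbb{T}}$ = distance from $x$ to the nearest integer. $\mathbb{E}_{n\in\mathbf{N}}a(n)=\lim_s\frac1{N_s}\sum_{n=1}^{N_s}a(n)$, $\|g\|_{2,\mathbf{N}}=(\mathbb{E}_{n\in\mathbf{N}}|g(n)|^2)^{1/2}$. For $u\colon\mathbb{Z}/M\mathbb{Z}\to\mathbb{C}$, $\|u\|_{U^2(\mathbb{Z}/M\mathbb{Z})}^4=\frac1{M^3}\sum_{x,h_1,h_2}u(x)\overline{u(x+h_1)}\,\overline{u(x+h_2)}u(x+h_1+h_2)$. For $g\colon\mathbb{N}\to\mathbb{C}$ and an interval $\{x+1,\dots,x+L\}$, $\|g\|_{U^2(\{x+1,\dots,x+L\})}=\|\tilde g\|_{U^2(\mathbb{Z}/M\mathbb{Z})}/\|1_{[L]}\|_{U^2(\mathbb{Z}/M\mathbb{Z})}$ where $M\ge4L$ and $\tilde g(n)=1_{[L]}(n)g(x+n)$. For $1\prec\mathbf{H}\preceq\mathbf{N}$: $\|g\|_{U^2(\mathbf{N},\mathbf{H})}=\lim_s\frac{1}{N_s-H_s+1}\sum_{n=1}^{N_s-H_s+1}\|g\|_{U^2(\{n,\dots,n+H_s-1\})}$.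 $(\mathbf{N},\mathbf{H})$ is a $U^2$ good scale for $f\colon\mathbb{N}\to[0,1]$ if there is a decomposition $f=f_{\mathrm{str}}+f_{\mathrm{unf}}$ with: (i) $f_{\mathrm{str}}$ takes values in $[0,1]$ and $\mathbb{E}_{n\in\mathbf{N}}f_{\mathrm{unf}}(n)=0$; (ii) for every $\epsilon>0$ there exist $d\in\mathbb{N}$, $c_1,\dots,c_d\colon\mathbb{N}\to\mathbb{C}$ with $\|c_i\|_\infty\le1$ and $\alpha_1,\dots,\alpha_d\colon\mathbb{N}\to\mathbb{R}$ such that $\mathcal{P}(n)=\sum_{i=1}^dc_i(n)e(n\alpha_i(n))$ satisfies $\|\mathcal{P}-f_{\mathrm{str}}\|_{2,\mathbf{N}}\le\epsilon$, and moreover for every $C\ge1$ the sets $\Gamma_s^{(1)}=\{n\in[N_s-H_s+1]:\alpha_i(n+m_1)=\alpha_i(n+m_2)~\forall i\in[d],\forall m_1,m_2\in[H_s]\}$, $\Gamma_s^{(2)}$ (same with $c_i$ in place of $\alpha_i$), and $W_{s,C}=\{n\in[N_s-H_s+1]:$ for all $(w_1,\dots,w_d)\in[-C,C]^d\cap\mathbb{Z}^d$, either $\|\sum_iw_i\alpha_i(n)\|_{\mathbb{T}}\le\frac1{CH_s}$ or $\|\sum_iw_i\alpha_i(n)\|_{\mathbb{T}}\ge\frac{C}{H_s}\}$ each have cardinality $(1-o(1))(N_s-H_s+1)$ as $s\to\infty$; (iii) there is $\mathbf{H}'$ with $1\prec\mathbf{H}'\prec\mathbf{H}$ and $\|f_{\mathrm{unf}}\|_{U^2(\mathbf{N},\mathbf{H}')}=0$.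 *)

theory Defs
  imports Complex_Main
begin

text \<open>
  The natural numbers of the source are positive. Functions on them are rendered as functions on
  \<open>nat\<close> whose value at \<open>0\<close> is never constrained or used, and sequences in them as
  functions \<open>nat \<Rightarrow> nat\<close> with all values at least \<open>1\<close>.
\<close>

definition pos_seq :: "(nat \<Rightarrow> nat) \<Rightarrow> bool" where
  "pos_seq X \<longleftrightarrow> (\<forall>s. 1 \<le> X s)"

definition seq_at_top :: "(nat \<Rightarrow> nat) \<Rightarrow> bool" where
  "seq_at_top X \<longleftrightarrow> filterlim X at_top sequentially"

definition seq_le :: "(nat \<Rightarrow> nat) \<Rightarrow> (nat \<Rightarrow> nat) \<Rightarrow> bool" (infix "\<preceq>" 50) where
  "X \<preceq> Y \<longleftrightarrow> (\<forall>\<^sub>F s in sequentially. X s \<le> Y s)"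

definition seq_less :: "(nat \<Rightarrow> nat) \<Rightarrow> (nat \<Rightarrow> nat) \<Rightarrow> bool" (infix "\<prec>" 50) where
  "X \<prec> Y \<longleftrightarrow> (\<lambda>s. real (X s) / real (Y s)) \<longlonglongrightarrow> 0"

definition unit_exp :: "real \<Rightarrow> complex" where
  "unit_exp x = exp (2 * of_real pi * \<i> * of_real x)"

definition norm_T :: "real \<Rightarrow> real" where
  "norm_T x = \<bar>x - of_int (round x)\<bar>"

text \<open>
  Quantities defined as limits are predicates asserting that the limit exists and has the
  stated value.
\<close>

definition has_mean :: "(nat \<Rightarrow> nat) \<Rightarrow> (nat \<Rightarrow> real) \<Rightarrow> real \<Rightarrow> bool" where
  "has_mean N a l \<longleftrightarrow> (\<lambda>s. (1 / real (N s)) * (\<Sum>n=1..N s. a n)) \<longlonglongrightarrow> l"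

definition has_L2_norm :: "(nat \<Rightarrow> nat) \<Rightarrow> (nat \<Rightarrow> complex) \<Rightarrow> real \<Rightarrow> bool" where
  "has_L2_norm N g l \<longleftrightarrow> (\<exists>m. has_mean N (\<lambda>n. (cmod (g n))\<^sup>2) m \<and> l = sqrt m)"

text \<open>
  Functions on \<open>\<int>/M\<int>\<close> are given by their values on the residues \<open>0, \<dots>, M - 1\<close>.
  The sum below is real and nonnegative (lemma \<open>U2_cyclic_pow4_nonneg\<close>), so taking the real
  part loses nothing.
\<close>

definition U2_cyclic_pow4 :: "nat \<Rightarrow> (nat \<Rightarrow> complex) \<Rightarrow> complex" where
  "U2_cyclic_pow4 M u = 1 / of_nat M ^ 3 *
     (\<Sum>x<M. \<Sum>h1<M. \<Sum>h2<M.
        u x * cnj (u ((x + h1) mod M)) * cnj (u ((x + h2) mod M)) * u ((x + h1 + h2) mod M))"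

definition U2_cyclic :: "nat \<Rightarrow> (nat \<Rightarrow> complex) \<Rightarrow> real" where
  "U2_cyclic M u = root 4 (Re (U2_cyclic_pow4 M u))"

text \<open>
  The norm on \<open>{x + 1, \<dots>, x + L}\<close>, with the choice \<open>M = 4 * L\<close>; by lemma
  \<open>U2_interval_eq\<close> any \<open>M \<ge> 4 * L\<close> gives the same value.
\<close>

definition U2_interval :: "(nat \<Rightarrow> complex) \<Rightarrow> nat \<Rightarrow> nat \<Rightarrow> real" where
  "U2_interval g x L =
     U2_cyclic (4 * L) (\<lambda>n. of_bool (n \<in> {1..L}) * g (x + n)) /
     U2_cyclic (4 * L) (\<lambda>n. of_bool (n \<in> {1..L}))"

lemma sum_shift_mod:
  fixes F :: "nat \<Rightarrow> 'a::comm_monoid_add"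
  assumes "x < M"
  shows "(\<Sum>h<M. F ((x + h) mod M)) = (\<Sum>a<M. F a)"
proof (rule sum.reindex_bij_witness[where i = "\<lambda>a. (a + (M - x)) mod M" and j = "\<lambda>h. (x + h) mod M"])
  fix h assume "h \<in> {..<M}"
  moreover have "((x + h) mod M + (M - x)) mod M = (x + h + (M - x)) mod M"
    by (rule mod_add_left_eq)
  moreover have "x + h + (M - x) = h + M" using assms by simp
  ultimately show "((x + h) mod M + (M - x)) mod M = h"
    by (simp only: mod_add_self2 mod_less lessThan_iff)
next
  fix a assume "a \<in> {..<M}"
  moreover have "(x + (a + (M - x)) mod M) mod M = (x + (a + (M - x))) mod M"
    by (rule mod_add_right_eq)
  moreover have "x + (a + (M - x)) = a + M" using assms by simp
  ultimately show "(x + (a + (M - x)) mod M) mod M = a"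
    by (simp only: mod_add_self2 mod_less lessThan_iff)
qed (use assms in auto)

lemma U2_cyclic_pow4_alt:
  "U2_cyclic_pow4 M u = 1 / of_nat M ^ 3 *
     (\<Sum>x<M. \<Sum>a<M. \<Sum>b<M. u x * cnj (u a) * cnj (u b) * u ((a + b + (M - x)) mod M))"
proof -
  have "(\<Sum>h1<M. \<Sum>h2<M. u x * cnj (u ((x + h1) mod M)) * cnj (u ((x + h2) mod M)) * u ((x + h1 + h2) mod M))
      = (\<Sum>a<M. \<Sum>b<M. u x * cnj (u a) * cnj (u b) * u ((a + b + (M - x)) mod M))" if "x < M" for x
  proof -
    define F where "F a b = u x * cnj (u a) * cnj (u b) * u ((a + b + (M - x)) mod M)" for a b
    have "(x + h1 + h2) mod M = ((x + h1) mod M + (x + h2) mod M + (M - x)) mod M" for h1 h2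
    proof -
      have "((x + h1) mod M + (x + h2) mod M + (M - x)) mod M = ((x + h1) + (x + h2) + (M - x)) mod M"
        by (intro mod_add_cong[OF mod_add_eq refl])
      also have "(x + h1) + (x + h2) + (M - x) = x + h1 + h2 + M" using that by simp
      finally show ?thesis by simp
    qed
    note eq = this
    have "(\<Sum>h1<M. \<Sum>h2<M. u x * cnj (u ((x + h1) mod M)) * cnj (u ((x + h2) mod M)) * u ((x + h1 + h2) mod M))
       = (\<Sum>h1<M. \<Sum>h2<M. F ((x + h1) mod M) ((x + h2) mod M))"
      unfolding F_def by (intro sum.cong refl) (simp only: eq [symmetric])
    also have "\<dots> = (\<Sum>h1<M. \<Sum>b<M. F ((x + h1) mod M) b)"
      by (intro sum.cong refl sum_shift_mod[OF that])
    also have "\<dots> = (\<Sum>a<M. \<Sum>b<M. F a b)"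
      using sum_shift_mod[OF that, of "\<lambda>a. \<Sum>b<M. F a b"] .
    finally show ?thesis unfolding F_def .
  qed
  then show ?thesis unfolding U2_cyclic_pow4_def by simp
qed

lemma U2_cyclic_pow4_nonneg:
  "\<exists>r\<ge>0. U2_cyclic_pow4 M u = of_real r"
proof -
  define w where "w h x = u x * cnj (u ((x + h) mod M))" for h x
  have "(\<Sum>x<M. \<Sum>h1<M. \<Sum>h2<M.
        u x * cnj (u ((x + h1) mod M)) * cnj (u ((x + h2) mod M)) * u ((x + h1 + h2) mod M))
      = (\<Sum>x<M. \<Sum>h1<M. \<Sum>h2<M. w h1 x * cnj (w h1 ((x + h2) mod M)))"
  proof (intro sum.cong refl)
    fix x h1 h2
    have "((x + h2) mod M + h1) mod M = (x + h1 + h2) mod M"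
      by (simp add: mod_add_right_eq ac_simps)
    then show "u x * cnj (u ((x + h1) mod M)) * cnj (u ((x + h2) mod M)) * u ((x + h1 + h2) mod M)
        = w h1 x * cnj (w h1 ((x + h2) mod M))"
      by (simp add: w_def)
  qed
  also have "\<dots> = (\<Sum>x<M. \<Sum>h1<M. \<Sum>y<M. w h1 x * cnj (w h1 y))"
  proof -
    have "(\<Sum>h2<M. w h1 x * cnj (w h1 ((x + h2) mod M))) = (\<Sum>y<M. w h1 x * cnj (w h1 y))"
      if "x < M" for x h1
      using sum_shift_mod[OF that, of "\<lambda>y. w h1 x * cnj (w h1 y)"] .
    then show ?thesis by simp
  qed
  also have "\<dots> = (\<Sum>h1<M. \<Sum>x<M. \<Sum>y<M. w h1 x * cnj (w h1 y))"
    by (rule sum.swap)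
  also have "\<dots> = (\<Sum>h<M. (\<Sum>x<M. w h x) * cnj (\<Sum>x<M. w h x))"
    by (simp add: sum_product)
  also have "\<dots> = of_real (\<Sum>h<M. (cmod (\<Sum>x<M. w h x))\<^sup>2)"
    by (simp only: complex_norm_square [symmetric] of_real_sum)
  finally have "U2_cyclic_pow4 M u = of_real (1 / real M ^ 3 * (\<Sum>h<M. (cmod (\<Sum>x<M. w h x))\<^sup>2))"
    by (simp add: U2_cyclic_pow4_def)
  then show ?thesis by (intro exI[of _ "1 / real M ^ 3 * (\<Sum>h<M. (cmod (\<Sum>x<M. w h x))\<^sup>2)"]) (auto intro!: sum_nonneg divide_nonneg_nonneg)
qed

lemma U2_cyclic_pow4_supported:
  assumes "1 \<le> L" "4 * L \<le> M" and supp: "\<And>n. n \<notin> {1..L} \<Longrightarrow> u n = 0"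
  shows "U2_cyclic_pow4 M u = 1 / of_nat M ^ 3 *
    (\<Sum>x=1..L. \<Sum>a=1..L. \<Sum>b=1..L.
       u x * cnj (u a) * cnj (u b) * (if x \<le> a + b then u (a + b - x) else 0))"
proof -
  have sub: "{1..L} \<subseteq> {..<M}" using assms by auto
  have ind: "u ((a + b + (M - x)) mod M) = (if x \<le> a + b then u (a + b - x) else 0)"
    if "x \<in> {1..L}" "a \<in> {1..L}" "b \<in> {1..L}" for x a b
  proof (cases "x \<le> a + b")
    case True
    have "a + b + (M - x) = (a + b - x) + M" using that True assms by auto
    moreover have "a + b - x < M" using that assms by auto
    ultimately show ?thesis using True by (simp only: mod_add_self2 mod_less if_True)
  next
    case False
    have "a + b + (M - x) < M" using that False assms by auto
    moreover have "a + b + (M - x) \<notin> {1..L}" using that assms by auto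
    ultimately show ?thesis using False supp by simp
  qed
  have "(\<Sum>x<M. \<Sum>a<M. \<Sum>b<M. u x * cnj (u a) * cnj (u b) * u ((a + b + (M - x)) mod M))
     = (\<Sum>x=1..L. \<Sum>a=1..L. \<Sum>b=1..L. u x * cnj (u a) * cnj (u b) * u ((a + b + (M - x)) mod M))"
    by (intro sum.mono_neutral_cong_right sub finite_lessThan ballI sum.neutral) (auto simp: supp)
  also have "\<dots> = (\<Sum>x=1..L. \<Sum>a=1..L. \<Sum>b=1..L.
       u x * cnj (u a) * cnj (u b) * (if x \<le> a + b then u (a + b - x) else 0))"
    by (intro sum.cong refl) (simp only: ind)
  finally show ?thesis unfolding U2_cyclic_pow4_alt by simp
qed

lemma U2_interval_eq:
  assumes "1 \<le> L" "4 * L \<le> M"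
  shows "U2_interval g x L =
     U2_cyclic M (\<lambda>n. of_bool (n \<in> {1..L}) * g (x + n)) /
     U2_cyclic M (\<lambda>n. of_bool (n \<in> {1..L}))"
proof -
  define S where "S u = (\<Sum>x=1..L. \<Sum>a=1..L. \<Sum>b=1..L.
       u x * cnj (u a) * cnj (u b) * (if x \<le> a + b then u (a + b - x) else 0))"
    for u :: "nat \<Rightarrow> complex"
  have U: "U2_cyclic K u = root 4 (1 / real K ^ 3) * root 4 (Re (S u))"
    if "4 * L \<le> K" "\<And>n. n \<notin> {1..L} \<Longrightarrow> u n = 0" for K u
  proof -
    have "U2_cyclic_pow4 K u = of_real (1 / real K ^ 3) * S u"
      using U2_cyclic_pow4_supported[OF assms(1) that] by (simp add: S_def)
    then have "Re (U2_cyclic_pow4 K u) = 1 / real K ^ 3 * Re (S u)"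
      by (simp del: of_real_divide)
    then show ?thesis unfolding U2_cyclic_def by (simp only: real_root_mult)
  qed
  have nz: "root 4 (1 / real K ^ 3) \<noteq> 0" if "4 * L \<le> K" for K
    using that assms(1) by simp
  show ?thesis
    unfolding U2_interval_def using nz[OF assms(2)] nz[of "4 * L"] assms(2)
    by (subst (1 2 3 4) U) auto
qed

text \<open>
  In the following, \<open>N s - H s + 1\<close> is truncated only when \<open>N s < H s\<close>, which for
  \<open>H \<preceq> N\<close> happens for finitely many \<open>s\<close>. The interval
  \<open>{n, \<dots>, n + H s - 1}\<close> is \<open>{x + 1, \<dots>, x + L}\<close> with \<open>x = n - 1\<close>, \<open>L = H s\<close>.
\<close>

definition has_U2_norm :: "(nat \<Rightarrow> nat) \<Rightarrow> (nat \<Rightarrow> nat) \<Rightarrow> (nat \<Rightarrow> complex) \<Rightarrow> real \<Rightarrow> bool" where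
  "has_U2_norm N H g l \<longleftrightarrow>
     (\<lambda>s. (1 / real (N s - H s + 1)) * (\<Sum>n=1..N s - H s + 1. U2_interval g (n - 1) (H s)))
       \<longlonglongrightarrow> l"

definition trig_sum :: "nat \<Rightarrow> (nat \<Rightarrow> nat \<Rightarrow> complex) \<Rightarrow> (nat \<Rightarrow> nat \<Rightarrow> real) \<Rightarrow> nat \<Rightarrow> complex" where
  "trig_sum d c \<alpha> n = (\<Sum>i=1..d. c i n * unit_exp (real n * \<alpha> i n))"

text \<open>The sets \<open>\<Gamma>\<^sup>(\<^sup>1\<^sup>)\<close> and \<open>\<Gamma>\<^sup>(\<^sup>2\<^sup>)\<close> are the instances for \<open>\<alpha>\<close> and for \<open>c\<close>.\<close>

definition locally_constant_set ::
  "(nat \<Rightarrow> nat) \<Rightarrow> (nat \<Rightarrow> nat) \<Rightarrow> nat \<Rightarrow> (nat \<Rightarrow> nat \<Rightarrow> 'a) \<Rightarrow> nat \<Rightarrow> nat set" where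
  "locally_constant_set N H d a s =
     {n \<in> {1..N s - H s + 1}.
        \<forall>i\<in>{1..d}. \<forall>m1\<in>{1..H s}. \<forall>m2\<in>{1..H s}. a i (n + m1) = a i (n + m2)}"

definition well_spaced_set ::
  "(nat \<Rightarrow> nat) \<Rightarrow> (nat \<Rightarrow> nat) \<Rightarrow> nat \<Rightarrow> (nat \<Rightarrow> nat \<Rightarrow> real) \<Rightarrow> real \<Rightarrow> nat \<Rightarrow> nat set" where
  "well_spaced_set N H d \<alpha> C s =
     {n \<in> {1..N s - H s + 1}.
        \<forall>w :: nat \<Rightarrow> int. (\<forall>i\<in>{1..d}. - C \<le> of_int (w i) \<and> of_int (w i) \<le> C) \<longrightarrow>
          norm_T (\<Sum>i=1..d. of_int (w i) * \<alpha> i n) \<le> 1 / (C * real (H s)) \<or>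
          norm_T (\<Sum>i=1..d. of_int (w i) * \<alpha> i n) \<ge> C / real (H s)}"

definition almost_all ::
  "(nat \<Rightarrow> nat) \<Rightarrow> (nat \<Rightarrow> nat) \<Rightarrow> (nat \<Rightarrow> nat set) \<Rightarrow> bool" where
  "almost_all N H A \<longleftrightarrow> (\<lambda>s. real (card (A s)) / real (N s - H s + 1)) \<longlonglongrightarrow> 1"

definition U2_good_scale :: "(nat \<Rightarrow> nat) \<Rightarrow> (nat \<Rightarrow> nat) \<Rightarrow> (nat \<Rightarrow> real) \<Rightarrow> bool" where
  "U2_good_scale N H f \<longleftrightarrow>
     seq_at_top H \<and> H \<preceq> N \<and>
     (\<exists>f_str f_unf :: nat \<Rightarrow> real.
        (\<forall>n\<ge>1. f n = f_str n + f_unf n) \<and>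
        (\<forall>n\<ge>1. 0 \<le> f_str n \<and> f_str n \<le> 1) \<and>
        has_mean N f_unf 0 \<and>
        (\<forall>\<epsilon>>0. \<exists>d\<ge>1. \<exists>(c :: nat \<Rightarrow> nat \<Rightarrow> complex) (\<alpha> :: nat \<Rightarrow> nat \<Rightarrow> real).
           (\<forall>i\<in>{1..d}. \<forall>n\<ge>1. cmod (c i n) \<le> 1) \<and>
           (\<exists>l\<le>\<epsilon>. has_L2_norm N (\<lambda>n. trig_sum d c \<alpha> n - of_real (f_str n)) l) \<and>
           (\<forall>C\<ge>1. almost_all N H (locally_constant_set N H d \<alpha>) \<and>
                  almost_all N H (locally_constant_set N H d c) \<and>
                  almost_all N H (well_spaced_set N H d \<alpha> C))) \<and>
        (\<exists>H'. pos_seq H' \<and> seq_at_top H' \<and> H' \<prec> H \<and>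
              has_U2_norm N H' (\<lambda>n. of_real (f_unf n)) 0))"

end

theory Submission
  imports Defs "HOL-Complex_Analysis.Great_Picard"
begin

text \<open>
  Call a function on \<open>{1..N}\<close> structured at scale \<open>L\<close> with complexity \<open>d\<close> if it is a sum of \<open>d\<close> local
  characters \<open>c(n) e(n \<alpha>(n))\<close> whose data change at most \<open>d N / L\<close> times. The squared distance from
  \<open>f\<close> to this class is monotone in \<open>L\<close>, so a pigeonhole over scales gives a window
  \<open>[Hm, Hp]\<close> across which it is asymptotically constant for every \<open>d\<close>; let \<open>V\<close> be its limit as first
  \<open>s\<close>, then \<open>d\<close> tends to infinity. Nearly optimal structured functions at scale \<open>Hp\<close> are close to each
  other by the parallelogram law. They can be truncated to \<open>[0, 1]\<close>, because by Weierstrass the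
  truncation is a uniform limit of structured functions. Finally, \<open>f\<close> minus such a function cannot
  correlate with local characters even at the smaller scale \<open>Hm\<close>, since the distance \<open>V\<close> cannot
  be improved there, so its local \<open>U\<^sup>2\<close> norms at scale \<open>Hm\<close> are small. A second pigeonhole,
  for the proportion of \<open>n\<close> with \<open>norm_T (\<Sum>i. w i * \<alpha> i n) \<ge> 1 / L\<close>, shrinks the window so that
  the frequencies are well spaced. The structured function on \<open>{1..N s}\<close>, of complexity growing
  slowly with \<open>s\<close>, is used on \<open>{N (s - 1) + 1..N s}\<close> for a lacunary subsequence of \<open>N\<close>.
\<close>

section \<open>The inverse theorem for the U2 norm\<close>

text \<open>Structured functions of bounded complexity do not form a linear space, so there is no
  orthogonal projection onto them. What replaces it is a pair of facts about \<open>V\<close>: it is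
  almost attained at the coarse scale \<open>Hp\<close>, and it cannot be beaten at the fine scale
  \<open>Hm\<close>. The separation of scales is used from both sides. Breaks allowed at scale
  \<open>Hp\<close> are rare for windows of length \<open>H \<prec> Hp\<close>, and
  \<open>Hm\<close> itself serves as the smaller scale \<open>H'\<close> for every admissible
  \<open>H\<close> at once. The obstacle is uniformity: one function \<open>f_str\<close> must be
  approximable to every accuracy by sums whose complexity does not grow with \<open>s\<close>,
  although \<open>f_str\<close> is cut from functions of growing complexity. Hence a hierarchy of
  approximants, level \<open>j\<close> having excess \<open>1 / Suc j\<close> over \<open>V\<close>,
  is carried through all stages. Stage \<open>k\<close> truncates level \<open>k\<close>, and level
  \<open>j\<close> stays within about \<open>6 / Suc j\<close> of the result in mean square.
  Frequencies must exist before their spacing can be pigeonholed, so the window is shrunk once more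
  after the approximants are chosen.\<close>

lemma unit_exp_eq_cis: "unit_exp x = cis (2 * pi * x)"
  by (simp add: unit_exp_def cis_conv_exp mult_ac)

lemma unit_exp_add: "unit_exp (x + y) = unit_exp x * unit_exp y"
  by (simp add: unit_exp_eq_cis cis_mult distrib_left)

lemma norm_unit_exp [simp]: "cmod (unit_exp x) = 1"
  by (simp add: unit_exp_eq_cis)

lemma unit_exp_0 [simp]: "unit_exp 0 = 1"
  by (simp add: unit_exp_eq_cis)

lemma cnj_unit_exp: "cnj (unit_exp x) = unit_exp (- x)"
  by (simp add: unit_exp_eq_cis cis_cnj)

lemma unit_exp_power: "unit_exp x ^ k = unit_exp (real k * x)"
  by (simp add: unit_exp_eq_cis Complex.DeMoivre mult_ac)

lemma unit_exp_eq_1_iff: "unit_exp x = 1 \<longleftrightarrow> x \<in> \<int>"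
proof -
  have "unit_exp x = 1 \<longleftrightarrow> (\<exists>n::int. 2 * pi * x = 2 * pi * of_int n)"
    by (simp add: unit_exp_eq_cis complex_eq_iff cos_one_2pi_int mult_ac)
       (metis cos_one_2pi_int mult.commute mult.left_commute sin_cos_squared_add2
          cos_one_sin_zero)
  then show ?thesis by (auto simp: Ints_def)
qed

lemma sum_unit_exp_orthogonal:
  fixes k :: int
  assumes "M > 0"
  shows "(\<Sum>\<xi><M. unit_exp (real \<xi> * (of_int k / real M))) = (if int M dvd k then of_nat M else 0)"
proof -
  define z where "z = unit_exp (of_int k / real M)"
  have zM: "z ^ M = 1"
    using assms by (simp add: z_def unit_exp_power unit_exp_eq_1_iff)
  have z1: "z = 1 \<longleftrightarrow> int M dvd k"
  proof -
    have "of_int k / real M \<in> \<int> \<longleftrightarrow> int M dvd k"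
      using of_int_div_of_int_in_Ints_iff[where 'a = real, of k "int M"] assms by simp
    then show ?thesis by (simp add: z_def unit_exp_eq_1_iff)
  qed
  have "(\<Sum>\<xi><M. unit_exp (real \<xi> * (of_int k / real M))) = (\<Sum>\<xi><M. z ^ \<xi>)"
    by (simp add: z_def unit_exp_power)
  also have "\<dots> = (if int M dvd k then of_nat M else 0)"
    using z1 zM by (simp add: sum_gp_strict)
  finally show ?thesis .
qed

text \<open>Unnormalised discrete Fourier transform with a plus sign in the exponent. The phase is
  kept in the shape \<open>real \<xi> * (... / real M)\<close> so that sums over
  \<open>\<xi>\<close> match \<open>sum_unit_exp_orthogonal\<close> as they stand.\<close>

definition fourier_sum :: "nat \<Rightarrow> (nat \<Rightarrow> complex) \<Rightarrow> nat \<Rightarrow> complex" where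
  "fourier_sum M u \<xi> = (\<Sum>x<M. u x * unit_exp (real \<xi> * (real x / real M)))"

lemma cnj_fourier_sum:
  "cnj (fourier_sum M u \<xi>) = (\<Sum>x<M. cnj (u x) * unit_exp (real \<xi> * (- real x / real M)))"
  by (simp add: fourier_sum_def cnj_unit_exp)

lemma parseval_fourier_sum:
  assumes "M > 0"
  shows "(\<Sum>\<xi><M. (cmod (fourier_sum M u \<xi>))\<^sup>2) = real M * (\<Sum>x<M. (cmod (u x))\<^sup>2)"
proof -
  have "(\<Sum>\<xi><M. fourier_sum M u \<xi> * cnj (fourier_sum M u \<xi>))
     = (\<Sum>\<xi><M. \<Sum>x<M. \<Sum>y<M. u x * cnj (u y) * unit_exp (real \<xi> * (of_int (int x - int y) / real M)))"
    unfolding cnj_fourier_sum unfolding fourier_sum_def sum_product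
    by (intro sum.cong refl) (simp add: unit_exp_add[symmetric] algebra_simps diff_divide_distrib)
  also have "\<dots> = (\<Sum>x<M. \<Sum>y<M. u x * cnj (u y) *
       (\<Sum>\<xi><M. unit_exp (real \<xi> * (of_int (int x - int y) / real M))))"
    by (subst sum.swap, rule sum.cong[OF refl], subst sum.swap) (simp add: sum_distrib_left)
  also have "\<dots> = (\<Sum>x<M. \<Sum>y<M. if x = y then u x * cnj (u y) * of_nat M else 0)"
  proof (intro sum.cong refl)
    fix x y assume "x \<in> {..<M}" "y \<in> {..<M}"
    then have "int M dvd int x - int y \<longleftrightarrow> x = y"
      by (auto dest!: zdvd_imp_le[rotated] simp: zdvd_not_zless abs_if)
         (metis (no_types, opaque_lifting) int_ops(9) mod_eq_dvd_iff mod_less of_nat_eq_iff)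
    then show "u x * cnj (u y) * (\<Sum>\<xi><M. unit_exp (real \<xi> * (of_int (int x - int y) / real M)))
       = (if x = y then u x * cnj (u y) * of_nat M else 0)"
      by (simp only: sum_unit_exp_orthogonal[OF assms] mult_zero_right split: if_splits) simp
  qed
  also have "\<dots> = (\<Sum>x<M. of_real ((cmod (u x))\<^sup>2) * of_nat M)"
    by (intro sum.cong refl) (simp add: complex_norm_square del: of_real_power)
  finally have "of_real (\<Sum>\<xi><M. (cmod (fourier_sum M u \<xi>))\<^sup>2)
      = (of_real (real M * (\<Sum>x<M. (cmod (u x))\<^sup>2)) :: complex)"
    by (simp add: complex_norm_square[symmetric] sum_distrib_left mult.commute)
  then show ?thesis by (simp only: of_real_eq_iff)
qed

lemma sum_product4:
  fixes A B C G :: "'i \<Rightarrow> 'a :: comm_semiring_0"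
  shows "(\<Sum>x\<in>X. A x) * (\<Sum>x\<in>X. B x) * (\<Sum>x\<in>X. C x) * (\<Sum>x\<in>X. G x)
       = (\<Sum>x\<in>X. \<Sum>a\<in>X. \<Sum>b\<in>X. \<Sum>y\<in>X. A x * B a * C b * G y)"
proof -
  have "(\<Sum>x\<in>X. A x) * ((\<Sum>x\<in>X. B x) * ((\<Sum>x\<in>X. C x) * (\<Sum>x\<in>X. G x)))
       = (\<Sum>x\<in>X. \<Sum>a\<in>X. \<Sum>b\<in>X. \<Sum>y\<in>X. A x * (B a * (C b * G y)))"
    by (simp only: sum_product) (simp only: sum_distrib_left)
  then show ?thesis by (simp only: mult.assoc)
qed

text \<open>When the fourth power is expanded, orthogonality keeps the quadruples with
  \<open>x + y = a + b\<close> modulo \<open>M\<close>, and these are the parallelograms counted by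
  the U2 norm. The factor \<open>M ^ 4\<close> has three powers from the norm and one from
  orthogonality.\<close>

lemma U2_cyclic_pow4_fourier:
  assumes "M > 0"
  shows "Re (U2_cyclic_pow4 M u) = (\<Sum>\<xi><M. cmod (fourier_sum M u \<xi>) ^ 4) / real M ^ 4"
proof -
  define S where "S = (\<Sum>x<M. \<Sum>a<M. \<Sum>b<M. u x * cnj (u a) * cnj (u b) * u ((a + b + (M - x)) mod M))"
  have "(\<Sum>\<xi><M. fourier_sum M u \<xi> * cnj (fourier_sum M u \<xi>) * cnj (fourier_sum M u \<xi>) * fourier_sum M u \<xi>)
     = (\<Sum>\<xi><M. \<Sum>x<M. \<Sum>a<M. \<Sum>b<M. \<Sum>y<M. u x * cnj (u a) * cnj (u b) * u y *
          unit_exp (real \<xi> * (of_int (int x + int y - int a - int b) / real M)))"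
  proof (rule sum.cong[OF refl])
    fix \<xi>
    show "fourier_sum M u \<xi> * cnj (fourier_sum M u \<xi>) * cnj (fourier_sum M u \<xi>) * fourier_sum M u \<xi>
     = (\<Sum>x<M. \<Sum>a<M. \<Sum>b<M. \<Sum>y<M. u x * cnj (u a) * cnj (u b) * u y *
          unit_exp (real \<xi> * (of_int (int x + int y - int a - int b) / real M)))"
      unfolding cnj_fourier_sum unfolding fourier_sum_def sum_product4
    proof (intro sum.cong refl)
      fix x a b y
      have "unit_exp (real \<xi> * (of_int (int x + int y - int a - int b) / real M)) =
        unit_exp (real \<xi> * (real x / real M)) * unit_exp (real \<xi> * (- real a / real M)) *
        unit_exp (real \<xi> * (- real b / real M)) * unit_exp (real \<xi> * (real y / real M))"
        unfolding unit_exp_add[symmetric]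
        by (rule arg_cong[of _ _ unit_exp]) (simp add: algebra_simps diff_divide_distrib add_divide_distrib)
      then show "u x * unit_exp (real \<xi> * (real x / real M)) *
         (cnj (u a) * unit_exp (real \<xi> * (- real a / real M))) *
         (cnj (u b) * unit_exp (real \<xi> * (- real b / real M))) *
         (u y * unit_exp (real \<xi> * (real y / real M))) =
         u x * cnj (u a) * cnj (u b) * u y *
         unit_exp (real \<xi> * (of_int (int x + int y - int a - int b) / real M))"
        by (simp only: mult_ac)
    qed
  qed
  also have "\<dots> = (\<Sum>x<M. \<Sum>a<M. \<Sum>b<M. \<Sum>y<M. u x * cnj (u a) * cnj (u b) * u y *
       (\<Sum>\<xi><M. unit_exp (real \<xi> * (of_int (int x + int y - int a - int b) / real M))))"
    unfolding sum_distrib_left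
    by (subst sum.swap, rule sum.cong[OF refl], subst sum.swap, rule sum.cong[OF refl],
        subst sum.swap, rule sum.cong[OF refl], subst sum.swap, rule refl)
  also have "\<dots> = (\<Sum>x<M. \<Sum>a<M. \<Sum>b<M. u x * cnj (u a) * cnj (u b) * u ((a + b + (M - x)) mod M) * of_nat M)"
  proof (intro sum.cong refl)
    fix x a b assume xab: "x \<in> {..<M}" "a \<in> {..<M}" "b \<in> {..<M}"
    \<comment> \<open>The fourth vertex \<open>y\<close> is determined by the other three;
      \<open>M - x\<close> stands for \<open>- x\<close> so that the formula stays in the
      naturals.\<close>
    have dvd: "int M dvd int x + int y - int a - int b \<longleftrightarrow> y = (a + b + (M - x)) mod M"
      if "y \<in> {..<M}" for y
    proof -
      have "int M dvd int x + int y - int a - int b \<longleftrightarrow>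
          int M dvd int y - int (a + b + (M - x))"
      proof -
        have "int y - int (a + b + (M - x)) = (int x + int y - int a - int b) - int M"
          using xab by simp
        then show ?thesis by (metis dvd_diff_right_iff dvd_refl minus_diff_eq dvd_diff_commute)
      qed
      also have "\<dots> \<longleftrightarrow> int y mod int M = int (a + b + (M - x)) mod int M"
        by (simp add: mod_eq_dvd_iff)
      also have "\<dots> \<longleftrightarrow> y mod M = (a + b + (M - x)) mod M"
        by (metis of_nat_eq_iff zmod_int)
      finally show ?thesis using that by simp
    qed
    have "(\<Sum>y<M. u x * cnj (u a) * cnj (u b) * u y *
       (\<Sum>\<xi><M. unit_exp (real \<xi> * (of_int (int x + int y - int a - int b) / real M))))
      = (\<Sum>y<M. if y = (a + b + (M - x)) mod M then u x * cnj (u a) * cnj (u b) * u y * of_nat M else 0)"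
      by (intro sum.cong refl) (simp only: sum_unit_exp_orthogonal[OF assms] dvd split: if_splits, simp)
    also have "\<dots> = u x * cnj (u a) * cnj (u b) * u ((a + b + (M - x)) mod M) * of_nat M"
      using assms by (simp add: sum.delta)
    finally show "(\<Sum>y<M. u x * cnj (u a) * cnj (u b) * u y *
       (\<Sum>\<xi><M. unit_exp (real \<xi> * (of_int (int x + int y - int a - int b) / real M))))
      = u x * cnj (u a) * cnj (u b) * u ((a + b + (M - x)) mod M) * of_nat M" .
  qed
  also have "\<dots> = S * of_nat M"
    by (simp only: S_def sum_distrib_right)
  finally have *: "S * of_nat M = (\<Sum>\<xi><M. fourier_sum M u \<xi> * cnj (fourier_sum M u \<xi>) * cnj (fourier_sum M u \<xi>) * fourier_sum M u \<xi>)" ..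
  have "fourier_sum M u \<xi> * cnj (fourier_sum M u \<xi>) * cnj (fourier_sum M u \<xi>) * fourier_sum M u \<xi>
      = of_real (cmod (fourier_sum M u \<xi>) ^ 4)" for \<xi>
  proof -
    have "fourier_sum M u \<xi> * cnj (fourier_sum M u \<xi>) * cnj (fourier_sum M u \<xi>) * fourier_sum M u \<xi>
      = (fourier_sum M u \<xi> * cnj (fourier_sum M u \<xi>))\<^sup>2" by (simp add: power2_eq_square)
    also have "\<dots> = of_real (((cmod (fourier_sum M u \<xi>))\<^sup>2)\<^sup>2)"
      by (simp only: complex_norm_square[symmetric] of_real_power)
    finally show ?thesis by (simp add: power_mult[symmetric] del: of_real_power)
  qed
  with * have S: "S * of_nat M = of_real (\<Sum>\<xi><M. cmod (fourier_sum M u \<xi>) ^ 4)"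
    by (simp del: of_real_power)
  have "U2_cyclic_pow4 M u = 1 / of_nat M ^ 3 * S"
    unfolding U2_cyclic_pow4_alt S_def ..
  also have "\<dots> = (S * of_nat M) / of_nat M ^ 4"
    using assms by (simp add: field_simps power_numeral_reduce)
  also have "\<dots> = of_real ((\<Sum>\<xi><M. cmod (fourier_sum M u \<xi>) ^ 4) / real M ^ 4)"
    unfolding S by simp
  finally show ?thesis by (simp only: Re_complex_of_real)
qed

text \<open>Two of the four factors of the transform are bounded by their maximum and the other two
  are summed by Parseval, which gives \<open>A^2 / 64\<close>. For the indicator the zero frequency
  alone gives at least \<open>1 / 256\<close>. The quotient \<open>4 * A^2\<close> is relaxed to
  \<open>(2 * sqrt A) ^ 4\<close>. The exponential carries the absolute position
  \<open>x + m\<close>, as local characters do; this costs only a factor of modulus 1.\<close>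

lemma U2_interval_inverse:
  assumes "L \<ge> 1" and g: "\<And>m. m \<in> {1..L} \<Longrightarrow> cmod (g (x + m)) \<le> 1"
  shows "\<exists>\<beta>. U2_interval g x L
    \<le> 2 * sqrt (cmod (\<Sum>m=1..L. g (x + m) * unit_exp (real (x + m) * \<beta>)) / real L)"
proof -
  define M where "M = 4 * L"
  have M: "M > 0" using assms by (simp add: M_def)
  define u where "u n = of_bool (n \<in> {1..L}) * g (x + n)" for n
  define v where "v n = (of_bool (n \<in> {1..L}) :: complex)" for n :: nat
  define U where "U = fourier_sum M u"
  obtain \<xi> where \<xi>: "\<xi> < M" "\<And>\<zeta>. \<zeta> < M \<Longrightarrow> cmod (U \<zeta>) \<le> cmod (U \<xi>)"
  proof -
    define T where "T = (\<lambda>\<xi>. cmod (U \<xi>)) ` {..<M}"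
    have "finite T" "T \<noteq> {}" using M by (auto simp: T_def)
    then have "Max T \<in> T" "\<And>t. t \<in> T \<Longrightarrow> t \<le> Max T" by auto
    moreover from this obtain \<xi> where "Max T = cmod (U \<xi>)" "\<xi> < M" by (auto simp: T_def)
    ultimately show ?thesis using that[of \<xi>] unfolding T_def by (metis imageI lessThan_iff)
  qed
  define A where "A = cmod (U \<xi>) / real L"
  define \<beta> where "\<beta> = real \<xi> / real M"
  have u0: "u n = 0" if "n \<notin> {1..L}" for n using that by (simp add: u_def)
  have "(\<Sum>y<M. (cmod (u y))\<^sup>2) = (\<Sum>y=1..L. (cmod (u y))\<^sup>2)"
    by (intro sum.mono_neutral_right) (use u0 in \<open>auto simp: M_def\<close>)
  also have "\<dots> \<le> (\<Sum>y=1..L. 1)"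
    by (intro sum_mono) (use g in \<open>auto simp: u_def power_le_one\<close>)
  finally have u2: "(\<Sum>y<M. (cmod (u y))\<^sup>2) \<le> real L" by simp
  have "(\<Sum>\<zeta><M. cmod (U \<zeta>) ^ 4) \<le> (\<Sum>\<zeta><M. (cmod (U \<xi>))\<^sup>2 * (cmod (U \<zeta>))\<^sup>2)"
  proof (intro sum_mono)
    fix \<zeta> assume "\<zeta> \<in> {..<M}"
    then have "(cmod (U \<zeta>))\<^sup>2 \<le> (cmod (U \<xi>))\<^sup>2" using \<xi> by (intro power_mono) auto
    then have "(cmod (U \<zeta>))\<^sup>2 * (cmod (U \<zeta>))\<^sup>2 \<le> (cmod (U \<xi>))\<^sup>2 * (cmod (U \<zeta>))\<^sup>2"
      by (intro mult_right_mono) auto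
    then show "cmod (U \<zeta>) ^ 4 \<le> (cmod (U \<xi>))\<^sup>2 * (cmod (U \<zeta>))\<^sup>2"
      by (simp add: power_add[symmetric])
  qed
  also have "\<dots> = (cmod (U \<xi>))\<^sup>2 * (real M * (\<Sum>y<M. (cmod (u y))\<^sup>2))"
    using parseval_fourier_sum[OF M, of u] by (simp add: U_def sum_distrib_left[symmetric])
  also have "\<dots> \<le> (cmod (U \<xi>))\<^sup>2 * (real M * real L)"
    by (intro mult_left_mono u2) auto
  finally have num: "Re (U2_cyclic_pow4 M u) \<le> A\<^sup>2 / 64"
    unfolding U2_cyclic_pow4_fourier[OF M] U_def[symmetric]
    using assms(1) by (simp add: M_def A_def field_simps power_numeral_reduce)
  have "fourier_sum M v 0 = of_nat L"
  proof -
    have "fourier_sum M v 0 = (\<Sum>y<M. v y)" by (simp add: fourier_sum_def)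
    also have "\<dots> = (\<Sum>y=1..L. 1)"
      by (intro sum.mono_neutral_cong_right) (auto simp: M_def v_def)
    finally show ?thesis by simp
  qed
  then have "real L ^ 4 \<le> (\<Sum>\<xi><M. cmod (fourier_sum M v \<xi>) ^ 4)"
    using member_le_sum[of 0 "{..<M}" "\<lambda>\<xi>. cmod (fourier_sum M v \<xi>) ^ 4"] M by simp
  then have den: "1 / 256 \<le> Re (U2_cyclic_pow4 M v)"
    unfolding U2_cyclic_pow4_fourier[OF M]
    using assms(1) by (simp add: M_def field_simps)
  have "Re (U2_cyclic_pow4 M u) \<ge> 0"
    using U2_cyclic_pow4_nonneg[of M u] by auto
  then have "Re (U2_cyclic_pow4 M u) / Re (U2_cyclic_pow4 M v) \<le> (A\<^sup>2 / 64) / (1 / 256)"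
    using num den by (intro frac_le) auto
  also have "\<dots> \<le> (2 * sqrt A) ^ 4"
  proof -
    have "sqrt A ^ 4 = ((sqrt A)\<^sup>2)\<^sup>2" by (simp only: power_mult[symmetric]) simp
    also have "\<dots> = A\<^sup>2" by (simp add: A_def)
    finally show ?thesis by (simp add: power_mult_distrib)
  qed
  finally have "root 4 (Re (U2_cyclic_pow4 M u) / Re (U2_cyclic_pow4 M v)) \<le> root 4 ((2 * sqrt A) ^ 4)"
    by simp
  also have "\<dots> = 2 * sqrt A"
    by (intro real_root_power_cancel) (auto simp: A_def)
  finally have le: "U2_interval g x L \<le> 2 * sqrt A"
    unfolding U2_interval_def M_def[symmetric] U2_cyclic_def u_def[abs_def] v_def[abs_def]
    by (simp add: real_root_divide)
  have "U \<xi> = (\<Sum>m=1..L. g (x + m) * unit_exp (real m * \<beta>))"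
    unfolding U_def fourier_sum_def
    by (intro sum.mono_neutral_cong_right) (auto simp: M_def u_def \<beta>_def mult_ac)
  then have "(\<Sum>m=1..L. g (x + m) * unit_exp (real (x + m) * \<beta>)) = unit_exp (real x * \<beta>) * U \<xi>"
    by (simp add: sum_distrib_left distrib_right unit_exp_add) (simp add: mult_ac)
  then have "cmod (\<Sum>m=1..L. g (x + m) * unit_exp (real (x + m) * \<beta>)) = cmod (U \<xi>)"
    by (simp add: norm_mult)
  with le show ?thesis unfolding A_def by metis
qed

section \<open>Choice of scales and subsequences\<close>

lemma seq_less_eventually:
  fixes X Y :: "nat \<Rightarrow> nat" and C :: real
  assumes "X \<prec> Y" "pos_seq Y" "C > 0"
  shows "\<forall>\<^sub>F s in sequentially. C * real (X s) \<le> real (Y s)"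
proof -
  have "\<forall>\<^sub>F s in sequentially. real (X s) / real (Y s) < 1 / C"
    using assms by (intro order_tendstoD(2)[of _ 0]) (auto simp: seq_less_def)
  then show ?thesis
  proof eventually_elim
    case (elim s)
    moreover have "real (Y s) > 0" using assms(2) by (auto simp: pos_seq_def Suc_le_eq)
    ultimately show ?case using assms(3) by (simp add: field_simps)
  qed
qed

lemma filterlim_nat_at_topI:
  fixes q :: "nat \<Rightarrow> nat"
  assumes "\<And>m. \<forall>\<^sub>F s in sequentially. m \<le> q s"
  shows "filterlim q at_top sequentially"
  using assms by (simp add: filterlim_at_top)

text \<open>
  Between \<open>Km\<close> and \<open>Kp\<close> there is room for a geometric progression of \<open>q\<close> scales with ratio
  \<open>q \<rightarrow> \<infinity>\<close>, and a bounded monotone quantity is nearly constant between two consecutive ones.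
\<close>

lemma pigeonhole_scale:
  fixes F :: "nat \<Rightarrow> nat \<Rightarrow> nat \<Rightarrow> real" and Km Kp :: "nat \<Rightarrow> nat"
  assumes mono: "\<And>j s L L'. 1 \<le> L \<Longrightarrow> L \<le> L' \<Longrightarrow> F j s L \<le> F j s L'"
    and F0: "\<And>j s L. 0 \<le> F j s L" and F1: "\<And>j s L. F j s L \<le> 1"
    and "pos_seq Km" "pos_seq Kp" "Km \<prec> Kp" and le: "\<And>s. Km s \<le> Kp s"
  obtains Hm Hp :: "nat \<Rightarrow> nat" where "Hm \<prec> Hp"
    "\<And>s. Km s \<le> Hm s" "\<And>s. Hm s \<le> Hp s" "\<And>s. Hp s \<le> Kp s"
    "\<And>j. (\<lambda>s. F j s (Hp s) - F j s (Hm s)) \<longlonglongrightarrow> 0"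
proof -
  \<comment> \<open>\<open>q ^ q * Km s \<le> Kp s\<close> leaves room for the scales
    \<open>Km s * q ^ i\<close> with \<open>i \<le> q\<close>. The cap \<open>q \<le> s\<close>
    makes the set finite, and admitting \<open>0\<close> makes it nonempty, so the maximum
    exists.\<close>
  define R where "R s = {q. q \<le> s \<and> (q = 0 \<or> q ^ q * Km s \<le> Kp s)}" for s
  define q where "q s = Max (R s)" for s
  have fin: "finite (R s)" for s unfolding R_def by simp
  have qR: "q s \<in> R s" for s
    unfolding q_def using fin by (intro Max_in) (auto simp: R_def)
  have q_ge: "\<forall>\<^sub>F s in sequentially. m \<le> q s" for m
  proof (cases "m = 0")
    case False
    have "\<forall>\<^sub>F s in sequentially. real (m ^ m) * real (Km s) \<le> real (Kp s)"
      using False assms by (intro seq_less_eventually) auto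
    then show ?thesis using eventually_ge_at_top[of m]
    proof eventually_elim
      case (elim s)
      have "m ^ m * Km s \<le> Kp s" using elim(1) by (simp only: of_nat_mult[symmetric] of_nat_le_iff)
      then have "m \<in> R s" using elim unfolding R_def by auto
      then show ?case unfolding q_def using fin by (intro Max_ge)
    qed
  qed auto
  then have q_lim: "filterlim q at_top sequentially" by (rule filterlim_nat_at_topI)
  have ex: "\<exists>hm hp. Km s \<le> hm \<and> 1 \<le> hm \<and> hm \<le> hp \<and> hp \<le> Kp s \<and> (q s > 0 \<longrightarrow> hp = hm * q s \<and>
      (\<forall>j<q s. F j s hp - F j s hm \<le> 2 ^ Suc j / real (q s)))" for s
  proof (cases "q s = 0")
    case True
    then show ?thesis using assms le by (auto simp: pos_seq_def intro!: exI[of _ "Km s"])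
  next
    case False
    define Q where "Q = q s"
    have Q: "Q \<ge> 1" "Q ^ Q * Km s \<le> Kp s" using qR[of s] False by (auto simp: R_def Q_def)
    have Km: "1 \<le> Km s" using assms by (auto simp: pos_seq_def)
    define L where "L i = Km s * Q ^ i" for i
    have Q1: "1 \<le> Q ^ i" for i using Q(1) by simp
    have KL: "Km s \<le> L i" for i using mult_le_mono2[OF Q1[of i], of "Km s"] by (simp add: L_def)
    have L1: "1 \<le> L i" for i using KL[of i] Km by simp
    have LS: "L (Suc i) = L i * Q" for i by (simp add: L_def)
    have Lmono: "L i \<le> L (Suc i)" for i unfolding LS using Q(1) by simp
    \<comment> \<open>The weights merge all quantities with \<open>j < Q\<close> into one that lies
      between 0 and 2, so one of its \<open>Q\<close> steps rises by at most \<open>2 / Q\<close>.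
      Undoing the weight costs \<open>2 ^ j\<close>, which is harmless for fixed \<open>j\<close> as
      \<open>Q\<close> tends to infinity.\<close>
    define G where "G i = (\<Sum>j<Q. F j s (L i) / 2 ^ j)" for i
    have G0: "0 \<le> G i" for i by (auto simp: G_def F0 intro!: sum_nonneg)
    have G2: "G i \<le> 2" for i
    proof -
      have "G i \<le> (\<Sum>j<Q. (1/2) ^ j)"
        unfolding G_def by (intro sum_mono) (use F1 in \<open>auto simp: field_simps\<close>)
      also have "\<dots> \<le> 2" by (simp add: sum_gp_strict)
      finally show ?thesis .
    qed
    have "\<exists>i<Q. G (Suc i) - G i \<le> 2 / real Q"
    proof (rule ccontr)
      assume "\<not> ?thesis"
      then have "(\<Sum>i<Q. 2 / real Q) < (\<Sum>i<Q. G (Suc i) - G i)"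
        using Q(1) by (intro sum_strict_mono) (auto simp: not_le lessThan_empty_iff)
      also have "\<dots> = G Q - G 0" by (rule sum_lessThan_telescope)
      also have "\<dots> \<le> 2" using G2[of Q] G0[of 0] by simp
      finally show False using Q(1) by simp
    qed
    then obtain i where i: "i < Q" "G (Suc i) - G i \<le> 2 / real Q" by auto
    have "F j s (L (Suc i)) - F j s (L i) \<le> 2 ^ Suc j / real Q" if "j < Q" for j
    proof -
      have "(F j s (L (Suc i)) - F j s (L i)) / 2 ^ j
        \<le> (\<Sum>j<Q. (F j s (L (Suc i)) - F j s (L i)) / 2 ^ j)"
        by (rule member_le_sum) (use that mono[OF L1 Lmono] in auto)
      also have "\<dots> = G (Suc i) - G i"
        by (simp add: G_def sum_subtractf diff_divide_distrib)
      also have "\<dots> \<le> 2 / real Q" by (rule i)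
      finally show ?thesis by (simp add: field_simps)
    qed
    moreover have "L (Suc i) \<le> Kp s"
    proof -
      have "Q ^ Suc i \<le> Q ^ Q" using Q(1) i(1) by (intro power_increasing) auto
      then have "L (Suc i) \<le> Km s * Q ^ Q" unfolding L_def by (rule mult_le_mono2)
      then show ?thesis using Q(2) by (simp add: mult.commute)
    qed
    ultimately show ?thesis
      using KL[of i] L1[of i] L1[of "Suc i"] LS[of i] Q(1)
      by - (rule exI[of _ "L i"], rule exI[of _ "L (Suc i)"], auto simp: Q_def)
  qed
  then obtain Hm Hp where H: "\<And>s. Km s \<le> Hm s" "\<And>s. 1 \<le> Hm s" "\<And>s. Hm s \<le> Hp s"
    "\<And>s. q s > 0 \<Longrightarrow> Hp s = Hm s * q s" "\<And>s. Hp s \<le> Kp s"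
    "\<And>s j. q s > 0 \<Longrightarrow> j < q s \<Longrightarrow> F j s (Hp s) - F j s (Hm s) \<le> 2 ^ Suc j / real (q s)"
    by metis
  have inv: "(\<lambda>s. C / real (q s)) \<longlonglongrightarrow> 0" for C :: real
    using q_lim by (intro real_tendsto_divide_at_top[OF tendsto_const])
      (rule filterlim_compose[OF filterlim_real_sequentially])
  show ?thesis
  proof
    show "Km s \<le> Hm s" "Hm s \<le> Hp s" "Hp s \<le> Kp s" for s using H by auto
    show "Hm \<prec> Hp" unfolding seq_less_def
    proof (rule Lim_transform_eventually[OF inv[of 1]])
      show "\<forall>\<^sub>F s in sequentially. 1 / real (q s) = real (Hm s) / real (Hp s)"
        using q_ge[of 1]
      proof eventually_elim
        case (elim s)
        moreover have "real (Hm s) > 0" using H(2)[of s] by simp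
        ultimately show ?case using H(4)[of s] by simp
      qed
    qed
    fix j
    show "(\<lambda>s. F j s (Hp s) - F j s (Hm s)) \<longlonglongrightarrow> 0"
    proof (rule tendsto_sandwich[OF _ _ tendsto_const inv])
      show "\<forall>\<^sub>F s in sequentially. 0 \<le> F j s (Hp s) - F j s (Hm s)"
        using mono[OF H(2,3)] by simp
      show "\<forall>\<^sub>F s in sequentially. F j s (Hp s) - F j s (Hm s) \<le> 2 ^ Suc j / real (q s)"
        using q_ge[of "Suc j"] by eventually_elim (use H(6) in auto)
    qed
  qed
qed

text \<open>Dependent choice: the condition may refer to the previously chosen index
  \<open>p\<close>, which is how lacunarity is obtained. The start \<open>r 0 = 0\<close> is
  arbitrary, so nothing is known at index 0; hence the restriction \<open>k \<ge> 1\<close> in later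
  statements.\<close>

lemma strict_mono_choice:
  fixes Q :: "nat \<Rightarrow> nat \<Rightarrow> nat \<Rightarrow> bool"
  assumes "\<And>k p. \<forall>\<^sub>F s in sequentially. Q k p s"
  obtains r where "strict_mono r" "\<And>k. Q (Suc k) (r k) (r (Suc k))"
proof -
  have ex: "\<exists>s. p < s \<and> Q k p s" for k p
    using eventually_happens[OF eventually_conj[OF eventually_gt_at_top[of p] assms[of k p]]] by auto
  define nxt where "nxt k p = (SOME s. p < s \<and> Q k p s)" for k p
  have nxt: "p < nxt k p" "Q k p (nxt k p)" for k p
    using someI_ex[OF ex, of p k] by (simp_all add: nxt_def)
  define r where "r = rec_nat 0 (\<lambda>k p. nxt (Suc k) p)"
  have "r (Suc k) = nxt (Suc k) (r k)" for k by (simp add: r_def)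
  then show ?thesis using nxt that[of r] by (simp add: strict_mono_Suc_iff)
qed

lemma bounded_family_convergent_subseq:
  fixes x :: "nat \<Rightarrow> nat \<Rightarrow> real"
  assumes "\<And>s j. \<bar>x s j\<bar> \<le> B j"
  obtains r where "strict_mono (r :: nat \<Rightarrow> nat)" "\<And>j. convergent (\<lambda>s. x (r s) j)"
proof -
  \<comment> \<open>\<open>function_convergent_subsequence\<close> performs the diagonal argument
    under one common bound, so coordinate \<open>j\<close> is rescaled; \<open>+ 1\<close> keeps the
    divisor nonzero.\<close>
  define y where "y s j = x s j / (B j + 1)" for s j
  have B: "B j \<ge> 0" for j using assms[of 0 j] by linarith
  have "norm (y s j) \<le> 1" for s j
  proof -
    have "\<bar>x s j\<bar> \<le> B j + 1" "\<bar>B j + 1\<bar> = B j + 1" using assms[of s j] B[of j] by auto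
    then show ?thesis using B[of j] by (simp add: y_def)
  qed
  then obtain r where r: "strict_mono (r :: nat \<Rightarrow> nat)" "\<And>j. \<exists>l. (\<lambda>s. y (r s) j) \<longlonglongrightarrow> l"
    using function_convergent_subsequence[of UNIV y 1] by (metis UNIV_I uncountable_def countableI_type)
  have "convergent (\<lambda>s. x (r s) j)" for j
  proof -
    obtain l where "(\<lambda>s. y (r s) j) \<longlonglongrightarrow> l" using r(2) by auto
    then have "(\<lambda>s. y (r s) j * (B j + 1)) \<longlonglongrightarrow> l * (B j + 1)" by (intro tendsto_intros)
    moreover have "y s j * (B j + 1) = x s j" for s using B[of j] by (simp add: y_def)
    ultimately show ?thesis by (auto simp: convergent_def)
  qed
  then show ?thesis using r(1) that by blast
qed

section \<open>Structured functions\<close>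

definition mean :: "nat \<Rightarrow> (nat \<Rightarrow> real) \<Rightarrow> real" where
  "mean M a = (\<Sum>n=1..M. a n) / real M"

lemma has_mean_iff: "has_mean N a l \<longleftrightarrow> (\<lambda>s. mean (N s) a) \<longlonglongrightarrow> l"
  by (simp add: has_mean_def mean_def)

lemma mean_mono: "(\<And>n. n \<in> {1..M} \<Longrightarrow> a n \<le> b n) \<Longrightarrow> mean M a \<le> mean M b"
  unfolding mean_def by (intro divide_right_mono sum_mono) auto

lemma mean_cong: "(\<And>n. n \<in> {1..M} \<Longrightarrow> a n = b n) \<Longrightarrow> mean M a = mean M b"
  unfolding mean_def by (intro arg_cong2[of _ _ _ _ "(/)"] sum.cong) auto

lemma mean_add: "mean M (\<lambda>n. a n + b n) = mean M a + mean M b"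
  by (simp add: mean_def sum.distrib add_divide_distrib)

lemma mean_diff: "mean M (\<lambda>n. a n - b n) = mean M a - mean M b"
  by (simp add: mean_def sum_subtractf diff_divide_distrib)

lemma mean_cmult: "mean M (\<lambda>n. r * a n) = r * mean M a"
  by (simp add: mean_def sum_distrib_left)

lemma mean_const: "M \<ge> 1 \<Longrightarrow> mean M (\<lambda>n. r) = r"
  by (simp add: mean_def)

lemma mean_nonneg: "(\<And>n. n \<in> {1..M} \<Longrightarrow> 0 \<le> a n) \<Longrightarrow> 0 \<le> mean M a"
  unfolding mean_def by (intro divide_nonneg_nonneg sum_nonneg) auto

lemma mean_le: "M \<ge> 1 \<Longrightarrow> (\<And>n. n \<in> {1..M} \<Longrightarrow> a n \<le> r) \<Longrightarrow> mean M a \<le> r"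
  using mean_mono[of M a "\<lambda>_. r"] by (simp add: mean_const)

section \<open>Local characters and their breaks\<close>

definition breaks :: "nat \<Rightarrow> (nat \<Rightarrow> 'a) \<Rightarrow> nat set" where
  "breaks N a = {n \<in> {1..<N}. a n \<noteq> a (Suc n)}"

lemma finite_breaks [simp]: "finite (breaks N a)"
  by (simp add: breaks_def)

text \<open>The budget is a product because \<open>b * N / L\<close> would need division of
  naturals. Amplitude and frequency are counted together, as changes of the pair. A break is the
  last index before a change, and it and its successor both lie in \<open>{1..N}\<close>, so changes
  outside are not counted.\<close>

definition local_char :: "nat \<Rightarrow> nat \<Rightarrow> nat \<Rightarrow> (nat \<Rightarrow> complex) \<Rightarrow> bool" where
  "local_char N L b \<phi> \<longleftrightarrow> (\<exists>c \<alpha>. (\<forall>n. cmod (c n) \<le> 1) \<and>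
     card (breaks N (\<lambda>n. (c n, \<alpha> n))) * L \<le> b * N \<and>
     (\<forall>n. \<phi> n = c n * unit_exp (real n * \<alpha> n)))"

lemma local_charI:
  assumes "\<And>n. cmod (c n) \<le> 1" "card (breaks N (\<lambda>n. (c n, \<alpha> n))) * L \<le> b * N"
    "\<And>n. \<phi> n = c n * unit_exp (real n * \<alpha> n)"
  shows "local_char N L b \<phi>"
  using assms unfolding local_char_def by blast

lemma local_charE:
  assumes "local_char N L b \<phi>"
  obtains c \<alpha> where "\<And>n. cmod (c n) \<le> 1" "card (breaks N (\<lambda>n. (c n, \<alpha> n))) * L \<le> b * N"
    "\<And>n. \<phi> n = c n * unit_exp (real n * \<alpha> n)"
  using assms unfolding local_char_def by blast

lemma norm_local_char_le: "local_char N L b \<phi> \<Longrightarrow> cmod (\<phi> n) \<le> 1"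
  by (auto elim!: local_charE simp: norm_mult)

lemma local_char_const: "cmod z \<le> 1 \<Longrightarrow> local_char N L b (\<lambda>n. z)"
  by (rule local_charI[of "\<lambda>n. z" _ "\<lambda>n. 0"]) (auto simp: breaks_def)

lemma local_char_mono:
  assumes "local_char N L b \<phi>" "L' \<le> L" "b \<le> b'"
  shows "local_char N L' b' \<phi>"
proof -
  obtain c \<alpha> where *: "\<And>n. cmod (c n) \<le> 1" "card (breaks N (\<lambda>n. (c n, \<alpha> n))) * L \<le> b * N"
    "\<And>n. \<phi> n = c n * unit_exp (real n * \<alpha> n)" by (rule local_charE[OF assms(1)]) blast
  have "card (breaks N (\<lambda>n. (c n, \<alpha> n))) * L' \<le> card (breaks N (\<lambda>n. (c n, \<alpha> n))) * L"
    using assms by simp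
  also have "\<dots> \<le> b * N" by fact
  also have "\<dots> \<le> b' * N" using assms by simp
  finally show ?thesis using * by (intro local_charI[of c _ \<alpha>])
qed

text \<open>Amplitudes multiply, frequencies add, and a break of the product is a break of a factor.
  This closure under products is what makes polynomials in structured functions structured.\<close>

lemma local_char_mult:
  assumes "local_char N L b \<phi>" "local_char N L b' \<psi>"
  shows "local_char N L (b + b') (\<lambda>n. \<phi> n * \<psi> n)"
proof -
  obtain c \<alpha> where 1: "\<And>n. cmod (c n) \<le> 1" "card (breaks N (\<lambda>n. (c n, \<alpha> n))) * L \<le> b * N"
    "\<And>n. \<phi> n = c n * unit_exp (real n * \<alpha> n)" by (rule local_charE[OF assms(1)]) blast
  obtain c' \<alpha>' where 2: "\<And>n. cmod (c' n) \<le> 1" "card (breaks N (\<lambda>n. (c' n, \<alpha>' n))) * L \<le> b' * N"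
    "\<And>n. \<psi> n = c' n * unit_exp (real n * \<alpha>' n)" by (rule local_charE[OF assms(2)]) blast
  show ?thesis
  proof (rule local_charI[of "\<lambda>n. c n * c' n" _ "\<lambda>n. \<alpha> n + \<alpha>' n"])
    show "cmod (c n * c' n) \<le> 1" for n
      using mult_mono[OF 1(1)[of n] 2(1)[of n]] by (simp add: norm_mult)
    have "breaks N (\<lambda>n. (c n * c' n, \<alpha> n + \<alpha>' n)) \<subseteq>
        breaks N (\<lambda>n. (c n, \<alpha> n)) \<union> breaks N (\<lambda>n. (c' n, \<alpha>' n))"
      by (auto simp: breaks_def)
    then have "card (breaks N (\<lambda>n. (c n * c' n, \<alpha> n + \<alpha>' n))) \<le>
        card (breaks N (\<lambda>n. (c n, \<alpha> n))) + card (breaks N (\<lambda>n. (c' n, \<alpha>' n)))"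
      by (meson card_Un_le card_mono finite_UnI finite_breaks order_trans)
    then have "card (breaks N (\<lambda>n. (c n * c' n, \<alpha> n + \<alpha>' n))) * L \<le>
        (card (breaks N (\<lambda>n. (c n, \<alpha> n))) + card (breaks N (\<lambda>n. (c' n, \<alpha>' n)))) * L"
      by (rule mult_le_mono1)
    then show "card (breaks N (\<lambda>n. (c n * c' n, \<alpha> n + \<alpha>' n))) * L \<le> (b + b') * N"
      using 1(2) 2(2) by (simp add: distrib_right)
    show "\<phi> n * \<psi> n = c n * c' n * unit_exp (real n * (\<alpha> n + \<alpha>' n))" for n
      by (simp add: 1(3) 2(3) distrib_left unit_exp_add)
  qed
qed

lemma local_char_cnj:
  assumes "local_char N L b \<phi>"
  shows "local_char N L b (\<lambda>n. cnj (\<phi> n))"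
proof -
  obtain c \<alpha> where 1: "\<And>n. cmod (c n) \<le> 1" "card (breaks N (\<lambda>n. (c n, \<alpha> n))) * L \<le> b * N"
    "\<And>n. \<phi> n = c n * unit_exp (real n * \<alpha> n)" by (rule local_charE[OF assms(1)]) blast
  have "breaks N (\<lambda>n. (cnj (c n), - \<alpha> n)) = breaks N (\<lambda>n. (c n, \<alpha> n))"
    by (auto simp: breaks_def)
  then show ?thesis using 1
    by (intro local_charI[of "\<lambda>n. cnj (c n)" _ "\<lambda>n. - \<alpha> n"]) (auto simp: cnj_unit_exp)
qed

text \<open>A single \<open>d\<close> bounds both the number of terms and the break budget of each,
  so that complexity is one number and the class increases with it.\<close>

definition structured :: "nat \<Rightarrow> nat \<Rightarrow> nat \<Rightarrow> (nat \<Rightarrow> complex) \<Rightarrow> bool" where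
  "structured N L d Q \<longleftrightarrow> (\<exists>\<phi>. (\<forall>i\<in>{1..d}. local_char N L d (\<phi> i)) \<and> (\<forall>n. Q n = (\<Sum>i=1..d. \<phi> i n)))"

text \<open>The index set is re-enumerated and padded with the zero function, which has no breaks,
  so sums over any set of at most \<open>d\<close> indices qualify.\<close>

lemma structured_sumI:
  assumes "finite A" "card A \<le> d" "\<And>a. a \<in> A \<Longrightarrow> local_char N L d (\<phi> a)"
    "\<And>n. Q n = (\<Sum>a\<in>A. \<phi> a n)"
  shows "structured N L d Q"
proof -
  obtain h where h: "bij_betw h {1..card A} A"
    using ex_bij_betw_nat_finite_1[OF assms(1)] by blast
  define \<psi> where "\<psi> i = (if i \<le> card A then \<phi> (h i) else (\<lambda>n. 0))" for i
  have "local_char N L d (\<psi> i)" if "i \<in> {1..d}" for i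
    using that assms(3) bij_betwE[OF h] local_char_const[of 0] by (auto simp: \<psi>_def)
  moreover have "Q n = (\<Sum>i=1..d. \<psi> i n)" for n
  proof -
    have "(\<Sum>i=1..d. \<psi> i n) = (\<Sum>i=1..card A. \<psi> i n)"
      using assms(2) by (intro sum.mono_neutral_right) (auto simp: \<psi>_def)
    also have "\<dots> = (\<Sum>i=1..card A. \<phi> (h i) n)"
      by (intro sum.cong) (auto simp: \<psi>_def)
    also have "\<dots> = (\<Sum>a\<in>A. \<phi> a n)" by (rule sum.reindex_bij_betw[OF h])
    finally show ?thesis using assms(4) by simp
  qed
  ultimately show ?thesis unfolding structured_def by blast
qed

lemma structuredE:
  assumes "structured N L d Q"
  obtains \<phi> where "\<And>i. i \<in> {1..d} \<Longrightarrow> local_char N L d (\<phi> i)" "\<And>n. Q n = (\<Sum>i=1..d. \<phi> i n)"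
  using assms unfolding structured_def by blast

lemma structured_mono:
  assumes "structured N L d Q" "L' \<le> L" "d \<le> d'"
  shows "structured N L' d' Q"
proof -
  obtain \<phi> where \<phi>: "\<And>i. i \<in> {1..d} \<Longrightarrow> local_char N L d (\<phi> i)" "\<And>n. Q n = (\<Sum>i=1..d. \<phi> i n)"
    using structuredE[OF assms(1)] by blast
  show ?thesis
    by (rule structured_sumI[of "{1..d}" _ _ _ \<phi>])
      (use \<phi> assms in \<open>auto intro: local_char_mono\<close>)
qed

lemma norm_structured_le:
  assumes "structured N L d Q"
  shows "cmod (Q n) \<le> real d"
proof -
  obtain \<phi> where \<phi>: "\<And>i. i \<in> {1..d} \<Longrightarrow> local_char N L d (\<phi> i)" "\<And>n. Q n = (\<Sum>i=1..d. \<phi> i n)"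
    using structuredE[OF assms(1)] by blast
  have "cmod (Q n) \<le> (\<Sum>i=1..d. cmod (\<phi> i n))" unfolding \<phi>(2) by (rule norm_sum)
  also have "\<dots> \<le> (\<Sum>i=1..d. 1)" by (intro sum_mono norm_local_char_le[OF \<phi>(1)])
  finally show ?thesis by simp
qed

lemma structured_local_char:
  assumes "local_char N L b \<phi>" "b \<ge> 1"
  shows "structured N L b \<phi>"
  by (rule structured_sumI[of "{0::nat}" _ _ _ "\<lambda>_. \<phi>"]) (use assms in auto)

lemma structured_add:
  assumes "structured N L d P" "structured N L e Q"
  shows "structured N L (d + e) (\<lambda>n. P n + Q n)"
proof -
  obtain \<phi> where \<phi>: "\<And>i. i \<in> {1..d} \<Longrightarrow> local_char N L d (\<phi> i)" "\<And>n. P n = (\<Sum>i=1..d. \<phi> i n)"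
    using structuredE[OF assms(1)] by blast
  obtain \<psi> where \<psi>: "\<And>i. i \<in> {1..e} \<Longrightarrow> local_char N L e (\<psi> i)" "\<And>n. Q n = (\<Sum>i=1..e. \<psi> i n)"
    using structuredE[OF assms(2)] by blast
  show ?thesis
  proof (rule structured_sumI[of "{1..d} <+> {1..e}" _ _ _ "case_sum \<phi> \<psi>"])
    show "local_char N L (d + e) (case_sum \<phi> \<psi> a)" if "a \<in> {1..d} <+> {1..e}" for a
      using that by (auto intro!: local_char_mono[OF \<phi>(1)] local_char_mono[OF \<psi>(1)])
    show "P n + Q n = (\<Sum>a\<in>{1..d} <+> {1..e}. case_sum \<phi> \<psi> a n)" for n
      by (simp add: \<phi>(2) \<psi>(2) sum.Plus)
  qed (auto simp: card_Plus)
qed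

text \<open>There are \<open>d * e\<close> products, each with break budget \<open>d + e\<close>;
  the complexity in the statement dominates both numbers.\<close>

lemma structured_mult:
  assumes "structured N L d P" "structured N L e Q"
  shows "structured N L (d * e + d + e) (\<lambda>n. P n * Q n)"
proof -
  obtain \<phi> where \<phi>: "\<And>i. i \<in> {1..d} \<Longrightarrow> local_char N L d (\<phi> i)" "\<And>n. P n = (\<Sum>i=1..d. \<phi> i n)"
    using structuredE[OF assms(1)] by blast
  obtain \<psi> where \<psi>: "\<And>i. i \<in> {1..e} \<Longrightarrow> local_char N L e (\<psi> i)" "\<And>n. Q n = (\<Sum>i=1..e. \<psi> i n)"
    using structuredE[OF assms(2)] by blast
  show ?thesis
  proof (rule structured_sumI[of "{1..d} \<times> {1..e}" _ _ _ "\<lambda>(i, j) n. \<phi> i n * \<psi> j n"])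
    show "local_char N L (d * e + d + e) (case a of (i, j) \<Rightarrow> \<lambda>n. \<phi> i n * \<psi> j n)"
      if "a \<in> {1..d} \<times> {1..e}" for a
      using that by (cases a) (auto intro!: local_char_mono[OF local_char_mult[OF \<phi>(1) \<psi>(1)]])
    show "P n * Q n = (\<Sum>a\<in>{1..d} \<times> {1..e}. (case a of (i, j) \<Rightarrow> \<lambda>n. \<phi> i n * \<psi> j n) n)" for n
      unfolding \<phi>(2) \<psi>(2) sum_product sum.cartesian_product by (intro sum.cong) auto
  qed auto
qed

lemma structured_cnj:
  assumes "structured N L d P"
  shows "structured N L d (\<lambda>n. cnj (P n))"
proof -
  obtain \<phi> where \<phi>: "\<And>i. i \<in> {1..d} \<Longrightarrow> local_char N L d (\<phi> i)" "\<And>n. P n = (\<Sum>i=1..d. \<phi> i n)"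
    using structuredE[OF assms(1)] by blast
  show ?thesis
    by (rule structured_sumI[of "{1..d}" _ _ _ "\<lambda>i n. cnj (\<phi> i n)"])
      (use \<phi> in \<open>auto intro: local_char_cnj\<close>)
qed

text \<open>Amplitudes have modulus at most 1, so a larger constant is spread over \<open>m\<close>
  equal terms.\<close>

lemma structured_const:
  assumes "cmod z \<le> real m"
  shows "structured N L m (\<lambda>n. z)"
  by (rule structured_sumI[of "{1..m}" _ _ _ "\<lambda>i n. z / of_nat m"])
    (use assms in \<open>auto intro!: local_char_const simp: norm_divide divide_le_eq\<close>)

text \<open>The complexity is uniform in \<open>s\<close>: over this class the limit in
  \<open>s\<close> can be taken before the complexity grows.\<close>

definition bounded_complexity ::
  "(nat \<Rightarrow> nat) \<Rightarrow> (nat \<Rightarrow> nat) \<Rightarrow> (nat \<Rightarrow> nat \<Rightarrow> complex) \<Rightarrow> bool" where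
  "bounded_complexity N L Q \<longleftrightarrow> (\<exists>d. \<forall>s. structured (N s) (L s) d (Q s))"

lemma bounded_complexity_add:
  "bounded_complexity N L P \<Longrightarrow> bounded_complexity N L Q \<Longrightarrow>
   bounded_complexity N L (\<lambda>s n. P s n + Q s n)"
  unfolding bounded_complexity_def by (blast intro: structured_add)

lemma bounded_complexity_mult:
  "bounded_complexity N L P \<Longrightarrow> bounded_complexity N L Q \<Longrightarrow>
   bounded_complexity N L (\<lambda>s n. P s n * Q s n)"
  unfolding bounded_complexity_def by (blast intro: structured_mult)

lemma bounded_complexity_cnj:
  "bounded_complexity N L P \<Longrightarrow> bounded_complexity N L (\<lambda>s n. cnj (P s n))"
  unfolding bounded_complexity_def by (blast intro: structured_cnj)

lemma bounded_complexity_const: "bounded_complexity N L (\<lambda>s n. z)"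
  unfolding bounded_complexity_def using structured_const[of z] real_arch_simple by meson

lemma bounded_complexity_power:
  "bounded_complexity N L P \<Longrightarrow> bounded_complexity N L (\<lambda>s n. P s n ^ k)"
  by (induction k) (auto intro: bounded_complexity_const bounded_complexity_mult)

lemma bounded_complexity_sum:
  assumes "finite A" "\<And>i. i \<in> A \<Longrightarrow> bounded_complexity N L (P i)"
  shows "bounded_complexity N L (\<lambda>s n. \<Sum>i\<in>A. P i s n)"
  using assms by (induction A) (auto intro: bounded_complexity_const bounded_complexity_add)

lemma bounded_complexity_Re:
  assumes "bounded_complexity N L P"
  shows "bounded_complexity N L (\<lambda>s n. of_real (Re (P s n)))"
proof -
  have "bounded_complexity N L (\<lambda>s n. (1/2) * (P s n + cnj (P s n)))"
    by (intro bounded_complexity_mult bounded_complexity_const bounded_complexity_add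
        bounded_complexity_cnj assms)
  then show ?thesis by (simp add: complex_add_cnj)
qed

section \<open>Truncation to the unit interval\<close>

definition clamp01 :: "real \<Rightarrow> real" where
  "clamp01 x = max 0 (min 1 x)"

lemma clamp01_bounds: "0 \<le> clamp01 x" "clamp01 x \<le> 1"
  by (auto simp: clamp01_def)

lemma clamp01_dist_le: "0 \<le> y \<Longrightarrow> y \<le> 1 \<Longrightarrow> \<bar>y - clamp01 x\<bar> \<le> \<bar>y - x\<bar>"
  by (auto simp: clamp01_def)

text \<open>Truncation leaves the functions of bounded complexity, but not their closure under
  approximation uniform in both \<open>s\<close> and \<open>n\<close>. The complexity of
  \<open>R\<close> may depend on \<open>\<eta>\<close> but not on \<open>s\<close>.\<close>

definition nearly_structured ::
  "(nat \<Rightarrow> nat) \<Rightarrow> (nat \<Rightarrow> nat) \<Rightarrow> (nat \<Rightarrow> nat \<Rightarrow> complex) \<Rightarrow> bool" where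
  "nearly_structured N L Q \<longleftrightarrow>
     (\<forall>\<eta>>0. \<exists>R. bounded_complexity N L R \<and> (\<forall>s n. cmod (Q s n - R s n) \<le> \<eta>))"

text \<open>The values of \<open>P\<close> are bounded by its complexity \<open>d\<close> for every
  \<open>s\<close>, so one Weierstrass polynomial on \<open>[-d, d]\<close> serves all
  \<open>s\<close>; together with \<open>d\<close>, its degree and coefficients bound the complexity
  of \<open>R\<close>.\<close>

lemma nearly_structured_clamp01:
  assumes P: "bounded_complexity N L P"
  shows "nearly_structured N L (\<lambda>s n. of_real (clamp01 (Re (P s n))))"
  unfolding nearly_structured_def
proof (intro allI impI)
  fix \<eta> :: real assume "\<eta> > 0"
  obtain d where d: "\<And>s. structured (N s) (L s) d (P s)"
    using P unfolding bounded_complexity_def by blast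
  have "compact {- real d..real d}" by simp
  moreover have "continuous_on {- real d..real d} clamp01"
    unfolding clamp01_def by (intro continuous_intros)
  ultimately obtain p where p: "real_polynomial_function p"
    "\<And>x. x \<in> {- real d..real d} \<Longrightarrow> \<bar>clamp01 x - p x\<bar> < \<eta>"
    using Stone_Weierstrass_real_polynomial_function \<open>\<eta> > 0\<close> by metis
  then obtain a k where a: "p = (\<lambda>x. \<Sum>i\<le>k. a i * x ^ i)"
    unfolding real_polynomial_function_iff_sum by blast
  define R :: "nat \<Rightarrow> nat \<Rightarrow> complex" where
    "R s n = (\<Sum>i\<le>k. of_real (a i) * of_real (Re (P s n)) ^ i)" for s n
  have "bounded_complexity N L R"
    unfolding R_def
    by (intro bounded_complexity_sum bounded_complexity_mult bounded_complexity_const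
        bounded_complexity_power bounded_complexity_Re P) auto
  moreover have "cmod (of_real (clamp01 (Re (P s n))) - R s n) \<le> \<eta>" for s n
  proof -
    have "\<bar>Re (P s n)\<bar> \<le> real d"
      using abs_Re_le_cmod norm_structured_le[OF d] order_trans by blast
    then have "\<bar>clamp01 (Re (P s n)) - p (Re (P s n))\<bar> \<le> \<eta>"
      using p(2)[of "Re (P s n)"] by (auto simp: abs_le_iff)
    moreover have "R s n = of_real (p (Re (P s n)))" by (simp add: R_def a)
    ultimately show ?thesis by (simp only: of_real_diff[symmetric] norm_of_real)
  qed
  ultimately show "\<exists>R. bounded_complexity N L R \<and>
      (\<forall>s n. cmod (of_real (clamp01 (Re (P s n))) - R s n) \<le> \<eta>)" by blast
qed

lemma nearly_structured_add:
  assumes "nearly_structured N L Q" "bounded_complexity N L P"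
  shows "nearly_structured N L (\<lambda>s n. Q s n + P s n)"
  unfolding nearly_structured_def
proof (intro allI impI)
  fix \<eta> :: real assume "\<eta> > 0"
  then obtain R where R: "bounded_complexity N L R" "\<And>s n. cmod (Q s n - R s n) \<le> \<eta>"
    using assms unfolding nearly_structured_def by blast
  then show "\<exists>R. bounded_complexity N L R \<and> (\<forall>s n. cmod (Q s n + P s n - R s n) \<le> \<eta>)"
    by (intro exI[of _ "\<lambda>s n. R s n + P s n"]) (auto intro: bounded_complexity_add assms)
qed

lemma nearly_structured_half:
  assumes "nearly_structured N L Q"
  shows "nearly_structured N L (\<lambda>s n. Q s n / 2)"
  unfolding nearly_structured_def
proof (intro allI impI)
  fix \<eta> :: real assume "\<eta> > 0"
  then obtain R where R: "bounded_complexity N L R" "\<And>s n. cmod (Q s n - R s n) \<le> \<eta>"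
    using assms unfolding nearly_structured_def by blast
  have "bounded_complexity N L (\<lambda>s n. (1/2) * R s n)"
    by (intro bounded_complexity_mult bounded_complexity_const R)
  moreover have "cmod (Q s n / 2 - (1/2) * R s n) \<le> \<eta>" for s n
  proof -
    have "Q s n / 2 - (1/2) * R s n = (Q s n - R s n) / 2" by (simp add: field_simps)
    then have "cmod (Q s n / 2 - (1/2) * R s n) = cmod (Q s n - R s n) / 2"
      by (simp only: norm_divide) simp
    then show ?thesis using R(2)[of s n] norm_ge_zero[of "Q s n - R s n"] by linarith
  qed
  ultimately show "\<exists>R. bounded_complexity N L R \<and> (\<forall>s n. cmod (Q s n / 2 - R s n) \<le> \<eta>)"
    by blast
qed

section \<open>Nearly optimal structured functions\<close>

lemma structured_eq_trig_sum:
  assumes "structured N L d Q"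
  obtains c \<alpha> where "\<And>i n. cmod (c i n) \<le> 1"
    "\<And>i. i \<in> {1..d} \<Longrightarrow> card (breaks N (\<lambda>n. (c i n, \<alpha> i n))) * L \<le> d * N"
    "Q = trig_sum d c \<alpha>"
proof -
  obtain \<phi> where \<phi>: "\<And>i. i \<in> {1..d} \<Longrightarrow> local_char N L d (\<phi> i)" "\<And>n. Q n = (\<Sum>i=1..d. \<phi> i n)"
    using structuredE[OF assms(1)] by blast
  have "\<exists>c \<alpha>. (\<forall>n. cmod (c n) \<le> 1) \<and> (i \<in> {1..d} \<longrightarrow>
     card (breaks N (\<lambda>n. (c n, \<alpha> n))) * L \<le> d * N \<and>
     (\<forall>n. \<phi> i n = c n * unit_exp (real n * \<alpha> n)))" for i
  proof (cases "i \<in> {1..d}")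
    case True
    then show ?thesis using \<phi>(1)[OF True] unfolding local_char_def by blast
  next
    case False
    \<comment> \<open>The bound on \<open>c\<close> is exported for every \<open>i\<close>; outside
      \<open>{1..d}\<close> the zero amplitude provides it.\<close>
    then show ?thesis by (intro exI[of _ "\<lambda>_. 0"]) auto
  qed
  then obtain c \<alpha> where *: "\<And>i n. cmod (c i n) \<le> 1"
    "\<And>i. i \<in> {1..d} \<Longrightarrow> card (breaks N (\<lambda>n. (c i n, \<alpha> i n))) * L \<le> d * N"
    "\<And>i n. i \<in> {1..d} \<Longrightarrow> \<phi> i n = c i n * unit_exp (real n * \<alpha> i n)"
    by metis
  have "Q = trig_sum d c \<alpha>"
    by (rule ext) (auto simp: trig_sum_def \<phi>(2) *(3) intro!: sum.cong)
  with * show ?thesis using that by blast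
qed

lemma structured_trig_sum:
  assumes "\<And>i n. cmod (c i n) \<le> 1"
    "\<And>i. i \<in> {1..d} \<Longrightarrow> card (breaks N (\<lambda>n. (c i n, \<alpha> i n))) * L \<le> d * N"
  shows "structured N L d (trig_sum d c \<alpha>)"
  by (rule structured_sumI[of "{1..d}" _ _ _ "\<lambda>i n. c i n * unit_exp (real n * \<alpha> i n)"])
    (use assms in \<open>auto simp: trig_sum_def intro!: local_charI[of "c _" _ "\<alpha> _"]\<close>)

text \<open>A first pigeonhole, on the distances, gives \<open>Am\<close> and \<open>Ap\<close>; the
  approximants are chosen at scale \<open>Ap\<close>; a second one, on their frequencies, gives
  \<open>Hm\<close> and \<open>Hp\<close> in between. Structure passes to smaller scales, so from
  \<open>Ap\<close> the near optimality descends to \<open>Hp\<close>, and from \<open>Am\<close>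
  the lower bound carries over to functions structured at \<open>Hm\<close>.\<close>

lemma variational_window:
  fixes f :: "nat \<Rightarrow> real" and N Kp Km :: "nat \<Rightarrow> nat"
  assumes f: "\<And>n. n \<ge> 1 \<Longrightarrow> 0 \<le> f n \<and> f n \<le> 1"
    and pos: "pos_seq N" "pos_seq Kp" "pos_seq Km" and "Km \<prec> Kp" and le: "\<And>s. Km s \<le> Kp s"
  obtains r Hm Hp :: "nat \<Rightarrow> nat" and V :: real and d :: "nat \<Rightarrow> nat"
    and c :: "nat \<Rightarrow> nat \<Rightarrow> nat \<Rightarrow> nat \<Rightarrow> complex" and \<alpha> :: "nat \<Rightarrow> nat \<Rightarrow> nat \<Rightarrow> nat \<Rightarrow> real"
  where "strict_mono r" "Hm \<prec> Hp" "\<And>s. Km (r s) \<le> Hm s" "\<And>s. Hm s \<le> Hp s" "\<And>s. Hp s \<le> Kp (r s)"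
    "\<And>j. d j \<ge> 1" "\<And>j s i n. cmod (c j s i n) \<le> 1"
    "\<And>j s i. i \<in> {1..d j} \<Longrightarrow>
       card (breaks (N (r s)) (\<lambda>n. (c j s i n, \<alpha> j s i n))) * Hp s \<le> d j * N (r s)"
    "\<And>j. \<forall>\<^sub>F s in sequentially. mean (N (r s))
       (\<lambda>n. (cmod (of_real (f n) - trig_sum (d j) (c j s) (\<alpha> j s) n))\<^sup>2) \<le> V + 1 / real (Suc j)"
    "\<And>R \<eta>. bounded_complexity (N \<circ> r) Hm R \<Longrightarrow> \<eta> > 0 \<Longrightarrow> \<forall>\<^sub>F s in sequentially.
       V - \<eta> \<le> mean (N (r s)) (\<lambda>n. (cmod (of_real (f n) - R s n))\<^sup>2)"
    "\<And>j ws. (\<lambda>s. mean (N (r s)) (\<lambda>n. of_bool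
       (1 / real (Hp s) \<le> norm_T (\<Sum>i=1..d j. of_int (ws ! (i - 1)) * \<alpha> j s i n) \<and>
        norm_T (\<Sum>i=1..d j. of_int (ws ! (i - 1)) * \<alpha> j s i n) < 1 / real (Hm s)))) \<longlonglongrightarrow> 0"
proof -
  have N1: "N s \<ge> 1" for s using pos by (simp add: pos_seq_def)
  define err where "err s Q = mean (N s) (\<lambda>n. (cmod (of_real (f n) - Q n))\<^sup>2)" for s Q
  define D where "D d s L = Inf (err s ` {Q. structured (N s) L d Q})" for d s L
  have err0: "0 \<le> err s Q" for s Q unfolding err_def by (intro mean_nonneg) auto
  have bdd: "bdd_below (err s ` X)" for s X by (rule bdd_belowI[of _ 0]) (auto simp: err0)
  have zero: "structured (N s) L d (\<lambda>_. 0)" for s L d by (rule structured_const) auto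
  have ne: "err s ` {Q. structured (N s) L d Q} \<noteq> {}" for s L d using zero by blast
  have D_le: "D d s L \<le> err s Q" if "structured (N s) L d Q" for d s L Q
    unfolding D_def by (rule cInf_lower[OF _ bdd]) (use that in blast)
  have D0: "0 \<le> D d s L" for d s L
    unfolding D_def by (intro cInf_greatest ne) (auto simp: err0)
  have D1: "D d s L \<le> 1" for d s L
  proof -
    have "D d s L \<le> err s (\<lambda>_. 0)" by (rule D_le[OF zero])
    also have "\<dots> \<le> 1" unfolding err_def
      by (intro mean_le N1) (use f in \<open>auto simp: power_le_one\<close>)
    finally show ?thesis .
  qed
  have D_anti: "D d' s L' \<le> D d s L" if "L' \<le> L" "d \<le> d'" for d d' s L L'
    unfolding D_def by (intro cInf_superset_mono ne bdd) (use that structured_mono in blast)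
  obtain Am Ap :: "nat \<Rightarrow> nat" where A: "Am \<prec> Ap" "\<And>s. Km s \<le> Am s" "\<And>s. Am s \<le> Ap s" "\<And>s. Ap s \<le> Kp s"
    and A_lim: "\<And>d. (\<lambda>s. D d s (Ap s) - D d s (Am s)) \<longlonglongrightarrow> 0"
    using pigeonhole_scale[of D Km Kp, OF D_anti D0 D1 pos(3,2) assms(5) le] by blast
  obtain r where r: "strict_mono r" "\<And>d. convergent (\<lambda>s. D d (r s) (Ap (r s)))"
  proof -
    have "\<bar>D d s (Ap s)\<bar> \<le> 1" for d s using D0 D1 by simp
    then show ?thesis
      using that bounded_family_convergent_subseq[of "\<lambda>s d. D d s (Ap s)" "\<lambda>_. 1"] by blast
  qed
  define Dl where "Dl d = lim (\<lambda>s. D d (r s) (Ap (r s)))" for d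
  have Dl: "(\<lambda>s. D d (r s) (Ap (r s))) \<longlonglongrightarrow> Dl d" for d
    unfolding Dl_def using r(2) by (simp add: convergent_LIMSEQ_iff)
  have Dl0: "0 \<le> Dl d" for d by (rule LIMSEQ_le_const[OF Dl]) (use D0 in auto)
  have Dl_Suc: "Dl (Suc d) \<le> Dl d" for d
    by (rule LIMSEQ_le[OF Dl Dl]) (use D_anti in auto)
  define V where "V = Inf (range Dl)"
  have V_le: "V \<le> Dl d" for d
    unfolding V_def by (rule cInf_lower) (auto intro: bdd_belowI[of _ 0] simp: Dl0)
  \<comment> \<open>Raising \<open>d\<close> by one secures \<open>d \<ge> 1\<close> at no cost,
    since \<open>Dl\<close> is decreasing.\<close>
  have "\<exists>d\<ge>1. Dl d < V + 1 / real (Suc j)" for j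
  proof -
    have "Inf (range Dl) < V + 1 / real (Suc j)" by (simp add: V_def)
    then obtain d where "Dl d < V + 1 / real (Suc j)" using cInf_lessD[of "range Dl"] by auto
    then show ?thesis using Dl_Suc[of d] by (intro exI[of _ "Suc d"]) auto
  qed
  then obtain d where d: "\<And>j. d j \<ge> 1" "\<And>j. Dl (d j) < V + 1 / real (Suc j)" by metis
  \<comment> \<open>The infimum need not be attained, so an excess \<open>1 / Suc s\<close> is
    allowed; it vanishes in the limit while the complexity \<open>d j\<close> stays fixed.\<close>
  define T where "T j s c \<alpha> \<longleftrightarrow> (\<forall>i n. cmod (c i n) \<le> 1) \<and>
      (\<forall>i\<in>{1..d j}. card (breaks (N (r s)) (\<lambda>n. (c i n, \<alpha> i n))) * Ap (r s) \<le> d j * N (r s)) \<and>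
      err (r s) (trig_sum (d j) c \<alpha>) < D (d j) (r s) (Ap (r s)) + 1 / real (Suc s)" for j s c \<alpha>
  have exT: "\<exists>p. T j s (fst p) (snd p)" for j s
  proof -
    have "Inf (err (r s) ` {Q. structured (N (r s)) (Ap (r s)) (d j) Q})
        < D (d j) (r s) (Ap (r s)) + 1 / real (Suc s)" by (simp add: D_def)
    then obtain Q where "structured (N (r s)) (Ap (r s)) (d j) Q"
      "err (r s) Q < D (d j) (r s) (Ap (r s)) + 1 / real (Suc s)"
      using cInf_lessD[OF ne] by blast
    then have "\<exists>c \<alpha>. T j s c \<alpha>" unfolding T_def by (elim structured_eq_trig_sum) blast
    then show ?thesis by auto
  qed
  define c where "c j s = fst (SOME p. T j s (fst p) (snd p))" for j s
  define \<alpha> where "\<alpha> j s = snd (SOME p. T j s (fst p) (snd p))" for j s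
  have T: "T j s (c j s) (\<alpha> j s)" for j s
    unfolding c_def \<alpha>_def by (rule someI_ex[OF exT])
  have c: "cmod (c j s i n) \<le> 1"
    and er: "err (r s) (trig_sum (d j) (c j s) (\<alpha> j s)) < D (d j) (r s) (Ap (r s)) + 1 / real (Suc s)"
    and br: "i \<in> {1..d j} \<Longrightarrow>
      card (breaks (N (r s)) (\<lambda>n. (c j s i n, \<alpha> j s i n))) * Ap (r s) \<le> d j * N (r s)" for j s i n
    using T[of j s] unfolding T_def by auto
  define x where "x j ws s n = norm_T (\<Sum>i=1..d j. of_int (ws ! (i - 1)) * \<alpha> j s i n)"
    for j s n and ws :: "int list"
  \<comment> \<open>Coefficient vectors are lists because integer lists are countable, so
    \<open>from_nat\<close> enumerates all pairs of a level and a vector by the natural numbers, as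
    \<open>pigeonhole_scale\<close> expects. The proportion increases with \<open>L\<close> since
    \<open>1 / L\<close> decreases.\<close>
  define F where "F k s L = (case from_nat k of (j, ws) \<Rightarrow>
     mean (N (r s)) (\<lambda>n. of_bool (1 / real L \<le> x j ws s n)))" for k s L
  have Fmono: "F k s L \<le> F k s L'" if "1 \<le> L" "L \<le> L'" for k s L L'
  proof -
    have "1 / real L' \<le> 1 / real L" using that by (intro divide_left_mono) auto
    then show ?thesis unfolding F_def
      by (auto split: prod.split intro!: mean_mono)
  qed
  have F01: "0 \<le> F k s L" "F k s L \<le> 1" for k s L
    unfolding F_def using N1 by (auto split: prod.split intro!: mean_nonneg mean_le)
  have Apos: "pos_seq (Am \<circ> r)" "pos_seq (Ap \<circ> r)"
    using A(2,3) pos(3) unfolding pos_seq_def o_def by (meson order_trans)+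
  have "Am \<circ> r \<prec> Ap \<circ> r"
    using LIMSEQ_subseq_LIMSEQ[OF A(1)[unfolded seq_less_def] r(1)] by (simp add: seq_less_def o_def)
  then obtain Hm Hp :: "nat \<Rightarrow> nat" where H: "Hm \<prec> Hp" "\<And>s. Am (r s) \<le> Hm s" "\<And>s. Hm s \<le> Hp s" "\<And>s. Hp s \<le> Ap (r s)"
    and F_lim: "\<And>k. (\<lambda>s. F k s (Hp s) - F k s (Hm s)) \<longlonglongrightarrow> 0"
    using pigeonhole_scale[of F "Am \<circ> r" "Ap \<circ> r", OF Fmono F01 Apos] A(3) unfolding o_def by blast
  show ?thesis
  proof (rule that)
    show "strict_mono r" "Hm \<prec> Hp" "d j \<ge> 1" "cmod (c j s i n) \<le> 1" "Hm s \<le> Hp s" for j s i n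
      by fact+
    show "Km (r s) \<le> Hm s" "Hp s \<le> Kp (r s)" for s
      using A H order_trans by blast+
    show "card (breaks (N (r s)) (\<lambda>n. (c j s i n, \<alpha> j s i n))) * Hp s \<le> d j * N (r s)"
      if "i \<in> {1..d j}" for j s i
      using br[OF that, of s] mult_le_mono2[OF H(4)] order_trans by blast
    show "\<forall>\<^sub>F s in sequentially. mean (N (r s))
       (\<lambda>n. (cmod (of_real (f n) - trig_sum (d j) (c j s) (\<alpha> j s) n))\<^sup>2) \<le> V + 1 / real (Suc j)" for j
    proof -
      have "(\<lambda>s. D (d j) (r s) (Ap (r s)) + 1 / real (Suc s)) \<longlonglongrightarrow> Dl (d j) + 0"
        by (intro tendsto_add Dl LIMSEQ_Suc[OF lim_1_over_n])
      then have "\<forall>\<^sub>F s in sequentially. D (d j) (r s) (Ap (r s)) + 1 / real (Suc s) < V + 1 / real (Suc j)"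
        using d(2)[of j] by (intro order_tendstoD(2)) auto
      then show ?thesis
      proof eventually_elim
        case (elim s)
        then show ?case using er[of s j] unfolding err_def by linarith
      qed
    qed
    show "\<forall>\<^sub>F s in sequentially. V - \<eta> \<le> mean (N (r s)) (\<lambda>n. (cmod (of_real (f n) - R s n))\<^sup>2)"
      if R: "bounded_complexity (N \<circ> r) Hm R" and \<eta>: "\<eta> > 0" for R \<eta>
    proof -
      obtain e where e: "\<And>s. structured (N (r s)) (Hm s) e (R s)"
        using R by (auto simp: bounded_complexity_def)
      \<comment> \<open>At \<open>Am\<close> the distance has the same limit \<open>Dl e\<close> as
        at \<open>Ap\<close>, because the difference between the two scales vanishes; and
        \<open>V \<le> Dl e\<close>.\<close>
      have "(\<lambda>s. D e (r s) (Ap (r s)) - (D e (r s) (Ap (r s)) - D e (r s) (Am (r s)))) \<longlonglongrightarrow> Dl e - 0"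
        using LIMSEQ_subseq_LIMSEQ[OF A_lim r(1), of e] by (intro tendsto_diff Dl) (simp add: o_def)
      then have "(\<lambda>s. D e (r s) (Am (r s))) \<longlonglongrightarrow> Dl e" by simp
      then have "\<forall>\<^sub>F s in sequentially. V - \<eta> < D e (r s) (Am (r s))"
        using V_le[of e] \<eta> by (intro order_tendstoD(1)[of _ "Dl e"]) auto
      then show ?thesis
      proof eventually_elim
        case (elim s)
        have "D e (r s) (Am (r s)) \<le> err (r s) (R s)"
          by (intro D_le structured_mono[OF e]) (use H in auto)
        then show ?case using elim unfolding err_def by linarith
      qed
    qed
    show "(\<lambda>s. mean (N (r s)) (\<lambda>n. of_bool
       (1 / real (Hp s) \<le> norm_T (\<Sum>i=1..d j. of_int (ws ! (i - 1)) * \<alpha> j s i n) \<and>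
        norm_T (\<Sum>i=1..d j. of_int (ws ! (i - 1)) * \<alpha> j s i n) < 1 / real (Hm s)))) \<longlonglongrightarrow> 0" for j ws
    proof -
      have F: "F (to_nat (j, ws)) s L = mean (N (r s)) (\<lambda>n. of_bool (1 / real L \<le> x j ws s n))" for s L
        by (simp add: F_def)
      have "mean (N (r s)) (\<lambda>n. of_bool (1 / real (Hp s) \<le> x j ws s n \<and> x j ws s n < 1 / real (Hm s)))
         = F (to_nat (j, ws)) s (Hp s) - F (to_nat (j, ws)) s (Hm s)" for s
      proof -
        have "Hm s \<ge> 1" using H(2)[of s] Apos(1) unfolding pos_seq_def o_def by (meson order_trans)
        then have "1 / real (Hp s) \<le> 1 / real (Hm s)" using H(3)[of s] by (intro divide_left_mono) auto
        then show ?thesis unfolding F mean_diff[symmetric]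
          by (intro mean_cong) auto
      qed
      then show ?thesis using F_lim[of "to_nat (j, ws)"] by (simp add: x_def)
    qed
  qed
qed

section \<open>Consequences of near optimality\<close>

text \<open>A small uniform error changes the mean squared error of a bounded function little, so
  the lower bound extends from bounded complexity to its uniform closure, in particular to
  truncations.\<close>

lemma nearly_structured_lower_bound:
  fixes f :: "nat \<Rightarrow> real" and N L :: "nat \<Rightarrow> nat"
  assumes f: "\<And>n. n \<ge> 1 \<Longrightarrow> 0 \<le> f n \<and> f n \<le> 1" and N: "pos_seq N"
    and lower: "\<And>R \<eta>. bounded_complexity N L R \<Longrightarrow> \<eta> > 0 \<Longrightarrow> \<forall>\<^sub>F s in sequentially.
       V - \<eta> \<le> mean (N s) (\<lambda>n. (cmod (of_real (f n) - R s n))\<^sup>2)"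
    and Q: "nearly_structured N L Q" "\<And>s n. cmod (Q s n) \<le> B" and "\<eta> > 0"
  shows "\<forall>\<^sub>F s in sequentially. V - \<eta> \<le> mean (N s) (\<lambda>n. (cmod (of_real (f n) - Q s n))\<^sup>2)"
proof -
  have B: "B \<ge> 0" using Q(2)[of 0 0] norm_ge_zero order_trans by blast
  \<comment> \<open>For \<open>x \<le> 1 + B\<close> and \<open>\<zeta> \<le> 1\<close>, the
    difference \<open>(x + \<zeta>)^2 - x^2 = \<zeta> * (2 * x + \<zeta>)\<close> is at most
    \<open>\<zeta> * (2 * B + 3)\<close>.\<close>
  define \<zeta> where "\<zeta> = min 1 (\<eta> / 2 / (2 * B + 3))"
  have \<zeta>: "\<zeta> > 0" "\<zeta> \<le> 1" "\<zeta> * (2 * B + 3) \<le> \<eta> / 2"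
  proof -
    show "\<zeta> > 0" "\<zeta> \<le> 1" using B \<open>\<eta> > 0\<close> by (auto simp: \<zeta>_def)
    have "\<zeta> \<le> \<eta> / 2 / (2 * B + 3)" by (simp add: \<zeta>_def)
    then show "\<zeta> * (2 * B + 3) \<le> \<eta> / 2" using B by (simp add: field_simps)
  qed
  obtain R where R: "bounded_complexity N L R" "\<And>s n. cmod (Q s n - R s n) \<le> \<zeta>"
    using Q(1) \<zeta>(1) unfolding nearly_structured_def by blast
  have pt: "(cmod (of_real (f n) - R s n))\<^sup>2 \<le> (cmod (of_real (f n) - Q s n))\<^sup>2 + \<eta> / 2"
    if "n \<ge> 1" for n s
  proof -
    define x where "x = cmod (of_real (f n) - Q s n)"
    have x: "x \<le> 1 + B" "x \<ge> 0"
      using norm_triangle_ineq4[of "of_real (f n)" "Q s n"] f[OF that] Q(2)[of s n]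
      by (auto simp: x_def)
    have "cmod (of_real (f n) - R s n) \<le> x + cmod (Q s n - R s n)"
      using norm_triangle_ineq[of "of_real (f n) - Q s n" "Q s n - R s n"] by (simp add: x_def)
    then have "cmod (of_real (f n) - R s n) \<le> x + \<zeta>" using R(2)[of s n] by simp
    then have "(cmod (of_real (f n) - R s n))\<^sup>2 \<le> (x + \<zeta>)\<^sup>2" by (intro power_mono) auto
    also have "\<dots> = x\<^sup>2 + \<zeta> * (2 * x + \<zeta>)" by (simp add: power2_eq_square algebra_simps)
    also have "\<dots> \<le> x\<^sup>2 + \<zeta> * (2 * B + 3)"
      using x \<zeta> by (intro add_left_mono mult_left_mono) auto
    also have "\<dots> \<le> x\<^sup>2 + \<eta> / 2" using \<zeta> by simp
    finally show ?thesis by (simp add: x_def)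
  qed
  have "\<forall>\<^sub>F s in sequentially. V - \<eta> / 2 \<le> mean (N s) (\<lambda>n. (cmod (of_real (f n) - R s n))\<^sup>2)"
    using lower[OF R(1), of "\<eta> / 2"] \<open>\<eta> > 0\<close> by simp
  then show ?thesis
  proof eventually_elim
    case (elim s)
    have "mean (N s) (\<lambda>n. (cmod (of_real (f n) - R s n))\<^sup>2)
      \<le> mean (N s) (\<lambda>n. (cmod (of_real (f n) - Q s n))\<^sup>2 + \<eta> / 2)"
      by (intro mean_mono pt) auto
    also have "\<dots> = mean (N s) (\<lambda>n. (cmod (of_real (f n) - Q s n))\<^sup>2) + \<eta> / 2"
      using N by (simp add: mean_add mean_const pos_seq_def)
    finally show ?case using elim by simp
  qed
qed

text \<open>Taking the real part and then clamping never moves \<open>z\<close> away from a number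
  in \<open>[0, 1]\<close>, so truncation does not spoil an approximation of
  \<open>f\<close>.\<close>

lemma clamp01_error_le:
  assumes "0 \<le> y" "y \<le> 1"
  shows "(cmod (of_real y - of_real (clamp01 (Re z))))\<^sup>2 \<le> (cmod (of_real y - z))\<^sup>2"
proof -
  have "cmod (of_real y - of_real (clamp01 (Re z))) = \<bar>y - clamp01 (Re z)\<bar>"
    by (simp only: of_real_diff[symmetric] norm_of_real)
  also have "\<dots> \<le> \<bar>y - Re z\<bar>" by (rule clamp01_dist_le[OF assms])
  also have "\<dots> \<le> cmod (of_real y - z)" using abs_Re_le_cmod[of "of_real y - z"] by simp
  finally show ?thesis by (intro power_mono) auto
qed

text \<open>
  Since no structured function is closer to \<open>f\<close> than \<open>V\<close>, the parallelogram law forces two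
  nearly optimal ones to be close to each other.
\<close>

lemma near_minimizers_close:
  fixes f :: "nat \<Rightarrow> real" and N L :: "nat \<Rightarrow> nat"
  assumes f: "\<And>n. n \<ge> 1 \<Longrightarrow> 0 \<le> f n \<and> f n \<le> 1" and N: "pos_seq N"
    and lower: "\<And>R \<eta>. bounded_complexity N L R \<Longrightarrow> \<eta> > 0 \<Longrightarrow> \<forall>\<^sub>F s in sequentially.
       V - \<eta> \<le> mean (N s) (\<lambda>n. (cmod (of_real (f n) - R s n))\<^sup>2)"
    and P: "bounded_complexity N L P" "bounded_complexity N L P'"
    and a: "\<forall>\<^sub>F s in sequentially. mean (N s) (\<lambda>n. (cmod (of_real (f n) - P s n))\<^sup>2) \<le> V + a"
    and b: "\<forall>\<^sub>F s in sequentially. mean (N s) (\<lambda>n. (cmod (of_real (f n) - P' s n))\<^sup>2) \<le> V + b"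
    and "\<eta> > 0"
  shows "\<forall>\<^sub>F s in sequentially.
    mean (N s) (\<lambda>n. (cmod (P s n - of_real (clamp01 (Re (P' s n)))))\<^sup>2) \<le> 2 * a + 2 * b + \<eta>"
proof -
  define K :: "nat \<Rightarrow> nat \<Rightarrow> complex" where "K s n = of_real (clamp01 (Re (P' s n)))" for s n
  obtain d where d: "\<And>s. structured (N s) (L s) d (P s)"
    using P(1) unfolding bounded_complexity_def by blast
  have K1: "cmod (K s n) \<le> 1" for s n
    using clamp01_bounds[of "Re (P' s n)"] by (simp add: K_def)
  have Q: "nearly_structured N L (\<lambda>s n. (K s n + P s n) / 2)"
    unfolding K_def by (intro nearly_structured_half nearly_structured_add nearly_structured_clamp01 P)
  have "cmod ((K s n + P s n) / 2) \<le> real d + 1" for s n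
  proof -
    have "cmod (K s n + P s n) \<le> 1 + real d"
      using norm_triangle_le[of "K s n" "P s n"] K1[of s n] norm_structured_le[OF d, of s n] by simp
    then show ?thesis using norm_ge_zero[of "K s n + P s n"] by (simp add: norm_divide)
  qed
  from nearly_structured_lower_bound[OF f N lower Q this, of "\<eta> / 4"] \<open>\<eta> > 0\<close>
  have "\<forall>\<^sub>F s in sequentially.
      V - \<eta> / 4 \<le> mean (N s) (\<lambda>n. (cmod (of_real (f n) - (K s n + P s n) / 2))\<^sup>2)" by simp
  then show ?thesis using a b
  proof eventually_elim
    case (elim s)
    \<comment> \<open>The midpoint enters with weight 4, so \<open>V\<close> cancels:
      \<open>2 * (V + a) + 2 * (V + b) - 4 * (V - \<eta> / 4)\<close> is
      \<open>2 * a + 2 * b + \<eta>\<close>.\<close>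
    have par: "(cmod (x - y))\<^sup>2 = 2 * (cmod (z - x))\<^sup>2 + 2 * (cmod (z - y))\<^sup>2 - 4 * (cmod (z - (y + x) / 2))\<^sup>2"
      for x y z
      by (simp add: cmod_power2) (simp add: power2_eq_square field_simps)
    have "mean (N s) (\<lambda>n. (cmod (P s n - K s n))\<^sup>2)
      = mean (N s) (\<lambda>n. 2 * (cmod (of_real (f n) - P s n))\<^sup>2 + 2 * (cmod (of_real (f n) - K s n))\<^sup>2
           - 4 * (cmod (of_real (f n) - (K s n + P s n) / 2))\<^sup>2)"
      by (intro mean_cong par)
    also have "\<dots> = 2 * mean (N s) (\<lambda>n. (cmod (of_real (f n) - P s n))\<^sup>2)
        + 2 * mean (N s) (\<lambda>n. (cmod (of_real (f n) - K s n))\<^sup>2)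
        - 4 * mean (N s) (\<lambda>n. (cmod (of_real (f n) - (K s n + P s n) / 2))\<^sup>2)"
      by (simp add: mean_add mean_diff mean_cmult)
    also have "mean (N s) (\<lambda>n. (cmod (of_real (f n) - K s n))\<^sup>2)
        \<le> mean (N s) (\<lambda>n. (cmod (of_real (f n) - P' s n))\<^sup>2)"
      unfolding K_def by (intro mean_mono clamp01_error_le) (use f in auto)
    finally show ?case using elim unfolding K_def by linarith
  qed
qed

text \<open>
  Adding \<open>sqrt b\<close> times a local character to the structured part would otherwise bring it
  closer to \<open>f\<close> than \<open>V\<close> allows.
\<close>

lemma near_minimizer_uncorrelated:
  fixes f :: "nat \<Rightarrow> real" and N L :: "nat \<Rightarrow> nat"
  assumes f: "\<And>n. n \<ge> 1 \<Longrightarrow> 0 \<le> f n \<and> f n \<le> 1" and N: "pos_seq N"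
    and lower: "\<And>R \<eta>. bounded_complexity N L R \<Longrightarrow> \<eta> > 0 \<Longrightarrow> \<forall>\<^sub>F s in sequentially.
       V - \<eta> \<le> mean (N s) (\<lambda>n. (cmod (of_real (f n) - R s n))\<^sup>2)"
    and P: "bounded_complexity N L P"
    and b: "\<forall>\<^sub>F s in sequentially. mean (N s) (\<lambda>n. (cmod (of_real (f n) - P s n))\<^sup>2) \<le> V + b"
    and "b > 0"
  shows "\<forall>\<^sub>F s in sequentially. \<forall>\<phi>. local_char (N s) (L s) 2 \<phi> \<longrightarrow>
    mean (N s) (\<lambda>n. (f n - clamp01 (Re (P s n))) * Re (\<phi> n)) \<le> 2 * sqrt b"
proof -
  define corr where "corr s \<phi> = mean (N s) (\<lambda>n. (f n - clamp01 (Re (P s n))) * Re (\<phi> n))"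
    for s and \<phi> :: "nat \<Rightarrow> complex"
  define K :: "nat \<Rightarrow> nat \<Rightarrow> complex" where "K s n = of_real (clamp01 (Re (P s n)))" for s n
  define T where "T s \<phi> \<longleftrightarrow> local_char (N s) (L s) 2 \<phi> \<and> corr s \<phi> > 2 * sqrt b" for s \<phi>
  \<comment> \<open>The goal quantifies over all characters inside the eventuality, whereas the
    lower bound concerns one family. So \<open>\<phi> s\<close> is a violating character whenever
    there is one, and 0 otherwise.\<close>
  define \<phi> where "\<phi> s = (if \<exists>\<phi>. T s \<phi> then SOME \<phi>. T s \<phi> else (\<lambda>_. 0))" for s
  have T: "T s (\<phi> s)" if "\<exists>\<phi>. T s \<phi>" for s using that by (simp add: \<phi>_def someI_ex)
  have \<phi>: "local_char (N s) (L s) 2 (\<phi> s)" for s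
    using T[of s] local_char_const[of 0] by (cases "\<exists>\<phi>. T s \<phi>") (auto simp: T_def \<phi>_def)
  \<comment> \<open>With weight \<open>t = sqrt b\<close> the added square is no larger than the
    slack \<open>b\<close>. The upper bound \<open>V + b - 2 * t * corr + b\<close> and the lower
    bound \<open>V - b\<close> then give
    \<open>2 * t * corr \<le> 3 * b \<le> 2 * t * (2 * t)\<close>.\<close>
  define t where "t = sqrt b"
  have t: "t > 0" "t\<^sup>2 = b" using \<open>b > 0\<close> by (auto simp: t_def)
  have "bounded_complexity N L \<phi>"
    unfolding bounded_complexity_def using structured_local_char[OF \<phi>] by auto
  then have Q: "nearly_structured N L (\<lambda>s n. K s n + of_real t * \<phi> s n)"
    unfolding K_def by (intro nearly_structured_add nearly_structured_clamp01 P
        bounded_complexity_mult bounded_complexity_const)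
  have "cmod (K s n + of_real t * \<phi> s n) \<le> 1 + t" for s n
  proof -
    have "cmod (K s n) \<le> 1" using clamp01_bounds[of "Re (P s n)"] by (simp add: K_def)
    moreover have "cmod (of_real t * \<phi> s n) \<le> t"
      using norm_local_char_le[OF \<phi>[of s], of n] t(1) by (simp add: norm_mult mult_le_cancel_left1)
    ultimately show ?thesis using norm_triangle_ineq[of "K s n" "of_real t * \<phi> s n"] by linarith
  qed
  from nearly_structured_lower_bound[OF f N lower Q this \<open>b > 0\<close>]
  have "\<forall>\<^sub>F s in sequentially.
      V - b \<le> mean (N s) (\<lambda>n. (cmod (of_real (f n) - (K s n + of_real t * \<phi> s n)))\<^sup>2)" .
  then show ?thesis using b
  proof eventually_elim
    case (elim s)
    have pt: "(cmod (of_real (f n) - (K s n + of_real t * \<phi> s n)))\<^sup>2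
       \<le> (cmod (of_real (f n) - P s n))\<^sup>2 - 2 * t * ((f n - clamp01 (Re (P s n))) * Re (\<phi> s n)) + b"
      if "n \<in> {1..N s}" for n
    proof -
      have "(cmod (of_real (f n) - (K s n + of_real t * \<phi> s n)))\<^sup>2 = (cmod (of_real (f n) - K s n))\<^sup>2
         - 2 * t * ((f n - clamp01 (Re (P s n))) * Re (\<phi> s n)) + t\<^sup>2 * (cmod (\<phi> s n))\<^sup>2"
        by (simp add: cmod_power2 K_def) (simp add: power2_eq_square algebra_simps)
      moreover have "(cmod (of_real (f n) - K s n))\<^sup>2 \<le> (cmod (of_real (f n) - P s n))\<^sup>2"
        unfolding K_def using f that by (intro clamp01_error_le) auto
      moreover have "(cmod (\<phi> s n))\<^sup>2 \<le> 1"
        using norm_local_char_le[OF \<phi>[of s], of n] by (simp add: power_le_one)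
      then have "t\<^sup>2 * (cmod (\<phi> s n))\<^sup>2 \<le> b" unfolding t(2)
        using \<open>b > 0\<close> by (simp add: mult_le_cancel_left1)
      ultimately show ?thesis by linarith
    qed
    have "mean (N s) (\<lambda>n. (cmod (of_real (f n) - (K s n + of_real t * \<phi> s n)))\<^sup>2)
      \<le> mean (N s) (\<lambda>n. (cmod (of_real (f n) - P s n))\<^sup>2 - 2 * t * ((f n - clamp01 (Re (P s n))) * Re (\<phi> s n)) + b)"
      by (rule mean_mono[OF pt])
    also have "\<dots> = mean (N s) (\<lambda>n. (cmod (of_real (f n) - P s n))\<^sup>2) - 2 * t * corr s (\<phi> s) + b"
    proof -
      have "mean (N s) (\<lambda>n. b) = b" using N by (intro mean_const) (simp add: pos_seq_def)
      then show ?thesis by (simp only: mean_add mean_diff mean_cmult corr_def)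
    qed
    finally have "2 * t * corr s (\<phi> s) \<le> 3 * b" using elim by linarith
    also have "\<dots> \<le> 2 * t * (2 * t)" using t \<open>b > 0\<close> by (simp add: power2_eq_square)
    finally have le: "2 * t * corr s (\<phi> s) \<le> 2 * t * (2 * t)" .
    have "corr s (\<phi> s) \<le> 2 * sqrt b"
      using mult_left_le_imp_le[OF le] t(1) by (simp add: t_def)
    then have "\<not> T s (\<phi> s)" by (simp add: T_def)
    then have "\<nexists>\<phi>. T s \<phi>" using T by blast
    then show ?case unfolding T_def corr_def by force
  qed
qed

section \<open>From correlation with local characters to local U2 norms\<close>

text \<open>The windows \<open>{x + 1..x + L}\<close> with \<open>x\<close> congruent to
  \<open>r\<close> modulo \<open>L\<close> are disjoint, so one local character can carry a separate
  phase and frequency on each. Its breaks are congruent to \<open>r\<close>, at most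
  \<open>N div L + 1\<close> in number; times \<open>L\<close> this is at most \<open>2 * N\<close>
  because \<open>L \<le> N\<close>. This is the origin of the budget 2.\<close>

lemma window_partition_local_char:
  fixes S :: "nat \<Rightarrow> complex" and \<beta> :: "nat \<Rightarrow> real"
  assumes "1 \<le> L" "L \<le> N" "r < L"
  obtains \<phi> where "local_char N L 2 \<phi>"
    "\<And>k i. k < (N - r) div L \<Longrightarrow> i < L \<Longrightarrow>
       \<phi> (r + k * L + i + 1) = cnj (sgn (S (r + k * L))) * unit_exp (real (r + k * L + i + 1) * \<beta> (r + k * L))"
    "\<And>m. m \<le> r \<or> m > r + (N - r) div L * L \<Longrightarrow> \<phi> m = 0"
proof -
  define K where "K = (N - r) div L"
  \<comment> \<open>The left end of the window containing \<open>m\<close>; the end itself is not in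
    the window, hence \<open>m - r - 1\<close>. The predicate \<open>valid\<close> cuts off the
    initial piece, where the subtraction would truncate, and the incomplete last window.\<close>
  define x where "x m = r + (m - r - 1) div L * L" for m
  define valid where "valid m \<longleftrightarrow> r < m \<and> m \<le> r + K * L" for m
  define c where "c m = (if valid m then cnj (sgn (S (x m))) else 0)" for m
  define \<alpha> where "\<alpha> m = (if valid m then \<beta> (x m) else 0)" for m
  have sub: "breaks N (\<lambda>n. (c n, \<alpha> n)) \<subseteq> {n \<in> {..N}. n mod L = r}"
  proof
    fix n assume n: "n \<in> breaks N (\<lambda>n. (c n, \<alpha> n))"
    have "n mod L = r"
    proof (rule ccontr)
      assume neq: "n mod L \<noteq> r"
      have "valid n = valid (Suc n) \<and> (valid n \<longrightarrow> x n = x (Suc n))"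
      proof (cases "n < r")
        case True
        then show ?thesis by (auto simp: valid_def)
      next
        case False
        have "n \<noteq> r" using neq assms(3) by auto
        with False have "n > r" by simp
        then obtain j where j: "n = r + Suc j" by (metis less_iff_Suc_add add_Suc_right)
        have nd: "Suc j mod L \<noteq> 0"
        proof
          assume "Suc j mod L = 0"
          then have "n mod L = r mod L" unfolding j by (metis add.right_neutral mod_add_right_eq)
          then show False using neq assms(3) by simp
        qed
        then have "Suc j div L = j div L" by (simp add: div_Suc)
        moreover have "n \<noteq> r + K * L" using nd unfolding j by auto
        ultimately show ?thesis by (auto simp: valid_def x_def j)
      qed
      then show False using n by (auto simp: breaks_def c_def \<alpha>_def split: if_splits)
    qed
    then show "n \<in> {n \<in> {..N}. n mod L = r}" using n by (auto simp: breaks_def)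
  qed
  have "card {n \<in> {..N}. n mod L = r} \<le> card {..N div L}"
  proof (rule card_inj_on_le[of "\<lambda>n. n div L"])
    show "inj_on (\<lambda>n. n div L) {n \<in> {..N}. n mod L = r}"
      by (rule inj_onI) (metis (mono_tags, lifting) div_mult_mod_eq mem_Collect_eq)
    show "(\<lambda>n. n div L) ` {n \<in> {..N}. n mod L = r} \<subseteq> {..N div L}"
      by (auto intro: div_le_mono)
  qed auto
  then have "card (breaks N (\<lambda>n. (c n, \<alpha> n))) \<le> N div L + 1"
    using card_mono[OF _ sub] by simp
  then have "card (breaks N (\<lambda>n. (c n, \<alpha> n))) * L \<le> (N div L + 1) * L" by (rule mult_le_mono1)
  also have "\<dots> = N div L * L + L" by (simp add: distrib_right)
  also have "\<dots> \<le> N + N" by (intro add_mono div_times_less_eq_dividend assms)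
  finally have br: "card (breaks N (\<lambda>n. (c n, \<alpha> n))) * L \<le> 2 * N" by simp
  define \<phi> where "\<phi> n = c n * unit_exp (real n * \<alpha> n)" for n
  show ?thesis
  proof (rule that[of \<phi>])
    have "cmod (c n) \<le> 1" for n by (simp add: c_def norm_sgn)
    then show "local_char N L 2 \<phi>" using br by (intro local_charI[of c _ \<alpha>]) (auto simp: \<phi>_def)
    show "\<phi> (r + k * L + i + 1) = cnj (sgn (S (r + k * L))) * unit_exp (real (r + k * L + i + 1) * \<beta> (r + k * L))"
      if "k < (N - r) div L" "i < L" for k i
    proof -
      have "k * L + i + 1 \<le> Suc k * L" using that(2) by simp
      also have "\<dots> \<le> K * L" using that(1) by (intro mult_le_mono1) (simp add: K_def)
      finally have "valid (r + k * L + i + 1)" by (simp add: valid_def)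
      moreover have "x (r + k * L + i + 1) = r + k * L" using that(2) by (simp add: x_def)
      ultimately show ?thesis by (simp add: \<phi>_def c_def \<alpha>_def del: of_nat_add of_nat_mult)
    qed
    show "\<phi> m = 0" if "m \<le> r \<or> m > r + (N - r) div L * L" for m
      using that by (auto simp: \<phi>_def c_def valid_def K_def)
  qed
qed

text \<open>The starting points split into \<open>L\<close> residue classes. Within a class the
  windows are disjoint and one local character realises the moduli of all their sums at once, so a
  class contributes at most \<open>\<kappa> * N\<close>.\<close>

lemma sum_windows_le:
  fixes g :: "nat \<Rightarrow> real" and \<beta> :: "nat \<Rightarrow> real"
  assumes "1 \<le> L" "L \<le> N"
    and corr: "\<And>\<phi>. local_char N L 2 \<phi> \<Longrightarrow> mean N (\<lambda>n. g n * Re (\<phi> n)) \<le> \<kappa>"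
  shows "(\<Sum>x\<le>N-L. cmod (\<Sum>i=1..L. of_real (g (x + i)) * unit_exp (real (x + i) * \<beta> x)))
    \<le> \<kappa> * real N * real L"
proof -
  define S :: "nat \<Rightarrow> complex" where
    "S x = (\<Sum>i=1..L. of_real (g (x + i)) * unit_exp (real (x + i) * \<beta> x))" for x
  have N: "N > 0" using assms by simp
  have res: "(\<Sum>k<(N - r) div L. cmod (S (r + k * L))) \<le> \<kappa> * real N" if rL: "r < L" for r
  proof -
    define K where "K = (N - r) div L"
    obtain \<phi> where \<phi>: "local_char N L 2 \<phi>"
      "\<And>k i. k < K \<Longrightarrow> i < L \<Longrightarrow>
       \<phi> (r + k * L + i + 1) = cnj (sgn (S (r + k * L))) * unit_exp (real (r + k * L + i + 1) * \<beta> (r + k * L))"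
      "\<And>m. m \<le> r \<or> m > r + K * L \<Longrightarrow> \<phi> m = 0"
      using window_partition_local_char[OF assms(1,2) rL, of S \<beta>] unfolding K_def by blast
    have KL: "r + K * L \<le> N"
    proof -
      have "K * L \<le> N - r" unfolding K_def by (rule div_times_less_eq_dividend)
      then show ?thesis using rL assms by linarith
    qed
    have win: "(\<Sum>j\<in>{k * L..<k * L + L}. g (r + j + 1) * Re (\<phi> (r + j + 1))) = cmod (S (r + k * L))"
      if "k < K" for k
    proof -
      have "(\<Sum>j\<in>{k * L..<k * L + L}. g (r + j + 1) * Re (\<phi> (r + j + 1)))
         = (\<Sum>i=1..L. g (r + k * L + i) * Re (\<phi> (r + k * L + i)))"
        by (rule sum.reindex_bij_witness[of _ "\<lambda>i. k * L + i - 1" "\<lambda>j. j + 1 - k * L"]) auto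
      also have "\<dots> = (\<Sum>i=1..L. Re (cnj (sgn (S (r + k * L))) *
          (of_real (g (r + k * L + i)) * unit_exp (real (r + k * L + i) * \<beta> (r + k * L)))))"
      proof (rule sum.cong[OF refl])
        fix i assume i: "i \<in> {1..L}"
        have "\<phi> (r + k * L + i) = cnj (sgn (S (r + k * L))) * unit_exp (real (r + k * L + i) * \<beta> (r + k * L))"
          using \<phi>(2)[OF that, of "i - 1"] i by (auto simp: add.assoc)
        then have "of_real (g (r + k * L + i)) * \<phi> (r + k * L + i) = cnj (sgn (S (r + k * L))) *
          (of_real (g (r + k * L + i)) * unit_exp (real (r + k * L + i) * \<beta> (r + k * L)))"
          by (simp only: mult_ac)
        then show "g (r + k * L + i) * Re (\<phi> (r + k * L + i)) = Re (cnj (sgn (S (r + k * L))) *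
          (of_real (g (r + k * L + i)) * unit_exp (real (r + k * L + i) * \<beta> (r + k * L))))"
          by (metis Re_complex_of_real Im_complex_of_real mult_zero_left diff_zero times_complex.sel(1))
      qed
      also have "\<dots> = Re (cnj (sgn (S (r + k * L))) * S (r + k * L))"
        unfolding S_def by (simp only: sum_distrib_left Re_sum)
      \<comment> \<open>The chosen phase turns each window sum into its modulus, so nothing cancels
        between windows.\<close>
      also have "cnj (sgn (S (r + k * L))) * S (r + k * L) = of_real (cmod (S (r + k * L)))"
      proof (cases "S (r + k * L) = 0")
        case False
        have "cnj (sgn z) * z = of_real (cmod z)" if "z \<noteq> 0" for z :: complex
        proof -
          have "cnj (sgn z) * z = (z * cnj z) / of_real (cmod z)"
            by (simp add: sgn_eq)
          also have "\<dots> = of_real ((cmod z)\<^sup>2 / cmod z)"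
            by (simp add: complex_norm_square[symmetric])
          also have "\<dots> = of_real (cmod z)" using that by (simp add: power2_eq_square)
          finally show ?thesis .
        qed
        then show ?thesis using False by simp
      qed simp
      finally show ?thesis by simp
    qed
    have "(\<Sum>k<K. cmod (S (r + k * L)))
       = (\<Sum>k<K. \<Sum>j\<in>{k * L..<k * L + L}. g (r + j + 1) * Re (\<phi> (r + j + 1)))"
      by (intro sum.cong refl win[symmetric]) simp
    also have "\<dots> = (\<Sum>j<K * L. g (r + j + 1) * Re (\<phi> (r + j + 1)))"
      by (rule sum.nat_group)
    also have "\<dots> = (\<Sum>m\<in>{r + 1..r + K * L}. g m * Re (\<phi> m))"
      by (rule sum.reindex_bij_witness[of _ "\<lambda>m. m - r - 1" "\<lambda>j. r + j + 1"]) auto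
    also have "\<dots> = (\<Sum>m=1..N. g m * Re (\<phi> m))"
      by (rule sum.mono_neutral_left) (use KL \<phi>(3) in \<open>auto simp: not_le Suc_le_eq\<close>)
    also have "\<dots> = mean N (\<lambda>n. g n * Re (\<phi> n)) * real N" using N by (simp add: mean_def)
    also have "\<dots> \<le> \<kappa> * real N" by (intro mult_right_mono corr \<phi>) auto
    finally show ?thesis unfolding K_def .
  qed
  \<comment> \<open>Division with remainder: \<open>x = r + k * L\<close> starts a window inside
    \<open>{1..N}\<close> exactly when \<open>k < (N - r) div L\<close>.\<close>
  have "(\<Sum>x\<le>N-L. cmod (S x)) = (\<Sum>(r, k)\<in>(SIGMA r:{..<L}. {..<(N - r) div L}). cmod (S (r + k * L)))"
  proof (rule sum.reindex_bij_witness[of _ "\<lambda>(r, k). r + k * L" "\<lambda>x. (x mod L, x div L)"])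
    fix x assume "x \<in> {..N - L}"
    then have "x + L \<le> N" using assms by simp
    moreover have "Suc (x div L) * L + x mod L = x + L" by simp
    ultimately have "Suc (x div L) * L \<le> N - x mod L" by linarith
    then have "Suc (x div L) \<le> (N - x mod L) div L" using assms by (simp add: less_eq_div_iff_mult_less_eq)
    then show "(x mod L, x div L) \<in> (SIGMA r:{..<L}. {..<(N - r) div L})" using assms by auto
  next
    fix p assume "p \<in> (SIGMA r:{..<L}. {..<(N - r) div L})"
    then obtain r k where p: "p = (r, k)" "r < L" "Suc k \<le> (N - r) div L" by auto
    have "Suc k * L \<le> N - r" using p(3) assms(1) by (simp add: less_eq_div_iff_mult_less_eq)
    then show "(case p of (r, k) \<Rightarrow> r + k * L) \<in> {..N - L}" using p(1,2) assms by simp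
    show "((case p of (r, k) \<Rightarrow> r + k * L) mod L, (case p of (r, k) \<Rightarrow> r + k * L) div L) = p"
      using p(1,2) by simp
  qed auto
  also have "\<dots> = (\<Sum>r<L. \<Sum>k<(N - r) div L. cmod (S (r + k * L)))"
    by (rule sum.Sigma[symmetric]) auto
  also have "\<dots> \<le> (\<Sum>r<L. \<kappa> * real N)" by (intro sum_mono res) auto
  finally show ?thesis by (simp add: S_def mult_ac)
qed

text \<open>The inverse theorem bounds each norm by the root of a window sum, whereas only the total
  of the window sums is controlled. The inequality
  \<open>2 * sqrt y \<le> \<tau> + y / \<tau>\<close> removes the root; \<open>\<tau>\<close> stays
  free and is taken to be \<open>sqrt \<kappa>\<close> in the application.\<close>

lemma sum_U2_interval_le:
  fixes g :: "nat \<Rightarrow> real"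
  assumes "1 \<le> L" "L \<le> N" "\<tau> > 0" and g: "\<And>n. n \<ge> 1 \<Longrightarrow> \<bar>g n\<bar> \<le> 1"
    and corr: "\<And>\<phi>. local_char N L 2 \<phi> \<Longrightarrow> mean N (\<lambda>n. g n * Re (\<phi> n)) \<le> \<kappa>"
  shows "(\<Sum>x\<le>N-L. U2_interval (\<lambda>n. of_real (g n)) x L) \<le> real N * (\<tau> + \<kappa> / \<tau>)"
proof -
  have "\<exists>\<beta>. U2_interval (\<lambda>n. of_real (g n)) x L
    \<le> 2 * sqrt (cmod (\<Sum>m=1..L. of_real (g (x + m)) * unit_exp (real (x + m) * \<beta>)) / real L)" for x
    by (rule U2_interval_inverse) (use assms in auto)
  then obtain \<beta> where \<beta>: "\<And>x. U2_interval (\<lambda>n. of_real (g n)) x L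
    \<le> 2 * sqrt (cmod (\<Sum>m=1..L. of_real (g (x + m)) * unit_exp (real (x + m) * \<beta> x)) / real L)"
    by metis
  define A where "A x = cmod (\<Sum>m=1..L. of_real (g (x + m)) * unit_exp (real (x + m) * \<beta> x))" for x
  have A0: "A x \<ge> 0" for x by (simp add: A_def)
  have amgm: "2 * sqrt y \<le> \<tau> + y / \<tau>" if "y \<ge> 0" for y
  proof -
    have "0 \<le> (\<tau> - sqrt y)\<^sup>2" by simp
    also have "\<dots> = \<tau> * \<tau> - 2 * sqrt y * \<tau> + y" using that by (simp add: power2_eq_square algebra_simps)
    finally show ?thesis using \<open>\<tau> > 0\<close> by (simp add: field_simps)
  qed
  have "(\<Sum>x\<le>N-L. U2_interval (\<lambda>n. of_real (g n)) x L) \<le> (\<Sum>x\<le>N-L. \<tau> + (A x / real L) / \<tau>)"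
  proof (intro sum_mono)
    fix x
    have "U2_interval (\<lambda>n. of_real (g n)) x L \<le> 2 * sqrt (A x / real L)"
      using \<beta>[of x] by (simp only: A_def)
    also have "\<dots> \<le> \<tau> + (A x / real L) / \<tau>" using A0[of x] by (intro amgm) simp
    finally show "U2_interval (\<lambda>n. of_real (g n)) x L \<le> \<tau> + (A x / real L) / \<tau>" .
  qed
  also have "\<dots> = real (N - L + 1) * \<tau> + (\<Sum>x\<le>N-L. A x) / real L / \<tau>"
    by (simp add: sum.distrib sum_divide_distrib)
  also have "\<dots> \<le> real N * \<tau> + (\<kappa> * real N * real L) / real L / \<tau>"
    using sum_windows_le[OF assms(1,2) corr, of \<beta>] assms
    by (intro add_mono mult_right_mono divide_right_mono) (auto simp: A_def)
  also have "\<dots> = real N * (\<tau> + \<kappa> / \<tau>)" using assms by (simp add: field_simps)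
  finally show ?thesis .
qed

section \<open>Gluing and verification\<close>

text \<open>Each requirement holds for all late \<open>s\<close> once the levels are fixed, so stage
  \<open>k\<close> can be placed late enough for all levels \<open>j \<le> k\<close> together. Level
  \<open>k\<close> is the one truncated at stage \<open>k\<close>; the lower levels are kept as its
  approximants of fixed complexity.\<close>

lemma stage_sequence:
  fixes f :: "nat \<Rightarrow> real" and N Kp Km :: "nat \<Rightarrow> nat"
  assumes f: "\<And>n. n \<ge> 1 \<Longrightarrow> 0 \<le> f n \<and> f n \<le> 1"
    and pos: "pos_seq N" "pos_seq Kp" "pos_seq Km" and "seq_at_top Km" and "Km \<prec> Kp"
    and le: "\<And>s. Km s \<le> Kp s" "\<And>s. Kp s \<le> N s"
  obtains \<sigma> Hm Hp d :: "nat \<Rightarrow> nat"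
    and c :: "nat \<Rightarrow> nat \<Rightarrow> nat \<Rightarrow> nat \<Rightarrow> complex" and \<alpha> :: "nat \<Rightarrow> nat \<Rightarrow> nat \<Rightarrow> nat \<Rightarrow> real"
  where "strict_mono \<sigma>" "Hm \<prec> Hp" "\<And>k. Km (\<sigma> k) \<le> Hm k" "\<And>k. Hm k \<le> Hp k" "\<And>k. Hp k \<le> Kp (\<sigma> k)"
    "\<And>k. (k + 2) * N (\<sigma> k) \<le> N (\<sigma> (Suc k))"
    "\<And>j. d j \<ge> 1" "\<And>j k i n. cmod (c j k i n) \<le> 1"
    "\<And>j k i. i \<in> {1..d j} \<Longrightarrow>
       card (breaks (N (\<sigma> k)) (\<lambda>n. (c j k i n, \<alpha> j k i n))) * Hp k \<le> d j * N (\<sigma> k)"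
    "\<And>j k. k \<ge> 1 \<Longrightarrow> j \<le> k \<Longrightarrow> mean (N (\<sigma> k)) (\<lambda>n. (cmod (trig_sum (d j) (c j k) (\<alpha> j k) n -
        of_real (clamp01 (Re (trig_sum (d k) (c k k) (\<alpha> k k) n)))))\<^sup>2) \<le> 3 / real (Suc j) + 3 / real (Suc k)"
    "\<And>k \<phi>. k \<ge> 1 \<Longrightarrow> local_char (N (\<sigma> k)) (Hm k) 2 \<phi> \<Longrightarrow>
        mean (N (\<sigma> k)) (\<lambda>n. (f n - clamp01 (Re (trig_sum (d k) (c k k) (\<alpha> k k) n))) * Re (\<phi> n))
          \<le> 2 * sqrt (1 / real (Suc k))"
    "\<And>j ws. (\<lambda>k. mean (N (\<sigma> k)) (\<lambda>n. of_bool
       (1 / real (Hp k) \<le> norm_T (\<Sum>i=1..d j. of_int (ws ! (i - 1)) * \<alpha> j k i n) \<and>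
        norm_T (\<Sum>i=1..d j. of_int (ws ! (i - 1)) * \<alpha> j k i n) < 1 / real (Hm k)))) \<longlonglongrightarrow> 0"
proof (rule variational_window[OF f pos assms(6) le(1)])
  fix r Hm Hp :: "nat \<Rightarrow> nat" and V :: real and d :: "nat \<Rightarrow> nat"
    and c :: "nat \<Rightarrow> nat \<Rightarrow> nat \<Rightarrow> nat \<Rightarrow> complex" and \<alpha> :: "nat \<Rightarrow> nat \<Rightarrow> nat \<Rightarrow> nat \<Rightarrow> real"
  assume r: "strict_mono r" and H: "Hm \<prec> Hp" "\<And>s. Km (r s) \<le> Hm s" "\<And>s. Hm s \<le> Hp s" "\<And>s. Hp s \<le> Kp (r s)"
    and d: "\<And>j. d j \<ge> 1" and c: "\<And>j s i n. cmod (c j s i n) \<le> 1"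
    and br: "\<And>j s i. i \<in> {1..d j} \<Longrightarrow>
       card (breaks (N (r s)) (\<lambda>n. (c j s i n, \<alpha> j s i n))) * Hp s \<le> d j * N (r s)"
    and up: "\<And>j. \<forall>\<^sub>F s in sequentially. mean (N (r s))
       (\<lambda>n. (cmod (of_real (f n) - trig_sum (d j) (c j s) (\<alpha> j s) n))\<^sup>2) \<le> V + 1 / real (Suc j)"
    and low: "\<And>R \<eta>. bounded_complexity (N \<circ> r) Hm R \<Longrightarrow> \<eta> > 0 \<Longrightarrow> \<forall>\<^sub>F s in sequentially.
       V - \<eta> \<le> mean (N (r s)) (\<lambda>n. (cmod (of_real (f n) - R s n))\<^sup>2)"
    and sp: "\<And>j ws. (\<lambda>s. mean (N (r s)) (\<lambda>n. of_bool
       (1 / real (Hp s) \<le> norm_T (\<Sum>i=1..d j. of_int (ws ! (i - 1)) * \<alpha> j s i n) \<and>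
        norm_T (\<Sum>i=1..d j. of_int (ws ! (i - 1)) * \<alpha> j s i n) < 1 / real (Hm s)))) \<longlonglongrightarrow> 0"
  define P where "P j s = trig_sum (d j) (c j s) (\<alpha> j s)" for j s
  have bc: "bounded_complexity (N \<circ> r) Hm (P j)" for j
  proof -
    have "structured (N (r s)) (Hp s) (d j) (P j s)" for s
      unfolding P_def by (rule structured_trig_sum[OF c br])
    then have "structured (N (r s)) (Hm s) (d j) (P j s)" for s
      by (rule structured_mono[OF _ H(3)]) simp
    then show ?thesis by (auto simp: bounded_complexity_def)
  qed
  have posr: "pos_seq (N \<circ> r)" using pos(1) by (simp add: pos_seq_def)
  have low': "\<forall>\<^sub>F s in sequentially.
       V - \<eta> \<le> mean ((N \<circ> r) s) (\<lambda>n. (cmod (of_real (f n) - R s n))\<^sup>2)"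
    if "bounded_complexity (N \<circ> r) Hm R" "\<eta> > 0" for R \<eta>
    using low[OF that] by simp
  have up': "\<forall>\<^sub>F s in sequentially.
       mean ((N \<circ> r) s) (\<lambda>n. (cmod (of_real (f n) - P j s n))\<^sup>2) \<le> V + 1 / real (Suc j)" for j
    using up[of j] by (simp add: P_def)
  \<comment> \<open>The previous index \<open>p\<close> enters only the last clause, the growth of
    \<open>N\<close>.\<close>
  define Q where "Q k p s \<longleftrightarrow>
     (\<forall>j\<in>{..k}. mean ((N \<circ> r) s) (\<lambda>n. (cmod (P j s n - of_real (clamp01 (Re (P k s n)))))\<^sup>2)
        \<le> 3 / real (Suc j) + 3 / real (Suc k)) \<and>
     (\<forall>\<phi>. local_char ((N \<circ> r) s) (Hm s) 2 \<phi> \<longrightarrow>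
        mean ((N \<circ> r) s) (\<lambda>n. (f n - clamp01 (Re (P k s n))) * Re (\<phi> n)) \<le> 2 * sqrt (1 / real (Suc k))) \<and>
     (k + 1) * N (r p) \<le> N (r s)" for k p s
  have "\<forall>\<^sub>F s in sequentially. Q k p s" for k p
    unfolding Q_def
  proof (intro eventually_conj)
    show "\<forall>\<^sub>F s in sequentially. \<forall>j\<in>{..k}.
        mean ((N \<circ> r) s) (\<lambda>n. (cmod (P j s n - of_real (clamp01 (Re (P k s n)))))\<^sup>2)
        \<le> 3 / real (Suc j) + 3 / real (Suc k)"
    proof (intro eventually_ball_finite ballI)
      fix j assume "j \<in> {..k}"
      \<comment> \<open>The tolerance given to \<open>near_minimizers_close\<close> is
        \<open>1 / Suc j + 1 / Suc k\<close>, which turns its weights 2 into 3.\<close>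
      have *: "2 * (1 / real (Suc j)) + 2 * (1 / real (Suc k)) + (1 / real (Suc j) + 1 / real (Suc k))
        = 3 / real (Suc j) + 3 / real (Suc k)" by (simp only: divide_inverse)
      have "1 / real (Suc j) + 1 / real (Suc k) > 0" by (simp add: add_pos_pos)
      from near_minimizers_close[OF f posr low' bc bc up' up' this, of j k]
      show "\<forall>\<^sub>F s in sequentially.
        mean ((N \<circ> r) s) (\<lambda>n. (cmod (P j s n - of_real (clamp01 (Re (P k s n)))))\<^sup>2)
        \<le> 3 / real (Suc j) + 3 / real (Suc k)" unfolding * .
    qed auto
    show "\<forall>\<^sub>F s in sequentially. \<forall>\<phi>. local_char ((N \<circ> r) s) (Hm s) 2 \<phi> \<longrightarrow>
        mean ((N \<circ> r) s) (\<lambda>n. (f n - clamp01 (Re (P k s n))) * Re (\<phi> n)) \<le> 2 * sqrt (1 / real (Suc k))"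
      by (rule near_minimizer_uncorrelated[OF f posr low' bc up']) (assumption | simp)+
    have "filterlim (\<lambda>s. Km (r s)) at_top sequentially"
      using filterlim_compose[OF assms(5)[unfolded seq_at_top_def] filterlim_subseq[OF r]] .
    then have "\<forall>\<^sub>F s in sequentially. (k + 1) * N (r p) \<le> Km (r s)"
      by (simp add: filterlim_at_top)
    then show "\<forall>\<^sub>F s in sequentially. (k + 1) * N (r p) \<le> N (r s)"
    proof eventually_elim
      case (elim s)
      then show ?case using le(1)[of "r s"] le(2)[of "r s"] by linarith
    qed
  qed
  then obtain t where t: "strict_mono t" "\<And>k. Q (Suc k) (t k) (t (Suc k))"
    using strict_mono_choice[of Q] by blast
  have Qt: "Q k (t (k - 1)) (t k)" if "k \<ge> 1" for k
    using t(2)[of "k - 1"] that by simp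
  show thesis
  proof (rule that[where \<sigma> = "r \<circ> t" and Hm = "Hm \<circ> t" and Hp = "Hp \<circ> t" and d = d
        and c = "\<lambda>j k. c j (t k)" and \<alpha> = "\<lambda>j k. \<alpha> j (t k)"])
    show "strict_mono (r \<circ> t)" by (rule strict_mono_o[OF r t(1)])
    show "(Hm \<circ> t) \<prec> (Hp \<circ> t)"
      using LIMSEQ_subseq_LIMSEQ[OF H(1)[unfolded seq_less_def] t(1)] by (simp add: seq_less_def o_def)
    show "Km ((r \<circ> t) k) \<le> (Hm \<circ> t) k" "(Hm \<circ> t) k \<le> (Hp \<circ> t) k" "(Hp \<circ> t) k \<le> Kp ((r \<circ> t) k)" for k
      using H by auto
    show "(k + 2) * N ((r \<circ> t) k) \<le> N ((r \<circ> t) (Suc k))" for k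
      using t(2)[of k] by (simp add: Q_def)
    show "1 \<le> d j" "cmod (c j (t k) i n) \<le> 1" for j k i n by fact+
    show "card (breaks (N ((r \<circ> t) k)) (\<lambda>n. (c j (t k) i n, \<alpha> j (t k) i n))) * (Hp \<circ> t) k
        \<le> d j * N ((r \<circ> t) k)" if "i \<in> {1..d j}" for j k i
      using br[OF that] by simp
    show "mean (N ((r \<circ> t) k)) (\<lambda>n. (cmod (trig_sum (d j) (c j (t k)) (\<alpha> j (t k)) n -
        of_real (clamp01 (Re (trig_sum (d k) (c k (t k)) (\<alpha> k (t k)) n)))))\<^sup>2)
        \<le> 3 / real (Suc j) + 3 / real (Suc k)" if "k \<ge> 1" "j \<le> k" for j k
      using Qt[OF that(1)] that(2) unfolding Q_def P_def by auto
    show "mean (N ((r \<circ> t) k)) (\<lambda>n. (f n - clamp01 (Re (trig_sum (d k) (c k (t k)) (\<alpha> k (t k)) n))) * Re (\<phi> n))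
          \<le> 2 * sqrt (1 / real (Suc k))" if "k \<ge> 1" "local_char (N ((r \<circ> t) k)) ((Hm \<circ> t) k) 2 \<phi>" for k \<phi>
      using Qt[OF that(1)] that(2) unfolding Q_def P_def by auto
    show "(\<lambda>k. mean (N ((r \<circ> t) k)) (\<lambda>n. of_bool
       (1 / real ((Hp \<circ> t) k) \<le> norm_T (\<Sum>i=1..d j. of_int (ws ! (i - 1)) * \<alpha> j (t k) i n) \<and>
        norm_T (\<Sum>i=1..d j. of_int (ws ! (i - 1)) * \<alpha> j (t k) i n) < 1 / real ((Hm \<circ> t) k)))) \<longlonglongrightarrow> 0" for j ws
      using LIMSEQ_subseq_LIMSEQ[OF sp[of ws j] t(1)] by (simp add: o_def)
  qed
qed

text \<open>Glued data differ from those of a given stage only on the part taken from earlier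
  stages, a prefix of length \<open>m\<close>; this is the resulting error in an average.\<close>

lemma mean_change_prefix:
  assumes "m \<le> M" "\<And>n. n \<in> {m<..M} \<Longrightarrow> a n = b n" "\<And>n. n \<in> {1..m} \<Longrightarrow> \<bar>a n - b n\<bar> \<le> B"
  shows "\<bar>mean M a - mean M b\<bar> \<le> B * (real m / real M)"
proof -
  have "(\<Sum>n=1..M. a n - b n) = (\<Sum>n=1..m. a n - b n)"
    using assms by (intro sum.mono_neutral_right) auto
  moreover have "\<bar>\<Sum>n=1..m. a n - b n\<bar> \<le> (\<Sum>n=1..m. B)"
    by (rule order_trans[OF sum_abs sum_mono]) (use assms in auto)
  ultimately have "\<bar>(\<Sum>n=1..M. a n - b n)\<bar> \<le> real m * B" by simp
  then have "\<bar>(\<Sum>n=1..M. a n - b n)\<bar> / real M \<le> real m * B / real M" by (rule divide_right_mono) simp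
  moreover have "\<bar>mean M a - mean M b\<bar> = \<bar>(\<Sum>n=1..M. a n - b n)\<bar> / real M"
    unfolding mean_diff[symmetric] by (simp add: mean_def)
  ultimately show ?thesis by (simp add: mult.commute)
qed

lemma norm_trig_sum_le:
  assumes "\<And>i n. cmod (c i n) \<le> 1"
  shows "cmod (trig_sum d c \<alpha> n) \<le> real d"
proof -
  have "cmod (trig_sum d c \<alpha> n) \<le> (\<Sum>i=1..d. cmod (c i n * unit_exp (real n * \<alpha> i n)))"
    unfolding trig_sum_def by (rule norm_sum)
  also have "\<dots> \<le> (\<Sum>i=1..d. 1)" by (intro sum_mono) (simp add: norm_mult assms)
  finally show ?thesis by simp
qed

lemma U2_interval_nonneg: "0 \<le> U2_interval g x L"
proof -
  have "0 \<le> U2_cyclic M u" for M u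
    using U2_cyclic_pow4_nonneg[of M u] by (auto simp: U2_cyclic_def)
  then show ?thesis by (simp add: U2_interval_def)
qed

text \<open>The inverse theorem combined with the trivial bound for the exponential sum. The bound
  serves for the windows that start in a negligible prefix, so its crudeness is harmless.\<close>

lemma U2_interval_le_2:
  assumes "L \<ge> 1" and g: "\<And>m. m \<in> {1..L} \<Longrightarrow> cmod (g (x + m)) \<le> 1"
  shows "U2_interval g x L \<le> 2"
proof -
  obtain \<beta> where \<beta>: "U2_interval g x L
    \<le> 2 * sqrt (cmod (\<Sum>m=1..L. g (x + m) * unit_exp (real (x + m) * \<beta>)) / real L)"
    using U2_interval_inverse[of L g x] assms by blast
  have "cmod (\<Sum>m=1..L. g (x + m) * unit_exp (real (x + m) * \<beta>)) \<le> (\<Sum>m=1..L. 1)"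
    by (rule order_trans[OF norm_sum sum_mono]) (simp add: norm_mult g)
  then have "cmod (\<Sum>m=1..L. g (x + m) * unit_exp (real (x + m) * \<beta>)) / real L \<le> 1"
    using assms(1) by simp
  then have "sqrt (cmod (\<Sum>m=1..L. g (x + m) * unit_exp (real (x + m) * \<beta>)) / real L) \<le> sqrt 1"
    by (rule real_sqrt_le_mono)
  then show ?thesis using \<beta> by (simp only: real_sqrt_one)
qed

lemma U2_interval_cong:
  assumes "\<And>m. m \<in> {1..L} \<Longrightarrow> g (x + m) = h (x + m)"
  shows "U2_interval g x L = U2_interval h x L"
proof -
  have "(\<lambda>n. of_bool (n \<in> {1..L}) * g (x + n)) = (\<lambda>n. of_bool (n \<in> {1..L}) * h (x + n))"
    using assms by (intro ext) (auto simp: of_bool_def)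
  then show ?thesis by (simp add: U2_interval_def)
qed

section \<open>Properties of almost all windows\<close>

lemma almost_allI:
  fixes M H :: "nat \<Rightarrow> nat" and A :: "nat \<Rightarrow> nat set"
  assumes "pos_seq M" and H: "\<forall>\<^sub>F k in sequentially. 2 * H k \<le> M k"
    and A: "\<And>k. A k \<subseteq> {1..M k - H k + 1}"
    and bad: "\<forall>\<^sub>F k in sequentially. real (card ({1..M k - H k + 1} - A k)) \<le> E k"
    and E: "(\<lambda>k. E k / real (M k)) \<longlonglongrightarrow> 0"
  shows "almost_all M H A"
proof -
  define b where "b k = real (card ({1..M k - H k + 1} - A k)) / real (M k - H k + 1)" for k
  have ratio: "real (card (A k)) / real (M k - H k + 1) = 1 - b k" for k
  proof -
    have "card ({1..M k - H k + 1} - A k) = card {1..M k - H k + 1} - card (A k)"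
      using A finite_subset[OF A] by (intro card_Diff_subset) auto
    moreover have "card (A k) \<le> card {1..M k - H k + 1}" by (rule card_mono[OF _ A]) simp
    ultimately have "real (card ({1..M k - H k + 1} - A k)) = real (M k - H k + 1) - real (card (A k))"
      by (simp add: of_nat_diff)
    then show ?thesis unfolding b_def by (simp add: field_simps)
  qed
  have "b \<longlonglongrightarrow> 0"
  proof (rule tendsto_sandwich[OF _ _ tendsto_const])
    show "\<forall>\<^sub>F k in sequentially. 0 \<le> b k" by (simp add: b_def)
    show "(\<lambda>k. 2 * (E k / real (M k))) \<longlonglongrightarrow> 0" using tendsto_mult_left[OF E, of 2] by simp
    show "\<forall>\<^sub>F k in sequentially. b k \<le> 2 * (E k / real (M k))"
      using H bad
    proof eventually_elim
      case (elim k)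
      have M: "real (M k) > 0" using assms(1) by (simp add: pos_seq_def Suc_le_eq)
      \<comment> \<open>There are at least \<open>M k / 2\<close> windows, so exceptional sets may
        be measured against \<open>M k\<close>.\<close>
      have "real (M k) / 2 \<le> real (M k - H k + 1)" using elim(1) by (simp add: of_nat_diff)
      then have "b k \<le> E k / (real (M k) / 2)"
        unfolding b_def using elim(2) M by (intro frac_le) auto
      then show ?case by (simp add: mult.commute)
    qed
  qed
  then have "(\<lambda>k. 1 - b k) \<longlonglongrightarrow> 1 - 0" by (intro tendsto_intros)
  then show ?thesis unfolding almost_all_def ratio by simp
qed

lemma ex_break_between:
  fixes a :: "nat \<Rightarrow> 'a"
  assumes "a p \<noteq> a q" "p < q"
  shows "\<exists>b\<in>{p..<q}. a b \<noteq> a (Suc b)"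
proof (rule ccontr)
  assume no: "\<not> ?thesis"
  have "p \<le> n \<Longrightarrow> n \<le> q \<Longrightarrow> a n = a p" for n
  proof (induction n)
    case (Suc n)
    then show ?case using no by (cases "p = Suc n") auto
  qed simp
  from this[of q] show False using assms by simp
qed

text \<open>A window on which some \<open>a i\<close> varies contains a break \<open>b\<close>, so
  its start lies in \<open>{b - H k..b}\<close>, a set of at most
  \<open>H k + 1 \<le> 2 * H k\<close> points. The summand \<open>m\<close> discards a prefix. The
  summand 1 discards the last start \<open>M k - H k + 1\<close>, whose window
  \<open>{n + 1..n + H k}\<close> reaches one step beyond \<open>M k\<close>.\<close>

lemma card_not_locally_constant_le:
  fixes a :: "nat \<Rightarrow> nat \<Rightarrow> 'a"
  assumes "1 \<le> H k"
  shows "card ({1..M k - H k + 1} - locally_constant_set M H d a k)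
    \<le> m + 1 + (\<Sum>i=1..d. card {n \<in> breaks (M k) (a i). m < n} * (2 * H k))"
proof -
  define B where "B i = {n \<in> breaks (M k) (a i). m < n}" for i
  have finB: "finite (B i)" for i by (simp add: B_def)
  have "{1..M k - H k + 1} - locally_constant_set M H d a k
     \<subseteq> ({1..m} \<union> {M k - H k + 1}) \<union> (\<Union>i\<in>{1..d}. \<Union>b\<in>B i. {b - H k..b})"
  proof
    fix n assume n: "n \<in> {1..M k - H k + 1} - locally_constant_set M H d a k"
    then obtain i m1 m2 where i: "i \<in> {1..d}" "m1 \<in> {1..H k}" "m2 \<in> {1..H k}"
      "a i (n + m1) \<noteq> a i (n + m2)" by (auto simp: locally_constant_set_def)
    obtain p q where pq: "a i p \<noteq> a i q" "p < q" "n + 1 \<le> p" "q \<le> n + H k"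
    proof (cases "m1 < m2")
      case True
      then show ?thesis using i by (intro that[of "n + m1" "n + m2"]) auto
    next
      case False
      then have "m2 < m1" using i(4) by (cases "m1 = m2") auto
      then show ?thesis using i by (intro that[of "n + m2" "n + m1"]) auto
    qed
    obtain b where b: "b \<in> {p..<q}" "a i b \<noteq> a i (Suc b)"
      using ex_break_between[OF pq(1,2)] by blast
    show "n \<in> ({1..m} \<union> {M k - H k + 1}) \<union> (\<Union>i\<in>{1..d}. \<Union>b\<in>B i. {b - H k..b})"
    proof (cases "n \<le> m \<or> n = M k - H k + 1")
      case True
      then show ?thesis using n by auto
    next
      case False
      then have "n > m" "n \<le> M k - H k" using n by auto
      then have "n + H k \<le> M k" using n by auto
      then have "b \<in> B i" using b pq \<open>n > m\<close> by (auto simp: B_def breaks_def)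
      moreover have "n \<in> {b - H k..b}" using b pq by auto
      ultimately show ?thesis using i(1) by blast
    qed
  qed
  then have "card ({1..M k - H k + 1} - locally_constant_set M H d a k)
     \<le> card (({1..m} \<union> {M k - H k + 1}) \<union> (\<Union>i\<in>{1..d}. \<Union>b\<in>B i. {b - H k..b}))"
    by (intro card_mono) (auto simp: finB)
  also have "\<dots> \<le> card ({1..m} \<union> {M k - H k + 1}) + card (\<Union>i\<in>{1..d}. \<Union>b\<in>B i. {b - H k..b})"
    by (rule card_Un_le)
  also have "card ({1..m} \<union> {M k - H k + 1}) \<le> m + 1"
    using card_Un_le[of "{1..m}" "{M k - H k + 1}"] by simp
  also have "card (\<Union>i\<in>{1..d}. \<Union>b\<in>B i. {b - H k..b}) \<le> (\<Sum>i=1..d. card (B i) * (2 * H k))"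
  proof -
    have "card (\<Union>i\<in>{1..d}. \<Union>b\<in>B i. {b - H k..b}) \<le> (\<Sum>i=1..d. card (\<Union>b\<in>B i. {b - H k..b}))"
      by (rule card_UN_le) simp
    also have "\<dots> \<le> (\<Sum>i=1..d. \<Sum>b\<in>B i. card {b - H k..b})"
      by (intro sum_mono card_UN_le finB)
    also have "\<dots> \<le> (\<Sum>i=1..d. \<Sum>b\<in>B i. 2 * H k)"
      using assms by (intro sum_mono) auto
    finally show ?thesis by simp
  qed
  finally show ?thesis by (simp add: B_def)
qed

text \<open>Beyond the prefix each index has at most \<open>D * M k / Hp k\<close> breaks, and each
  break spoils at most \<open>2 * H k\<close> windows; the bad proportion is therefore of order
  \<open>H k / Hp k\<close>, up to vanishing terms.\<close>

lemma almost_all_locally_constant: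
  fixes a :: "nat \<Rightarrow> nat \<Rightarrow> 'a" and M H Hp m :: "nat \<Rightarrow> nat"
  assumes M: "pos_seq M" "filterlim M at_top sequentially" and H: "pos_seq H" "\<forall>\<^sub>F k in sequentially. 2 * H k \<le> M k"
    and Hp: "pos_seq Hp" "H \<prec> Hp" and m: "(\<lambda>k. real (m k) / real (M k)) \<longlonglongrightarrow> 0"
    and br: "\<And>k i. i \<in> {1..d} \<Longrightarrow> card {n \<in> breaks (M k) (a i). m k < n} * Hp k \<le> D * M k"
  shows "almost_all M H (locally_constant_set M H d a)"
proof (rule almost_allI[OF M(1) H(2)])
  show "locally_constant_set M H d a k \<subseteq> {1..M k - H k + 1}" for k
    by (auto simp: locally_constant_set_def)
  define E where "E k = real (m k) + 1 + real d * (real D * real (M k) / real (Hp k) * (2 * real (H k)))" for k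
  have Mk: "real (M k) > 0" for k using M(1) by (simp add: pos_seq_def Suc_le_eq)
  show "\<forall>\<^sub>F k in sequentially. real (card ({1..M k - H k + 1} - locally_constant_set M H d a k)) \<le> E k"
  proof (intro always_eventually allI)
    fix k
    have Hk: "real (Hp k) > 0" using Hp(1) by (simp add: pos_seq_def Suc_le_eq)
    have "real (card ({1..M k - H k + 1} - locally_constant_set M H d a k))
      \<le> real (m k + 1 + (\<Sum>i=1..d. card {n \<in> breaks (M k) (a i). m k < n} * (2 * H k)))"
      using H(1) by (intro of_nat_mono card_not_locally_constant_le) (simp add: pos_seq_def)
    also have "\<dots> = real (m k) + 1 + (\<Sum>i=1..d. real (card {n \<in> breaks (M k) (a i). m k < n}) * (2 * real (H k)))"
      by simp
    also have "\<dots> \<le> real (m k) + 1 + (\<Sum>i=1..d. real D * real (M k) / real (Hp k) * (2 * real (H k)))"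
    proof (intro add_left_mono sum_mono mult_right_mono)
      fix i assume "i \<in> {1..d}"
      from br[OF this, of k] have "real (card {n \<in> breaks (M k) (a i). m k < n} * Hp k) \<le> real (D * M k)"
        by (rule of_nat_mono)
      then show "real (card {n \<in> breaks (M k) (a i). m k < n}) \<le> real D * real (M k) / real (Hp k)"
        using Hk by (simp add: pos_le_divide_eq)
    qed simp
    finally show "real (card ({1..M k - H k + 1} - locally_constant_set M H d a k)) \<le> E k"
      by (simp add: E_def)
  qed
  have "(\<lambda>k. real (m k) / real (M k) + 1 / real (M k) + 2 * real d * real D * (real (H k) / real (Hp k)))
      \<longlonglongrightarrow> 0 + 0 + 2 * real d * real D * 0"
    using m Hp(2) unfolding seq_less_def
    by (intro tendsto_intros real_tendsto_divide_at_top[OF tendsto_const]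
        filterlim_compose[OF filterlim_real_sequentially M(2)])
  moreover have "E k / real (M k) = real (m k) / real (M k) + 1 / real (M k)
      + 2 * real d * real D * (real (H k) / real (Hp k))" for k
  proof -
    have "real (M k) \<noteq> 0" using Mk[of k] by simp
    then show ?thesis by (simp add: E_def add_divide_distrib)
  qed
  ultimately show "(\<lambda>k. E k / real (M k)) \<longlonglongrightarrow> 0" by simp
qed

text \<open>A violation places \<open>norm_T\<close> of some combination strictly between
  \<open>1 / (C * H k)\<close> and \<open>C / H k\<close>. Since
  \<open>Hm \<prec> H \<prec> Hp\<close>, this range eventually lies inside
  \<open>[1 / Hp k, 1 / Hm k)\<close>, where \<open>gap\<close> makes the proportion vanish; only
  finitely many combinations occur.\<close>

lemma almost_all_well_spaced:
  fixes \<alpha> :: "nat \<Rightarrow> nat \<Rightarrow> real" and M H Hm Hp :: "nat \<Rightarrow> nat"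
  assumes M: "pos_seq M" and H: "pos_seq H" "\<forall>\<^sub>F k in sequentially. 2 * H k \<le> M k"
    and Hp: "pos_seq Hp" "H \<prec> Hp" and Hm: "pos_seq Hm" "Hm \<prec> H" and "C \<ge> 1"
    and gap: "\<And>ws. (\<lambda>k. mean (M k) (\<lambda>n. of_bool
       (1 / real (Hp k) \<le> norm_T (\<Sum>i=1..d. of_int (ws ! (i - 1)) * \<alpha> i n) \<and>
        norm_T (\<Sum>i=1..d. of_int (ws ! (i - 1)) * \<alpha> i n) < 1 / real (Hm k)))) \<longlonglongrightarrow> 0"
  shows "almost_all M H (well_spaced_set M H d \<alpha> C)"
proof (rule almost_allI[OF M(1) H(2)])
  show "well_spaced_set M H d \<alpha> C k \<subseteq> {1..M k - H k + 1}" for k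
    by (auto simp: well_spaced_set_def)
  define x where "x ws n = norm_T (\<Sum>i=1..d. of_int (ws ! (i - 1)) * \<alpha> i n)" for ws :: "int list" and n
  \<comment> \<open>Integers of modulus at most \<open>C\<close> have modulus at most
    \<open>\<lfloor>C\<rfloor>\<close>, so these finitely many lists encode all coefficient vectors
    in question.\<close>
  define W where "W = {ws :: int list. set ws \<subseteq> {-\<lfloor>C\<rfloor>..\<lfloor>C\<rfloor>} \<and> length ws = d}"
  have finW: "finite W" unfolding W_def by (rule finite_lists_length_eq) simp
  define E where "E k = (\<Sum>ws\<in>W. mean (M k) (\<lambda>n. of_bool
       (1 / real (Hp k) \<le> x ws n \<and> x ws n < 1 / real (Hm k))) * real (M k))" for k
  have Mk: "real (M k) > 0" for k using M(1) by (simp add: pos_seq_def Suc_le_eq)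
  have "\<forall>\<^sub>F k in sequentially. C * real (H k) \<le> real (Hp k)"
    using Hp \<open>C \<ge> 1\<close> by (intro seq_less_eventually) auto
  moreover have "\<forall>\<^sub>F k in sequentially. C * real (Hm k) \<le> real (H k)"
    using Hm H(1) \<open>C \<ge> 1\<close> by (intro seq_less_eventually) auto
  ultimately show "\<forall>\<^sub>F k in sequentially.
      real (card ({1..M k - H k + 1} - well_spaced_set M H d \<alpha> C k)) \<le> E k"
    using H(2)
  proof eventually_elim
    case (elim k)
    have Hk: "real (H k) > 0" "real (Hm k) > 0" "real (Hp k) > 0"
      using H(1) Hm(1) Hp(1) by (simp_all add: pos_seq_def Suc_le_eq)
    define A where "A ws = {n \<in> {1..M k}. 1 / real (Hp k) \<le> x ws n \<and> x ws n < 1 / real (Hm k)}" for ws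
    have "{1..M k - H k + 1} - well_spaced_set M H d \<alpha> C k \<subseteq> (\<Union>ws\<in>W. A ws)"
    proof
      fix n assume n: "n \<in> {1..M k - H k + 1} - well_spaced_set M H d \<alpha> C k"
      then obtain w :: "nat \<Rightarrow> int" where w: "\<forall>i\<in>{1..d}. - C \<le> of_int (w i) \<and> of_int (w i) \<le> C"
        and lo: "\<not> norm_T (\<Sum>i=1..d. of_int (w i) * \<alpha> i n) \<le> 1 / (C * real (H k))"
        and hi: "\<not> norm_T (\<Sum>i=1..d. of_int (w i) * \<alpha> i n) \<ge> C / real (H k)"
        unfolding well_spaced_set_def by blast
      \<comment> \<open>The list is indexed from 0 and the vector from 1, whence
        \<open>i - 1\<close> in the sums.\<close>
      define ws where "ws = map w [1..<Suc d]"
      have "set ws \<subseteq> {-\<lfloor>C\<rfloor>..\<lfloor>C\<rfloor>}"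
      proof
        fix v assume "v \<in> set ws"
        then obtain i where i: "v = w i" "i \<in> {1..d}" by (auto simp: ws_def simp del: upt_Suc)
        then have "- C \<le> of_int v" "of_int v \<le> C" using w by auto
        then show "v \<in> {-\<lfloor>C\<rfloor>..\<lfloor>C\<rfloor>}" by (auto simp: le_floor_iff minus_le_iff)
      qed
      then have "ws \<in> W" by (simp add: W_def ws_def)
      have "(\<Sum>i=1..d. of_int (ws ! (i - 1)) * \<alpha> i n) = (\<Sum>i=1..d. of_int (w i) * \<alpha> i n)"
        by (intro sum.cong refl) (auto simp: ws_def simp del: upt_Suc)
      then have x: "x ws n = norm_T (\<Sum>i=1..d. of_int (w i) * \<alpha> i n)" by (simp add: x_def)
      have "1 / real (Hp k) \<le> 1 / (C * real (H k))"
        using elim(1) Hk \<open>C \<ge> 1\<close> by (intro divide_left_mono) auto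
      then have "1 / real (Hp k) \<le> x ws n" using lo unfolding x by linarith
      moreover have "C / real (H k) \<le> 1 / real (Hm k)"
        using elim(2) Hk by (simp add: field_simps)
      then have "x ws n < 1 / real (Hm k)" using hi unfolding x by linarith
      moreover have "n \<in> {1..M k}"
      proof -
        have "1 \<le> H k" using H(1) by (simp add: pos_seq_def)
        then show ?thesis using n elim(3) by auto
      qed
      ultimately show "n \<in> (\<Union>ws\<in>W. A ws)" using \<open>ws \<in> W\<close> by (auto simp: A_def)
    qed
    then have "card ({1..M k - H k + 1} - well_spaced_set M H d \<alpha> C k) \<le> card (\<Union>ws\<in>W. A ws)"
      by (intro card_mono) (auto simp: finW A_def)
    also have "\<dots> \<le> (\<Sum>ws\<in>W. card (A ws))" by (rule card_UN_le[OF finW])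
    finally have "real (card ({1..M k - H k + 1} - well_spaced_set M H d \<alpha> C k)) \<le> (\<Sum>ws\<in>W. real (card (A ws)))"
      by (simp only: of_nat_sum[symmetric] of_nat_le_iff)
    also have "\<dots> = E k" unfolding E_def
    proof (rule sum.cong[OF refl])
      fix ws
      show "real (card (A ws)) = mean (M k) (\<lambda>n. of_bool (1 / real (Hp k) \<le> x ws n \<and> x ws n < 1 / real (Hm k))) * real (M k)"
        using Mk[of k] by (simp add: mean_def A_def of_bool_def sum.If_cases Int_def)
    qed
    finally show ?case .
  qed
  have "(\<lambda>k. \<Sum>ws\<in>W. mean (M k) (\<lambda>n. of_bool
       (1 / real (Hp k) \<le> x ws n \<and> x ws n < 1 / real (Hm k)))) \<longlonglongrightarrow> (\<Sum>ws\<in>W. 0)"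
    by (intro tendsto_sum) (use gap in \<open>simp add: x_def\<close>)
  moreover have "E k / real (M k) = (\<Sum>ws\<in>W. mean (M k) (\<lambda>n. of_bool
       (1 / real (Hp k) \<le> x ws n \<and> x ws n < 1 / real (Hm k))))" for k
    using Mk[of k] by (simp add: E_def sum_distrib_right[symmetric])
  ultimately show "(\<lambda>k. E k / real (M k)) \<longlonglongrightarrow> 0" by simp
qed

text \<open>The data are tied to \<open>Hm\<close> and \<open>Hp\<close> only, so one decomposition
  with one family of approximants serves every \<open>H\<close> in between, and \<open>H'\<close> is
  \<open>Hm\<close>.\<close>

lemma U2_good_scaleI:
  fixes f f_str :: "nat \<Rightarrow> real" and M Hm Hp m H d :: "nat \<Rightarrow> nat"
    and c :: "nat \<Rightarrow> nat \<Rightarrow> nat \<Rightarrow> complex" and \<alpha> :: "nat \<Rightarrow> nat \<Rightarrow> nat \<Rightarrow> real"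
  assumes pos: "pos_seq M" "pos_seq Hm" "pos_seq Hp" and Hm: "filterlim Hm at_top sequentially"
    and HpM: "\<And>k. Hp k \<le> M k"
    and str: "\<And>n. 0 \<le> f_str n \<and> f_str n \<le> 1"
    and mn: "has_mean M (\<lambda>n. f n - f_str n) 0"
    and U2: "has_U2_norm M Hm (\<lambda>n. of_real (f n - f_str n)) 0"
    and m: "(\<lambda>k. real (m k) / real (M k)) \<longlonglongrightarrow> 0"
    and d: "\<And>j. d j \<ge> 1" and c: "\<And>j i n. cmod (c j i n) \<le> 1"
    and br: "\<And>j k i. i \<in> {1..d j} \<Longrightarrow>
       card {n \<in> breaks (M k) (\<lambda>n. (c j i n, \<alpha> j i n)). m k < n} * Hp k \<le> d j * M k"
    and gap: "\<And>j ws. (\<lambda>k. mean (M k) (\<lambda>n. of_bool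
       (1 / real (Hp k) \<le> norm_T (\<Sum>i=1..d j. of_int (ws ! (i - 1)) * \<alpha> j i n) \<and>
        norm_T (\<Sum>i=1..d j. of_int (ws ! (i - 1)) * \<alpha> j i n) < 1 / real (Hm k)))) \<longlonglongrightarrow> 0"
    and L2: "\<And>j. \<exists>l\<le>6 / real (Suc j).
       has_mean M (\<lambda>n. (cmod (trig_sum (d j) (c j) (\<alpha> j) n - of_real (f_str n)))\<^sup>2) l"
    and H: "pos_seq H" "Hm \<prec> H" "H \<prec> Hp"
  shows "U2_good_scale M H f"
proof -
  have HmH: "\<forall>\<^sub>F k in sequentially. Hm k \<le> H k"
    using seq_less_eventually[OF H(2,1), of 1] by simp
  have H2: "\<forall>\<^sub>F k in sequentially. 2 * H k \<le> M k"
    using seq_less_eventually[OF H(3) pos(3), of 2]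
  proof (rule eventually_mono)
    fix k assume "2 * real (H k) \<le> real (Hp k)"
    then show "2 * H k \<le> M k" using HpM[of k] by linarith
  qed simp
  have Htop: "filterlim H at_top sequentially"
    by (rule filterlim_at_top_mono[OF Hm HmH])
  have Mtop: "filterlim M at_top sequentially"
    by (rule filterlim_at_top_mono[OF Htop]) (use H2 in \<open>rule eventually_mono\<close>, simp)
  have Hle: "H \<preceq> M" unfolding seq_le_def using H2 by (rule eventually_mono) simp
  have lc: "almost_all M H (locally_constant_set M H (d j) (\<alpha> j))"
    "almost_all M H (locally_constant_set M H (d j) (c j))" for j
  proof -
    have "card {n \<in> breaks (M k) (\<alpha> j i). m k < n} * Hp k \<le> d j * M k"
      "card {n \<in> breaks (M k) (c j i). m k < n} * Hp k \<le> d j * M k" if "i \<in> {1..d j}" for k i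
    proof -
      have "card {n \<in> breaks (M k) (\<alpha> j i). m k < n} \<le> card {n \<in> breaks (M k) (\<lambda>n. (c j i n, \<alpha> j i n)). m k < n}"
        "card {n \<in> breaks (M k) (c j i). m k < n} \<le> card {n \<in> breaks (M k) (\<lambda>n. (c j i n, \<alpha> j i n)). m k < n}"
        by (rule card_mono; force simp: breaks_def)+
      then show "card {n \<in> breaks (M k) (\<alpha> j i). m k < n} * Hp k \<le> d j * M k"
        "card {n \<in> breaks (M k) (c j i). m k < n} * Hp k \<le> d j * M k"
        using br[OF that, of k] mult_le_mono1 order_trans by blast+
    qed
    note b = this
    show "almost_all M H (locally_constant_set M H (d j) (\<alpha> j))"
      by (rule almost_all_locally_constant[OF pos(1) Mtop H(1) H2 pos(3) H(3) m b(1)])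
    show "almost_all M H (locally_constant_set M H (d j) (c j))"
      by (rule almost_all_locally_constant[OF pos(1) Mtop H(1) H2 pos(3) H(3) m b(2)])
  qed
  have approx: "\<exists>d\<ge>1. \<exists>(c :: nat \<Rightarrow> nat \<Rightarrow> complex) (\<alpha> :: nat \<Rightarrow> nat \<Rightarrow> real).
           (\<forall>i\<in>{1..d}. \<forall>n\<ge>1. cmod (c i n) \<le> 1) \<and>
           (\<exists>l\<le>\<epsilon>. has_L2_norm M (\<lambda>n. trig_sum d c \<alpha> n - of_real (f_str n)) l) \<and>
           (\<forall>C\<ge>1. almost_all M H (locally_constant_set M H d \<alpha>) \<and>
                  almost_all M H (locally_constant_set M H d c) \<and>
                  almost_all M H (well_spaced_set M H d \<alpha> C))" if "\<epsilon> > 0" for \<epsilon> :: real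
  proof -
    \<comment> \<open>\<open>6 / Suc j\<close> bounds the square of the norm, hence the comparison
      with \<open>\<epsilon>\<^sup>2\<close>.\<close>
    obtain j where j: "6 / \<epsilon>\<^sup>2 \<le> real j" using real_arch_simple by blast
    obtain l where l: "l \<le> 6 / real (Suc j)"
      "has_mean M (\<lambda>n. (cmod (trig_sum (d j) (c j) (\<alpha> j) n - of_real (f_str n)))\<^sup>2) l"
      using L2 by blast
    have "6 / \<epsilon>\<^sup>2 \<le> real (Suc j)" using j by simp
    then have "6 / real (Suc j) \<le> \<epsilon>\<^sup>2" using that by (simp add: field_simps)
    then have "sqrt l \<le> \<epsilon>" using l(1) that by (intro real_le_lsqrt) auto
    then have "\<exists>l\<le>\<epsilon>. has_L2_norm M (\<lambda>n. trig_sum (d j) (c j) (\<alpha> j) n - of_real (f_str n)) l"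
      using l(2) unfolding has_L2_norm_def by blast
    moreover have "almost_all M H (well_spaced_set M H (d j) (\<alpha> j) C)" if "C \<ge> 1" for C
      by (rule almost_all_well_spaced[OF pos(1) H(1) H2 pos(3) H(3) pos(2) H(2) that gap])
    ultimately show ?thesis using d[of j] c lc[of j]
      by (intro exI[of _ "d j"] conjI exI[of _ "c j"] exI[of _ "\<alpha> j"]) auto
  qed
  show ?thesis
    unfolding U2_good_scale_def
  proof (intro conjI)
    show "seq_at_top H" "H \<preceq> M" using Htop Hle by (simp_all add: seq_at_top_def)
    have "seq_at_top Hm" using Hm by (simp add: seq_at_top_def)
    then show "\<exists>f_str f_unf :: nat \<Rightarrow> real.
        (\<forall>n\<ge>1. f n = f_str n + f_unf n) \<and>
        (\<forall>n\<ge>1. 0 \<le> f_str n \<and> f_str n \<le> 1) \<and>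
        has_mean M f_unf 0 \<and>
        (\<forall>\<epsilon>>0. \<exists>d\<ge>1. \<exists>(c :: nat \<Rightarrow> nat \<Rightarrow> complex) (\<alpha> :: nat \<Rightarrow> nat \<Rightarrow> real).
           (\<forall>i\<in>{1..d}. \<forall>n\<ge>1. cmod (c i n) \<le> 1) \<and>
           (\<exists>l\<le>\<epsilon>. has_L2_norm M (\<lambda>n. trig_sum d c \<alpha> n - of_real (f_str n)) l) \<and>
           (\<forall>C\<ge>1. almost_all M H (locally_constant_set M H d \<alpha>) \<and>
                  almost_all M H (locally_constant_set M H d c) \<and>
                  almost_all M H (well_spaced_set M H d \<alpha> C))) \<and>
        (\<exists>H'. pos_seq H' \<and> seq_at_top H' \<and> H' \<prec> H \<and>
              has_U2_norm M H' (\<lambda>n. of_real (f_unf n)) 0)"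
      using str mn U2 pos(2) H(2) approx
      by - (rule exI[of _ f_str], rule exI[of _ "\<lambda>n. f n - f_str n"], intro conjI exI[of _ Hm] allI impI; simp)
  qed
qed

text \<open>The data of \<open>stage_sequence\<close> depend on the stage, while those of a good
  scale may not. Each \<open>n\<close> receives the data of its own stage; by lacunarity, what
  earlier stages contribute is negligible at every later one.\<close>

lemma glued_decomposition:
  fixes f :: "nat \<Rightarrow> real" and N Kp Km :: "nat \<Rightarrow> nat"
  assumes f: "\<And>n. n \<ge> 1 \<Longrightarrow> 0 \<le> f n \<and> f n \<le> 1"
    and pos: "pos_seq N" "pos_seq Kp" "pos_seq Km" and "seq_at_top Km" and "Km \<prec> Kp"
    and le: "\<And>s. Km s \<le> Kp s" "\<And>s. Kp s \<le> N s"
  obtains \<sigma> Hm Hp d m :: "nat \<Rightarrow> nat" and f_str :: "nat \<Rightarrow> real"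
    and c :: "nat \<Rightarrow> nat \<Rightarrow> nat \<Rightarrow> complex" and \<alpha> :: "nat \<Rightarrow> nat \<Rightarrow> nat \<Rightarrow> real"
  where "strict_mono \<sigma>" "Hm \<prec> Hp" "\<And>k. Km (\<sigma> k) \<le> Hm k" "\<And>k. Hm k \<le> Hp k" "\<And>k. Hp k \<le> Kp (\<sigma> k)"
    "\<And>n. 0 \<le> f_str n \<and> f_str n \<le> 1"
    "has_mean (N \<circ> \<sigma>) (\<lambda>n. f n - f_str n) 0"
    "has_U2_norm (N \<circ> \<sigma>) Hm (\<lambda>n. of_real (f n - f_str n)) 0"
    "(\<lambda>k. real (m k) / real (N (\<sigma> k))) \<longlonglongrightarrow> 0"
    "\<And>j. d j \<ge> 1" "\<And>j i n. cmod (c j i n) \<le> 1"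
    "\<And>j k i. i \<in> {1..d j} \<Longrightarrow>
       card {n \<in> breaks (N (\<sigma> k)) (\<lambda>n. (c j i n, \<alpha> j i n)). m k < n} * Hp k \<le> d j * N (\<sigma> k)"
    "\<And>j ws. (\<lambda>k. mean (N (\<sigma> k)) (\<lambda>n. of_bool
       (1 / real (Hp k) \<le> norm_T (\<Sum>i=1..d j. of_int (ws ! (i - 1)) * \<alpha> j i n) \<and>
        norm_T (\<Sum>i=1..d j. of_int (ws ! (i - 1)) * \<alpha> j i n) < 1 / real (Hm k)))) \<longlonglongrightarrow> 0"
    "\<And>j \<eta>. \<eta> > 0 \<Longrightarrow> \<forall>\<^sub>F k in sequentially.
       mean (N (\<sigma> k)) (\<lambda>n. (cmod (trig_sum (d j) (c j) (\<alpha> j) n - of_real (f_str n)))\<^sup>2)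
         \<le> 6 / real (Suc j) + \<eta>"
proof (rule stage_sequence[OF assms])
  fix \<sigma> Hm Hp d :: "nat \<Rightarrow> nat"
    and c :: "nat \<Rightarrow> nat \<Rightarrow> nat \<Rightarrow> nat \<Rightarrow> complex" and \<alpha> :: "nat \<Rightarrow> nat \<Rightarrow> nat \<Rightarrow> nat \<Rightarrow> real"
  assume \<sigma>: "strict_mono \<sigma>"
    and H: "Hm \<prec> Hp" "\<And>k. Km (\<sigma> k) \<le> Hm k" "\<And>k. Hm k \<le> Hp k" "\<And>k. Hp k \<le> Kp (\<sigma> k)"
    and lac: "\<And>k. (k + 2) * N (\<sigma> k) \<le> N (\<sigma> (Suc k))"
    and d: "\<And>j. d j \<ge> 1" and c: "\<And>j k i n. cmod (c j k i n) \<le> 1"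
    and br: "\<And>j k i. i \<in> {1..d j} \<Longrightarrow>
       card (breaks (N (\<sigma> k)) (\<lambda>n. (c j k i n, \<alpha> j k i n))) * Hp k \<le> d j * N (\<sigma> k)"
    and close: "\<And>j k. k \<ge> 1 \<Longrightarrow> j \<le> k \<Longrightarrow> mean (N (\<sigma> k)) (\<lambda>n. (cmod (trig_sum (d j) (c j k) (\<alpha> j k) n -
        of_real (clamp01 (Re (trig_sum (d k) (c k k) (\<alpha> k k) n)))))\<^sup>2) \<le> 3 / real (Suc j) + 3 / real (Suc k)"
    and corr: "\<And>k \<phi>. k \<ge> 1 \<Longrightarrow> local_char (N (\<sigma> k)) (Hm k) 2 \<phi> \<Longrightarrow>
        mean (N (\<sigma> k)) (\<lambda>n. (f n - clamp01 (Re (trig_sum (d k) (c k k) (\<alpha> k k) n))) * Re (\<phi> n))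
          \<le> 2 * sqrt (1 / real (Suc k))"
    and gap: "\<And>j ws. (\<lambda>k. mean (N (\<sigma> k)) (\<lambda>n. of_bool
       (1 / real (Hp k) \<le> norm_T (\<Sum>i=1..d j. of_int (ws ! (i - 1)) * \<alpha> j k i n) \<and>
        norm_T (\<Sum>i=1..d j. of_int (ws ! (i - 1)) * \<alpha> j k i n) < 1 / real (Hm k)))) \<longlonglongrightarrow> 0"
  define M where "M k = N (\<sigma> k)" for k
  have M1: "M k \<ge> 1" for k using pos(1) by (simp add: M_def pos_seq_def)
  have Mk: "real (M k) > 0" for k using M1[of k] by simp
  have M_Suc: "M k < M (Suc k)" for k
  proof -
    have "(k + 1) * M k + M k \<le> M (Suc k)" using lac[of k] by (simp add: M_def)
    moreover have "(k + 1) * M k \<ge> 1" using M1[of k] by simp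
    ultimately show ?thesis by linarith
  qed
  then have M_mono: "strict_mono M" by (simp add: strict_mono_Suc_iff)
  \<comment> \<open>Stage \<open>k\<close> owns \<open>{m k<..M k}\<close>, with
    \<open>m 0 = 0\<close>, and \<open>\<kappa> n\<close> below is the stage that owns
    \<open>n\<close>.\<close>
  define m where "m k = (case k of 0 \<Rightarrow> 0 | Suc l \<Rightarrow> M l)" for k
  define \<kappa> where "\<kappa> n = (LEAST k. n \<le> M k)" for n
  have \<kappa>: "\<kappa> n = k" if "n \<in> {m k<..M k}" for n k
    unfolding \<kappa>_def
  proof (rule Least_equality)
    show "n \<le> M k" using that by simp
    fix l assume l: "n \<le> M l"
    show "k \<le> l"
    proof (rule ccontr)
      assume "\<not> k \<le> l"
      then obtain k' where k': "k = Suc k'" "l \<le> k'" by (cases k) auto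
      then have "M l \<le> m k" using strict_mono_less_eq[OF M_mono] by (simp add: m_def)
      then show False using l that by simp
    qed
  qed
  have mM: "m k \<le> M k" for k
    using M_Suc by (cases k) (auto simp: m_def less_imp_le)
  have m_lim: "(\<lambda>k. real (m k) / real (M k)) \<longlonglongrightarrow> 0"
  proof (rule tendsto_sandwich[OF _ _ tendsto_const])
    show "\<forall>\<^sub>F k in sequentially. 0 \<le> real (m k) / real (M k)" by simp
    show "(\<lambda>k. 1 / real (Suc k)) \<longlonglongrightarrow> 0" by (rule LIMSEQ_Suc[OF lim_1_over_n])
    show "\<forall>\<^sub>F k in sequentially. real (m k) / real (M k) \<le> 1 / real (Suc k)"
    proof (intro always_eventually allI)
      fix k
      show "real (m k) / real (M k) \<le> 1 / real (Suc k)"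
      proof (cases k)
        case (Suc l)
        have "real ((l + 2) * M l) \<le> real (M k)"
          using lac[of l] unfolding M_def Suc by (rule of_nat_mono)
        then have "real (Suc k) * real (m k) \<le> real (M k)" by (simp add: m_def Suc algebra_simps)
        then show ?thesis using Mk[of k] by (simp add: field_simps)
      qed (simp add: m_def)
    qed
  qed
  define fs where "fs k n = clamp01 (Re (trig_sum (d k) (c k k) (\<alpha> k k) n))" for k n
  define f_str where "f_str n = fs (\<kappa> n) n" for n
  define cg where "cg j i n = c j (\<kappa> n) i n" for j i n
  define ag where "ag j i n = \<alpha> j (\<kappa> n) i n" for j i n
  have fs01: "0 \<le> fs k n" "fs k n \<le> 1" for k n by (simp_all add: fs_def clamp01_bounds)
  have str01: "0 \<le> f_str n" "f_str n \<le> 1" for n by (simp_all add: f_str_def fs01)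
  have cg1: "cmod (cg j i n) \<le> 1" for j i n by (simp add: cg_def c)
  have tg: "trig_sum (d j) (cg j) (ag j) n = trig_sum (d j) (c j (\<kappa> n)) (\<alpha> j (\<kappa> n)) n" for j n
    by (simp add: trig_sum_def cg_def ag_def)
  have g1: "\<bar>f n - fs k n\<bar> \<le> 1" "\<bar>f n - f_str n\<bar> \<le> 1" if "n \<ge> 1" for n k
    using f[OF that] fs01[of k n] str01[of n] by (auto simp: abs_le_iff)
  have root_lim: "(\<lambda>k. sqrt (1 / real (Suc k))) \<longlonglongrightarrow> 0"
    using tendsto_real_sqrt[OF LIMSEQ_Suc[OF lim_1_over_n]] by simp

  \<comment> \<open>The constants 1 and -1 are local characters without breaks; testing
    \<open>corr\<close> against both bounds the mean in absolute value.\<close>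
  have mean_lim: "has_mean (N \<circ> \<sigma>) (\<lambda>n. f n - f_str n) 0"
    unfolding has_mean_iff o_def M_def[symmetric]
  proof (rule tendsto_rabs_zero_cancel, rule tendsto_sandwich[OF _ _ tendsto_const])
    show "\<forall>\<^sub>F k in sequentially. 0 \<le> \<bar>mean (M k) (\<lambda>n. f n - f_str n)\<bar>" by simp
    have "(\<lambda>k. 2 * sqrt (1 / real (Suc k)) + 1 * (real (m k) / real (M k))) \<longlonglongrightarrow> 2 * 0 + 1 * 0"
      by (intro tendsto_intros root_lim m_lim)
    then show "(\<lambda>k. 2 * sqrt (1 / real (Suc k)) + 1 * (real (m k) / real (M k))) \<longlonglongrightarrow> 0" by simp
    show "\<forall>\<^sub>F k in sequentially. \<bar>mean (M k) (\<lambda>n. f n - f_str n)\<bar>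
        \<le> 2 * sqrt (1 / real (Suc k)) + 1 * (real (m k) / real (M k))"
      using eventually_ge_at_top[of 1]
    proof eventually_elim
      case (elim k)
      have "mean (M k) (\<lambda>n. (f n - fs k n) * Re ((\<lambda>_. 1) n)) \<le> 2 * sqrt (1 / real (Suc k))"
        "mean (M k) (\<lambda>n. (f n - fs k n) * Re ((\<lambda>_. - 1) n)) \<le> 2 * sqrt (1 / real (Suc k))"
        unfolding M_def fs_def by (rule corr[OF elim local_char_const]; simp)+
      moreover have "mean (M k) (\<lambda>n. (f n - fs k n) * Re ((\<lambda>_. - 1) n)) = - mean (M k) (\<lambda>n. f n - fs k n)"
        using mean_cmult[of "M k" "-1" "\<lambda>n. f n - fs k n"] by simp
      ultimately have "\<bar>mean (M k) (\<lambda>n. f n - fs k n)\<bar> \<le> 2 * sqrt (1 / real (Suc k))" by simp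
      moreover have "\<bar>mean (M k) (\<lambda>n. f n - f_str n) - mean (M k) (\<lambda>n. f n - fs k n)\<bar>
          \<le> 1 * (real (m k) / real (M k))"
      proof (rule mean_change_prefix[OF mM])
        show "f n - f_str n = f n - fs k n" if "n \<in> {m k<..M k}" for n
          using \<kappa>[OF that] by (simp add: f_str_def)
        show "\<bar>f n - f_str n - (f n - fs k n)\<bar> \<le> 1" for n
          using fs01[of k n] str01[of n] by (auto simp: abs_le_iff)
      qed
      ultimately show ?case by linarith
    qed
  qed

  have U2_lim: "has_U2_norm (N \<circ> \<sigma>) Hm (\<lambda>n. of_real (f n - f_str n)) 0"
    unfolding has_U2_norm_def o_def M_def[symmetric]
  proof (rule tendsto_sandwich[OF _ _ tendsto_const])
    \<comment> \<open>The square root of the correlation bound, for which the terms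
      \<open>\<tau>\<close> and \<open>\<kappa> / \<tau>\<close> of
      \<open>sum_U2_interval_le\<close> coincide.\<close>
    define w where "w k = sqrt (2 * sqrt (1 / real (Suc k)))" for k
    have w: "w k > 0" for k by (simp add: w_def)
    show "\<forall>\<^sub>F k in sequentially. 0 \<le> 1 / real (M k - Hm k + 1) *
        (\<Sum>n=1..M k - Hm k + 1. U2_interval (\<lambda>n. of_real (f n - f_str n)) (n - 1) (Hm k))"
      by (intro always_eventually allI mult_nonneg_nonneg sum_nonneg U2_interval_nonneg) auto
    have "(\<lambda>k. 4 * (real (m k) / real (M k)) + 4 * w k) \<longlonglongrightarrow> 4 * 0 + 4 * sqrt (2 * 0)"
      unfolding w_def by (intro tendsto_intros root_lim m_lim)
    then show "(\<lambda>k. 4 * (real (m k) / real (M k)) + 4 * w k) \<longlonglongrightarrow> 0" by simp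
    have "\<forall>\<^sub>F k in sequentially. 2 * real (Hm k) \<le> real (Hp k)"
    proof (rule seq_less_eventually[OF H(1)])
      show "pos_seq Hp"
        unfolding pos_seq_def using H(2,3) pos(3) by (meson order_trans pos_seq_def)
    qed simp
    then show "\<forall>\<^sub>F k in sequentially. 1 / real (M k - Hm k + 1) *
        (\<Sum>n=1..M k - Hm k + 1. U2_interval (\<lambda>n. of_real (f n - f_str n)) (n - 1) (Hm k))
        \<le> 4 * (real (m k) / real (M k)) + 4 * w k"
      using eventually_ge_at_top[of 1]
    proof eventually_elim
      case (elim k)
      define L where "L = Hm k"
      have L1: "1 \<le> L" using H(2)[of k] pos(3) unfolding L_def pos_seq_def by (meson order_trans)
      have "Hp k \<le> M k" using H(4)[of k] le(2)[of "\<sigma> k"] by (simp add: M_def)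
      then have L2: "2 * L \<le> M k" using elim(1) by (simp add: L_def)
      define F G where "F x = U2_interval (\<lambda>n. of_real (f n - f_str n)) x L"
        and "G x = U2_interval (\<lambda>n. of_real (f n - fs k n)) x L" for x
      \<comment> \<open>A window with \<open>x \<ge> m k\<close> lies inside stage \<open>k\<close>,
        where glued and stage data agree; the others are bounded trivially.\<close>
      have "F x \<le> 2 * of_bool (x < m k) + G x" if "x \<le> M k - L" for x
      proof (cases "x < m k")
        case True
        have "F x \<le> 2" unfolding F_def
          by (rule U2_interval_le_2[OF L1]) (use g1 in \<open>auto simp del: of_real_diff\<close>)
        moreover have "0 \<le> G x" by (simp add: G_def U2_interval_nonneg)
        ultimately show ?thesis using True by simp
      next
        case False
        have "F x = G x" unfolding F_def G_def
        proof (rule U2_interval_cong)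
          fix i assume "i \<in> {1..L}"
          then have "x + i \<in> {m k<..M k}" using False that L2 by auto
          then show "complex_of_real (f (x + i) - f_str (x + i)) = of_real (f (x + i) - fs k (x + i))"
            using \<kappa>[of "x + i" k] by (simp add: f_str_def)
        qed
        then show ?thesis using False by simp
      qed
      then have "(\<Sum>x\<le>M k - L. F x) \<le> (\<Sum>x\<le>M k - L. 2 * of_bool (x < m k) + G x)"
        by (intro sum_mono) auto
      also have "\<dots> = 2 * real (card {x \<in> {..M k - L}. x < m k}) + (\<Sum>x\<le>M k - L. G x)"
        by (simp add: sum.distrib sum_distrib_left[symmetric] of_bool_def sum.If_cases Int_def)
      also have "\<dots> \<le> 2 * real (m k) + real (M k) * (w k + 2 * sqrt (1 / real (Suc k)) / w k)"
      proof (intro add_mono)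
        have "card {x \<in> {..M k - L}. x < m k} \<le> card {..<m k}" by (rule card_mono) auto
        then show "2 * real (card {x \<in> {..M k - L}. x < m k}) \<le> 2 * real (m k)" by simp
        show "(\<Sum>x\<le>M k - L. G x) \<le> real (M k) * (w k + 2 * sqrt (1 / real (Suc k)) / w k)"
          unfolding G_def
        proof (rule sum_U2_interval_le[OF L1 _ w])
          show "L \<le> M k" using L2 by simp
          show "\<bar>f n - fs k n\<bar> \<le> 1" if "n \<ge> 1" for n using g1(1)[OF that] .
          show "mean (M k) (\<lambda>n. (f n - fs k n) * Re (\<phi> n)) \<le> 2 * sqrt (1 / real (Suc k))"
            if "local_char (M k) L 2 \<phi>" for \<phi>
            using corr[OF elim(2), of \<phi>] that by (simp add: M_def L_def fs_def)
        qed
      qed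
      also have "2 * sqrt (1 / real (Suc k)) / w k = w k"
      proof -
        have "w k * w k = 2 * sqrt (1 / real (Suc k))" by (simp add: w_def)
        then show ?thesis using w[of k] by (simp add: field_simps)
      qed
      finally have le: "(\<Sum>x\<le>M k - L. F x) \<le> 2 * real (m k) + 2 * real (M k) * w k" by simp
      have "(\<Sum>n=1..M k - L + 1. F (n - 1)) = (\<Sum>x\<le>M k - L. F x)"
        by (rule sum.reindex_bij_witness[of _ Suc "\<lambda>n. n - 1"]) auto
      moreover have "real (M k) / 2 \<le> real (M k - L + 1)" using L2 by (simp add: of_nat_diff)
      ultimately have "1 / real (M k - L + 1) * (\<Sum>n=1..M k - L + 1. F (n - 1))
          \<le> (2 * real (m k) + 2 * real (M k) * w k) / (real (M k) / 2)"
        using le Mk[of k] w[of k] by (simp only: mult_1 times_divide_eq_left) (intro frac_le; simp)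
      also have "\<dots> = 4 * (real (m k) / real (M k)) + 4 * w k"
        using Mk[of k] by (simp add: field_simps)
      finally show ?case by (simp only: F_def L_def)
    qed
  qed

  \<comment> \<open>The junction at \<open>m k\<close> may be a new break, but
    \<open>m k < n\<close> excludes it; beyond it \<open>n\<close> and \<open>Suc n\<close> belong
    to the same stage.\<close>
  have breaks_glued: "card {n \<in> breaks (M k) (\<lambda>n. (cg j i n, ag j i n)). m k < n} * Hp k \<le> d j * M k"
    if "i \<in> {1..d j}" for j k i
  proof -
    have "{n \<in> breaks (M k) (\<lambda>n. (cg j i n, ag j i n)). m k < n}
        \<subseteq> breaks (M k) (\<lambda>n. (c j k i n, \<alpha> j k i n))"
    proof
      fix n assume n: "n \<in> {n \<in> breaks (M k) (\<lambda>n. (cg j i n, ag j i n)). m k < n}"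
      then have "\<kappa> n = k" "\<kappa> (Suc n) = k" by (auto intro!: \<kappa> simp: breaks_def)
      then show "n \<in> breaks (M k) (\<lambda>n. (c j k i n, \<alpha> j k i n))"
        using n by (simp add: breaks_def cg_def ag_def)
    qed
    then have "card {n \<in> breaks (M k) (\<lambda>n. (cg j i n, ag j i n)). m k < n}
        \<le> card (breaks (M k) (\<lambda>n. (c j k i n, \<alpha> j k i n)))" by (intro card_mono) auto
    then show ?thesis using br[OF that, of k] mult_le_mono1 order_trans unfolding M_def by blast
  qed

  have gap_glued: "(\<lambda>k. mean (M k) (\<lambda>n. of_bool
       (1 / real (Hp k) \<le> norm_T (\<Sum>i=1..d j. of_int (ws ! (i - 1)) * ag j i n) \<and>
        norm_T (\<Sum>i=1..d j. of_int (ws ! (i - 1)) * ag j i n) < 1 / real (Hm k)))) \<longlonglongrightarrow> 0" for j ws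
  proof -
    define X where "X k x \<longleftrightarrow> 1 / real (Hp k) \<le> x \<and> x < 1 / real (Hm k)" for k and x :: real
    define A B where "A k = mean (M k) (\<lambda>n. of_bool (X k (norm_T (\<Sum>i=1..d j. of_int (ws ! (i - 1)) * ag j i n))))"
      and "B k = mean (M k) (\<lambda>n. of_bool (X k (norm_T (\<Sum>i=1..d j. of_int (ws ! (i - 1)) * \<alpha> j k i n))))" for k
    have B: "B \<longlonglongrightarrow> 0" using gap[of ws j] by (simp add: B_def[abs_def] X_def M_def)
    have "(\<lambda>k. A k - B k) \<longlonglongrightarrow> 0"
    proof (rule tendsto_rabs_zero_cancel, rule tendsto_sandwich[OF _ _ tendsto_const])
      show "\<forall>\<^sub>F k in sequentially. 0 \<le> \<bar>A k - B k\<bar>" by simp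
      show "(\<lambda>k. 1 * (real (m k) / real (M k))) \<longlonglongrightarrow> 0" using m_lim by simp
      show "\<forall>\<^sub>F k in sequentially. \<bar>A k - B k\<bar> \<le> 1 * (real (m k) / real (M k))"
        unfolding A_def B_def
      proof (intro always_eventually allI mean_change_prefix[OF mM])
        fix k n assume "n \<in> {m k<..M k}"
        then have "\<kappa> n = k" by (rule \<kappa>)
        then show "of_bool (X k (norm_T (\<Sum>i=1..d j. of_int (ws ! (i - 1)) * ag j i n)))
          = (of_bool (X k (norm_T (\<Sum>i=1..d j. of_int (ws ! (i - 1)) * \<alpha> j k i n))) :: real)"
          by (simp add: ag_def)
      qed (simp add: of_bool_def)
    qed
    from tendsto_add[OF this B] have "A \<longlonglongrightarrow> 0" by simp
    then show ?thesis by (simp add: A_def[abs_def] X_def)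
  qed

  \<comment> \<open>The bound \<open>close\<close> asks for \<open>j \<le> k\<close>, and then
    \<open>3 / Suc k \<le> 3 / Suc j\<close>; this is the origin of the 6.\<close>
  have L2_glued: "\<forall>\<^sub>F k in sequentially.
      mean (M k) (\<lambda>n. (cmod (trig_sum (d j) (cg j) (ag j) n - of_real (f_str n)))\<^sup>2)
         \<le> 6 / real (Suc j) + \<eta>" if "\<eta> > 0" for j \<eta>
  proof -
    define B where "B = (real (d j) + 1)\<^sup>2"
    have bound: "(cmod (trig_sum (d j) (c j k) (\<alpha> j k) n - of_real (fs l n)))\<^sup>2 \<le> B" for k l n
    proof -
      have "cmod (trig_sum (d j) (c j k) (\<alpha> j k) n - of_real (fs l n)) \<le> real (d j) + 1"
        using norm_triangle_ineq4[of "trig_sum (d j) (c j k) (\<alpha> j k) n" "of_real (fs l n)"]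
          norm_trig_sum_le[of "c j k" "d j" "\<alpha> j k" n] c fs01[of l n] by simp
      then show ?thesis unfolding B_def by (intro power_mono) auto
    qed
    have "(\<lambda>k. B * (real (m k) / real (M k))) \<longlonglongrightarrow> B * 0" by (intro tendsto_intros m_lim)
    then have "\<forall>\<^sub>F k in sequentially. B * (real (m k) / real (M k)) < \<eta>"
      using that by (intro order_tendstoD(2)) auto
    then show ?thesis using eventually_ge_at_top[of "max 1 j"]
    proof eventually_elim
      case (elim k)
      have "\<bar>mean (M k) (\<lambda>n. (cmod (trig_sum (d j) (cg j) (ag j) n - of_real (f_str n)))\<^sup>2)
          - mean (M k) (\<lambda>n. (cmod (trig_sum (d j) (c j k) (\<alpha> j k) n - of_real (fs k n)))\<^sup>2)\<bar>
          \<le> B * (real (m k) / real (M k))"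
      proof (rule mean_change_prefix[OF mM])
        fix n assume "n \<in> {m k<..M k}"
        then have "\<kappa> n = k" by (rule \<kappa>)
        then show "(cmod (trig_sum (d j) (cg j) (ag j) n - of_real (f_str n)))\<^sup>2
          = (cmod (trig_sum (d j) (c j k) (\<alpha> j k) n - of_real (fs k n)))\<^sup>2"
          by (simp add: tg f_str_def)
      next
        fix n
        have "\<bar>x - y\<bar> \<le> B" if "0 \<le> x" "x \<le> B" "0 \<le> y" "y \<le> B" for x y using that by linarith
        then show "\<bar>(cmod (trig_sum (d j) (cg j) (ag j) n - of_real (f_str n)))\<^sup>2
          - (cmod (trig_sum (d j) (c j k) (\<alpha> j k) n - of_real (fs k n)))\<^sup>2\<bar> \<le> B"
          unfolding tg f_str_def using bound by simp
      qed
      moreover have "mean (M k) (\<lambda>n. (cmod (trig_sum (d j) (c j k) (\<alpha> j k) n - of_real (fs k n)))\<^sup>2)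
          \<le> 3 / real (Suc j) + 3 / real (Suc k)"
        using close[of k j] elim(2) unfolding M_def fs_def by simp
      moreover have "3 / real (Suc k) \<le> 3 / real (Suc j)" using elim(2) by (intro divide_left_mono) auto
      moreover have "6 / real (Suc j) = 3 / real (Suc j) + 3 / real (Suc j)" by simp
      ultimately show ?case using elim(1) by linarith
    qed
  qed

  show thesis
    by (rule that[of \<sigma> Hm Hp f_str m d cg ag])
      (use \<sigma> H d cg1 str01 mean_lim U2_lim m_lim breaks_glued gap_glued L2_glued in
        \<open>simp_all add: M_def\<close>)
qed

theorem theorem8p7:
  fixes f :: "nat \<Rightarrow> real" and N Kp Km :: "nat \<Rightarrow> nat"
  assumes "\<forall>n\<ge>1. 0 \<le> f n \<and> f n \<le> 1"
    and "pos_seq N" and "pos_seq Kp" and "pos_seq Km"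
    and "seq_at_top Km" and "Km \<prec> Kp" and "Kp \<preceq> N"
  shows "\<exists>\<sigma> :: nat \<Rightarrow> nat. strict_mono \<sigma> \<and>
    (\<exists>Hp Hm. pos_seq Hp \<and> pos_seq Hm \<and>
       (Km \<circ> \<sigma>) \<preceq> Hm \<and> Hm \<prec> Hp \<and> Hp \<preceq> (Kp \<circ> \<sigma>) \<and>
       (\<forall>H. pos_seq H \<longrightarrow> Hm \<prec> H \<longrightarrow> H \<prec> Hp \<longrightarrow> U2_good_scale (N \<circ> \<sigma>) H f))"
proof -
  \<comment> \<open>These inequalities hold only eventually, whereas the lemmas ask for them
    everywhere. The sequences are shifted by \<open>s0\<close>, and the final subsequence
    \<open>\<tau>\<close> absorbs the shift.\<close>
  have "\<forall>\<^sub>F s in sequentially. Km s \<le> Kp s \<and> Kp s \<le> N s"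
    using seq_less_eventually[OF assms(6,3) zero_less_one] assms(7)[unfolded seq_le_def]
    by eventually_elim simp
  then obtain s0 where s0: "\<And>s. s \<ge> s0 \<Longrightarrow> Km s \<le> Kp s \<and> Kp s \<le> N s"
    by (auto simp: eventually_sequentially)
  define N' Kp' Km' where "N' s = N (s + s0)" and "Kp' s = Kp (s + s0)" and "Km' s = Km (s + s0)" for s
  have f: "0 \<le> f n \<and> f n \<le> 1" if "n \<ge> 1" for n using assms(1) that by blast
  have pos: "pos_seq N'" "pos_seq Kp'" "pos_seq Km'"
    using assms(2-4) by (simp_all add: pos_seq_def N'_def Kp'_def Km'_def)
  have top: "seq_at_top Km'"
    using assms(5) filterlim_compose[OF _ filterlim_add_const_nat_at_top, of Km at_top s0]
    by (simp add: seq_at_top_def Km'_def[abs_def])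
  have less: "Km' \<prec> Kp'"
    using LIMSEQ_ignore_initial_segment[OF assms(6)[unfolded seq_less_def], of s0]
    by (simp add: seq_less_def Km'_def Kp'_def)
  have le: "Km' s \<le> Kp' s" "Kp' s \<le> N' s" for s
    using s0[of "s + s0"] by (simp_all add: N'_def Kp'_def Km'_def)
  show ?thesis
  proof (rule glued_decomposition[OF f pos top less le])
    fix \<sigma> Hm Hp d m :: "nat \<Rightarrow> nat" and f_str :: "nat \<Rightarrow> real"
      and c :: "nat \<Rightarrow> nat \<Rightarrow> nat \<Rightarrow> complex" and \<alpha> :: "nat \<Rightarrow> nat \<Rightarrow> nat \<Rightarrow> real"
    assume \<sigma>: "strict_mono \<sigma>"
      and H: "Hm \<prec> Hp" "\<And>k. Km' (\<sigma> k) \<le> Hm k" "\<And>k. Hm k \<le> Hp k" "\<And>k. Hp k \<le> Kp' (\<sigma> k)"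
      and str: "\<And>n. 0 \<le> f_str n \<and> f_str n \<le> 1"
      and mn: "has_mean (N' \<circ> \<sigma>) (\<lambda>n. f n - f_str n) 0"
      and U2: "has_U2_norm (N' \<circ> \<sigma>) Hm (\<lambda>n. of_real (f n - f_str n)) 0"
      and m: "(\<lambda>k. real (m k) / real (N' (\<sigma> k))) \<longlonglongrightarrow> 0"
      and d: "\<And>j. d j \<ge> 1" and c: "\<And>j i n. cmod (c j i n) \<le> 1"
      and br: "\<And>j k i. i \<in> {1..d j} \<Longrightarrow>
       card {n \<in> breaks (N' (\<sigma> k)) (\<lambda>n. (c j i n, \<alpha> j i n)). m k < n} * Hp k \<le> d j * N' (\<sigma> k)"
      and gap: "\<And>j ws. (\<lambda>k. mean (N' (\<sigma> k)) (\<lambda>n. of_bool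
       (1 / real (Hp k) \<le> norm_T (\<Sum>i=1..d j. of_int (ws ! (i - 1)) * \<alpha> j i n) \<and>
        norm_T (\<Sum>i=1..d j. of_int (ws ! (i - 1)) * \<alpha> j i n) < 1 / real (Hm k)))) \<longlonglongrightarrow> 0"
      and L2: "\<And>j \<eta>. \<eta> > 0 \<Longrightarrow> \<forall>\<^sub>F k in sequentially.
       mean (N' (\<sigma> k)) (\<lambda>n. (cmod (trig_sum (d j) (c j) (\<alpha> j) n - of_real (f_str n)))\<^sup>2)
         \<le> 6 / real (Suc j) + \<eta>"
    \<comment> \<open>Only an upper bound for the squared distances is known so far, while
      \<open>has_L2_norm\<close> demands that the limit exist. A further subsequence makes it exist
      for all levels \<open>j\<close> at once.\<close>
    define y where "y k j = mean (N' (\<sigma> k)) (\<lambda>n. (cmod (trig_sum (d j) (c j) (\<alpha> j) n - of_real (f_str n)))\<^sup>2)" for k j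
    have "\<bar>y k j\<bar> \<le> (real (d j) + 1)\<^sup>2" for k j
    proof -
      have "(cmod (trig_sum (d j) (c j) (\<alpha> j) n - of_real (f_str n)))\<^sup>2 \<le> (real (d j) + 1)\<^sup>2" for n
        using norm_triangle_ineq4[of "trig_sum (d j) (c j) (\<alpha> j) n" "of_real (f_str n)"]
          norm_trig_sum_le[of "c j" "d j" "\<alpha> j" n] c str[of n] by (intro power_mono) auto
      then have "y k j \<le> (real (d j) + 1)\<^sup>2"
        unfolding y_def using pos(1) by (intro mean_le) (auto simp: pos_seq_def)
      moreover have "0 \<le> y k j" unfolding y_def by (intro mean_nonneg) auto
      ultimately show ?thesis by simp
    qed
    then obtain t where t: "strict_mono (t :: nat \<Rightarrow> nat)" "\<And>j. convergent (\<lambda>k. y (t k) j)"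
      using bounded_family_convergent_subseq[of y "\<lambda>j. (real (d j) + 1)\<^sup>2"] by blast
    have ylim: "\<exists>l\<le>6 / real (Suc j). (\<lambda>k. y (t k) j) \<longlonglongrightarrow> l" for j
    proof -
      obtain l where l: "(\<lambda>k. y (t k) j) \<longlonglongrightarrow> l" using t(2)[of j] by (auto simp: convergent_def)
      have "l \<le> 6 / real (Suc j) + \<eta>" if "\<eta> > 0" for \<eta>
      proof (rule tendsto_upperbound[OF l])
        show "\<forall>\<^sub>F k in sequentially. y (t k) j \<le> 6 / real (Suc j) + \<eta>"
          using eventually_subseq[OF t(1) L2[OF that, of j]] by (simp add: y_def)
      qed simp
      then have "l \<le> 6 / real (Suc j)" by (rule field_le_epsilon)
      with l show ?thesis by blast
    qed
    define M where "M = N' \<circ> \<sigma> \<circ> t"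
    have Hmt: "pos_seq (Hm \<circ> t)" and Hpt: "pos_seq (Hp \<circ> t)"
    proof -
      have "1 \<le> Hm k" for k using H(2)[of k] pos(3) unfolding pos_seq_def by (meson order_trans)
      then show "pos_seq (Hm \<circ> t)" "pos_seq (Hp \<circ> t)"
        using H(3) unfolding pos_seq_def o_def by (meson order_trans)+
    qed
    have good: "U2_good_scale M H f" if "pos_seq H" "Hm \<circ> t \<prec> H" "H \<prec> Hp \<circ> t" for H :: "nat \<Rightarrow> nat"
    proof (rule U2_good_scaleI[where m = "m \<circ> t" and d = d and c = c and \<alpha> = \<alpha> and f_str = f_str,
          OF _ Hmt Hpt _ _ str _ _ _ d c _ _ _ that])
      show "pos_seq M" using pos(1) by (simp add: M_def pos_seq_def)
      show "(Hp \<circ> t) k \<le> M k" for k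
        using H(4)[of "t k"] le(2)[of "\<sigma> (t k)"] by (simp add: M_def)
      have "filterlim (\<lambda>k. Km' (\<sigma> (t k))) at_top sequentially"
        using filterlim_compose[OF top[unfolded seq_at_top_def] filterlim_subseq[OF strict_mono_o[OF \<sigma> t(1)]]]
        by (simp add: o_def)
      then show "filterlim (Hm \<circ> t) at_top sequentially"
        by (rule filterlim_at_top_mono) (simp add: H(2))
      show "has_mean M (\<lambda>n. f n - f_str n) 0"
        using LIMSEQ_subseq_LIMSEQ[OF mn[unfolded has_mean_iff] t(1)]
        by (simp add: has_mean_iff M_def o_def)
      show "has_U2_norm M (Hm \<circ> t) (\<lambda>n. of_real (f n - f_str n)) 0"
        using LIMSEQ_subseq_LIMSEQ[OF U2[unfolded has_U2_norm_def] t(1)]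
        by (simp add: has_U2_norm_def M_def o_def)
      show "(\<lambda>k. real ((m \<circ> t) k) / real (M k)) \<longlonglongrightarrow> 0"
        using LIMSEQ_subseq_LIMSEQ[OF m t(1)] by (simp add: M_def o_def)
      show "card {n \<in> breaks (M k) (\<lambda>n. (c j i n, \<alpha> j i n)). (m \<circ> t) k < n} * (Hp \<circ> t) k \<le> d j * M k"
        if "i \<in> {1..d j}" for j k i
        using br[OF that, of "t k"] by (simp add: M_def)
      show "(\<lambda>k. mean (M k) (\<lambda>n. of_bool
       (1 / real ((Hp \<circ> t) k) \<le> norm_T (\<Sum>i=1..d j. of_int (ws ! (i - 1)) * \<alpha> j i n) \<and>
        norm_T (\<Sum>i=1..d j. of_int (ws ! (i - 1)) * \<alpha> j i n) < 1 / real ((Hm \<circ> t) k)))) \<longlonglongrightarrow> 0" for j ws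
        using LIMSEQ_subseq_LIMSEQ[OF gap[of ws j] t(1)] by (simp add: M_def o_def)
      show "\<exists>l\<le>6 / real (Suc j).
         has_mean M (\<lambda>n. (cmod (trig_sum (d j) (c j) (\<alpha> j) n - of_real (f_str n)))\<^sup>2) l" for j
        using ylim[of j] by (simp add: has_mean_iff M_def y_def)
    qed
    define \<tau> where "\<tau> k = \<sigma> (t k) + s0" for k
    have \<tau>: "strict_mono \<tau>"
      using strict_mono_o[OF \<sigma> t(1)] by (simp add: \<tau>_def strict_mono_def)
    have M\<tau>: "N \<circ> \<tau> = M" by (auto simp: M_def \<tau>_def N'_def)
    have "(Hm \<circ> t) \<prec> (Hp \<circ> t)"
      using LIMSEQ_subseq_LIMSEQ[OF H(1)[unfolded seq_less_def] t(1)] by (simp add: seq_less_def o_def)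
    moreover have "(Km \<circ> \<tau>) \<preceq> (Hm \<circ> t)" "(Hp \<circ> t) \<preceq> (Kp \<circ> \<tau>)"
      using H(2,4) by (simp_all add: seq_le_def \<tau>_def Km'_def Kp'_def)
    ultimately show ?thesis
      using \<tau> Hmt Hpt good unfolding M\<tau>[symmetric] by blast
  qed
qed

end
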